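(* Let $\zeta$ be the Riemann zeta function. As distributions on $\mathbb{R}$, $$e^{-t/2}W_{1/2}(\zeta)(t)+e^{t/2}W_{1/2}(\zeta)(-t)=2c_0(\zeta,1/2)\,\delta_0-\sum_{p,\,k\ge1}(\log p)\,p^{-k/2}\big(\delta_{k\log p}+\delta_{-k\log p}\big),$$ where $p$ runs over prime numbers, the left-hand side is formally $\sum_\rho n_\rho e^{(\rho-1/2)|t|}$, and $$c_0(\zeta,1/2)=-\frac{\log\pi}{2}-\frac{\pi}{4}-\frac{\gamma}{2}-\frac32\log 2,$$ with $\gamma$ the Euler constant.
   Context: $\zeta$ extends meromorphically to $\mathbb{C}$, of order $1$, with convergence exponent $d=2$ and genus $1$; $n_\rho$ is the multiplicity of $\rho$ as zero of $\zeta$ ($n_1=-1$ for the pole at $1$). For $\sigma\in\mathbb{C}$: $K_{2,\sigma}(t)=\big(n_\sigma\tfrac{t^2}{2}+\sum_{\rho\ne\sigma}\tfrac{n_\rho}{(\rho-\sigma)^2}e^{(\rho-\sigma)t}\big)\mathbf{1}_{\mathbb{R}_+}(t)$ and $W_\sigma(\zeta)=e^{\sigma t}\frac{D^2}{Dt^2}\big((K_{2,\sigma}(t)-K_{2,\sigma}(0))\mathbf{1}_{\mathbb{R}_+}\big)$ (distributional derivative); $W(-t)$ denotes the reflected distribution. With $E_1(z)=(1-z)e^z$ and Hadamard factorization $\zeta(s)=(s-\sigma)^{n_\sigma}e^{Q_{\zeta,\sigma}(s)}\prod_{\rho\ne\sigma}E_1(\frac{s-\sigma}{\rho-\sigma})^{n_\rho}$,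 $c_0(\zeta,\sigma)$ denotes the constant $-Q'_{\zeta,\sigma}$. *)

theory Defs
  imports "HOL-Complex_Analysis.Complex_Analysis" "HOL-Computational_Algebra.Polynomial"
begin

section \<open>The Riemann zeta function\<close>

text \<open>
  The meromorphic extension to the whole plane of the Dirichlet series. The requirement
  ``nicely meromorphic'' fixes the value at poles to be 0 and excludes removable
  discontinuities, so the extension is a unique total function.
\<close>

definition riemann_zeta :: "complex \<Rightarrow> complex" where
  "riemann_zeta = (THE f. f nicely_meromorphic_on UNIV \<and>
     (\<forall>s. Re s > 1 \<longrightarrow> f s = (\<Sum>n. 1 / of_nat (Suc n) powr s)))"

section \<open>Divisor and Hadamard factorization\<close>

text \<open>
  The integer \<open>n\<^sub>\<rho>\<close> is \<open>zorder f \<rho>\<close>: positive at zeros, negative at poles, 0 elsewhere.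
\<close>

definition divisor_support :: "(complex \<Rightarrow> complex) \<Rightarrow> complex set" where
  "divisor_support f = {\<rho>. zorder f \<rho> \<noteq> 0}"

text \<open>
  Factorization of genus at most 1 (convergence exponent 2), centred at \<open>\<sigma>\<close>, with
  exponential factor \<open>exp Q\<close>. The library's \<open>weierstrass_factor 1 z\<close> is
  \<open>E\<^sub>1(z) = (1 - z) exp z\<close>. The product is the unordered limit of finite subproducts,
  and the identity is required at every point which is not a pole.
\<close>

definition hadamard_factorization ::
    "(complex \<Rightarrow> complex) \<Rightarrow> complex \<Rightarrow> complex poly \<Rightarrow> bool" where
  "hadamard_factorization f \<sigma> Q \<longleftrightarrow> degree Q \<le> 1 \<and>
     (\<forall>s. zorder f s \<ge> 0 \<longrightarrow>
        (\<exists>P. ((\<lambda>F. \<Prod>\<rho>\<in>F. weierstrass_factor 1 ((s - \<sigma>) / (\<rho> - \<sigma>)) powi zorder f \<rho>)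
                \<longlongrightarrow> P) (finite_subsets_at_top (divisor_support f - {\<sigma>})) \<and>
             f s = (s - \<sigma>) powi zorder f \<sigma> * exp (poly Q s) * P))"

definition c0 :: "(complex \<Rightarrow> complex) \<Rightarrow> complex \<Rightarrow> complex" where
  "c0 f \<sigma> = (THE c. \<exists>Q. hadamard_factorization f \<sigma> Q \<and> - pderiv Q = [:c:])"

section \<open>Distributions on the real line\<close>

definition iter_deriv :: "nat \<Rightarrow> (real \<Rightarrow> complex) \<Rightarrow> real \<Rightarrow> complex" where
  "iter_deriv n \<phi> = ((\<lambda>g t. vector_derivative g (at t)) ^^ n) \<phi>"

definition supp :: "(real \<Rightarrow> complex) \<Rightarrow> real set" where
  "supp \<phi> = closure {t. \<phi> t \<noteq> 0}"

definition test_function :: "(real \<Rightarrow> complex) \<Rightarrow> bool" where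
  "test_function \<phi> \<longleftrightarrow>
     (\<forall>n t. iter_deriv n \<phi> differentiable (at t)) \<and> compact (supp \<phi>)"

text \<open>
  A distribution is represented by a functional on all functions of which only the values on
  test functions matter; hence the equality \<open>distribution_eq\<close> instead of \<open>=\<close>.
  Continuity is expressed by the usual seminorm estimates.
\<close>

type_synonym functional = "(real \<Rightarrow> complex) \<Rightarrow> complex"

definition is_distribution :: "functional \<Rightarrow> bool" where
  "is_distribution T \<longleftrightarrow>
     (\<forall>\<phi> \<psi>. test_function \<phi> \<longrightarrow> test_function \<psi> \<longrightarrow> T (\<lambda>t. \<phi> t + \<psi> t) = T \<phi> + T \<psi>) \<and>
     (\<forall>a \<phi>. test_function \<phi> \<longrightarrow> T (\<lambda>t. a * \<phi> t) = a * T \<phi>) \<and>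
     (\<forall>K. compact K \<longrightarrow> (\<exists>C N. \<forall>\<phi>. test_function \<phi> \<longrightarrow> supp \<phi> \<subseteq> K \<longrightarrow>
        norm (T \<phi>) \<le> C * (\<Sum>j\<le>N. SUP t. norm (iter_deriv j \<phi> t))))"

definition distribution_eq :: "functional \<Rightarrow> functional \<Rightarrow> bool" where
  "distribution_eq S T \<longleftrightarrow> is_distribution S \<and> is_distribution T \<and>
     (\<forall>\<phi>. test_function \<phi> \<longrightarrow> S \<phi> = T \<phi>)"

definition function_distr :: "(real \<Rightarrow> complex) \<Rightarrow> functional" where
  "function_distr f = (\<lambda>\<phi>. LINT t|lborel. f t * \<phi> t)"

definition dirac :: "real \<Rightarrow> functional" where
  "dirac a = (\<lambda>\<phi>. \<phi> a)"

definition distr_deriv :: "functional \<Rightarrow> functional" where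
  "distr_deriv T = (\<lambda>\<phi>. - T (\<lambda>t. vector_derivative \<phi> (at t)))"

definition distr_mult :: "(real \<Rightarrow> complex) \<Rightarrow> functional \<Rightarrow> functional" where
  "distr_mult g T = (\<lambda>\<phi>. T (\<lambda>t. g t * \<phi> t))"

text \<open>The distribution \<open>T(-t)\<close>.\<close>

definition distr_reflect :: "functional \<Rightarrow> functional" where
  "distr_reflect T = (\<lambda>\<phi>. T (\<lambda>t. \<phi> (- t)))"

section \<open>The Newton-Cramer distribution for convergence exponent 2\<close>

definition K2 :: "(complex \<Rightarrow> complex) \<Rightarrow> complex \<Rightarrow> real \<Rightarrow> complex" where
  "K2 f \<sigma> t =
     (of_int (zorder f \<sigma>) * of_real (t\<^sup>2 / 2) +
      (\<Sum>\<^sub>\<infinity>\<rho>\<in>divisor_support f - {\<sigma>}.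
         of_int (zorder f \<rho>) / (\<rho> - \<sigma>)\<^sup>2 * exp ((\<rho> - \<sigma>) * of_real t)))
     * indicator {0..} t"

definition W :: "(complex \<Rightarrow> complex) \<Rightarrow> complex \<Rightarrow> functional" where
  "W f \<sigma> = distr_mult (\<lambda>t. exp (\<sigma> * of_real t))
     (distr_deriv (distr_deriv
        (function_distr (\<lambda>t. (K2 f \<sigma> t - K2 f \<sigma> 0) * indicator {0..} t))))"

end

theory Submission
  imports Defs "HOL-Real_Asymp.Real_Asymp" "HOL-Probability.Probability" "HOL-Number_Theory.Number_Theory"
begin

text \<open>
  The theta inversion formula continues \<open>(s - 1) \<zeta>(s)\<close> to an entire function whose growth is
  at most \<open>exp (C r powr (3/2))\<close>, so Hadamard's theorem applies; the functional equation gives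
  its logarithmic derivative at \<open>1/2\<close> and hence \<open>c\<^sub>0(\<zeta>, 1/2)\<close>. Differentiating the product
  logarithmically at \<open>s = z + 1/2\<close> and dividing by \<open>z\<^sup>2\<close> yields an identity of Laplace transforms:
  on the left that of \<open>K\<^sub>2(t) - K\<^sub>2(0)\<close>, on the right that of
  \<open>c\<^sub>0 t - (\<Sum>n. \<Lambda>(n) n powr (-1/2) max 0 (t - ln n))\<close>. Both functions are continuous, so they agree
  for \<open>t \<ge> 0\<close> by Lerch's theorem. The explicit formula is the second derivative of this identity,
  symmetrized under \<open>t \<mapsto> -t\<close>. Summing over zeros only after integrating twice makes every series
  absolutely convergent.
\<close>

section \<open>Hadamard factorization for growth of order 3/2\<close>

text \<open>The exponent 3/2 lies between the two orders that matter. The Gamma factor grows like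
  exp (c r ln r), so no bound exp (C r) can hold, while any exponent below 2 makes the sum of
  \<open>n_\<rho> / |\<rho> - 1/2|^2\<close> converge and forces genus at most 1. The division by
  \<open>z^2\<close> is dictated by the canonical factors. With a = \<rho> - 1/2, (1/(z - a) + 1/a)
  / z^2 = (1/(z - a) - 1/z) / a^2, and the right side is the Laplace transform of (exp (a t) - 1) /
  a^2. Thus the convergence term 1/a coming from \<open>E_1\<close> becomes the subtraction of the
  value of \<open>K2\<close> at 0, and the constant left over becomes the ramp \<open>c_0 t\<close>,
  whose second derivative is the multiple of the Dirac mass at 0. The centre 1/2 is the fixed point
  of the functional equation. There the factor \<open>xi\<close>, which is not explicit, has
  derivative 0, so only pi and Gamma factors enter the constant; and because the centre is
  symmetric, the parts of the formula on t > 0 and t < 0 are mirror images of one one-sided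
  identity. The pole at 1 is carried along throughout as a zero of multiplicity -1.\<close>

lemma divide_out_zeros:
  fixes f :: "complex \<Rightarrow> complex"
  assumes f: "f holomorphic_on UNIV" and nz: "f \<sigma> \<noteq> 0" and "finite S" "S \<subseteq> {\<rho>. f \<rho> = 0}"
  shows "\<exists>g. g holomorphic_on UNIV \<and> (\<forall>s. f s = g s * (\<Prod>\<rho>\<in>S. (s - \<rho>) ^ nat (zorder f \<rho>))) \<and> (\<forall>\<rho>\<in>S. g \<rho> \<noteq> 0)"
  using assms(3,4)
proof (induction S rule: finite_induct)
  case empty
  then show ?case using f by auto
next
  case (insert \<rho> S)
  then obtain g where g: "g holomorphic_on UNIV"
    and fg: "\<And>s. f s = g s * (\<Prod>\<rho>\<in>S. (s - \<rho>) ^ nat (zorder f \<rho>))" and gS: "\<forall>\<rho>\<in>S. g \<rho> \<noteq> 0" by auto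
  let ?p = "\<lambda>s. \<Prod>\<rho>\<in>S. (s - \<rho>) ^ nat (zorder f \<rho>)"
  have p_holo: "?p holomorphic_on UNIV" by (intro holomorphic_intros)
  have p\<rho>: "?p \<rho> \<noteq> 0" using insert by auto
  have g\<sigma>: "g \<sigma> \<noteq> 0" using fg[of \<sigma>] nz by auto
  have fan: "f analytic_on {\<rho>}" "g analytic_on {\<rho>}" "?p analytic_on {\<rho>}"
    using f g p_holo by (auto simp: analytic_on_open[symmetric] intro: analytic_on_subset[of _ UNIV] )
  have "eventually (\<lambda>s. f s \<noteq> 0) (at \<rho>)"
    using non_zero_neighbour_alt[OF f open_UNIV connected_UNIV UNIV_I UNIV_I nz, of \<rho>] by simp
  hence "eventually (\<lambda>s. g s * ?p s \<noteq> 0) (at \<rho>)" by (simp add: fg)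
  hence "zorder (\<lambda>s. g s * ?p s) \<rho> = zorder g \<rho> + zorder ?p \<rho>"
    by (rule zorder_times_analytic[OF fan(2,3)])
  \<comment> \<open>The factors already divided out do not vanish at \<rho>, so \<open>g\<close> has
    the multiplicity of \<open>f\<close> there.\<close>
  also have "zorder ?p \<rho> = 0" by (rule zorder_eq_0I[OF fan(3) p\<rho>])
  also have "(\<lambda>s. g s * ?p s) = f" by (auto simp: fg)
  finally have zo: "zorder f \<rho> = zorder g \<rho>" by simp
  define n where "n = nat (zorder g \<rho>)"
  define h where "h = zor_poly g \<rho>"
  from zorder_exist_zero[OF g open_UNIV connected_UNIV UNIV_I, of \<rho>] g\<sigma>
  obtain r where r: "r > 0" "h holomorphic_on cball \<rho> r"
    and gh: "\<And>w. w \<in> cball \<rho> r \<Longrightarrow> g w = h w * (w - \<rho>) ^ n \<and> h w \<noteq> 0"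
    unfolding h_def n_def by blast
  \<comment> \<open>The removable singularity of the quotient is filled with the value of the
    nonvanishing local factor \<open>h\<close>; \<open>k\<close> is then holomorphic on a disc
    around \<rho> and off \<rho>, hence entire.\<close>
  define k where "k = (\<lambda>w. if w = \<rho> then h \<rho> else g w / (w - \<rho>) ^ n)"
  have kh: "k w = h w" if "w \<in> cball \<rho> r" for w using gh[OF that] by (auto simp: k_def)
  have 1: "k holomorphic_on ball \<rho> r"
    by (rule holomorphic_transform[of h]) (use r kh in \<open>auto intro: holomorphic_on_subset\<close>)
  have 2: "k holomorphic_on (UNIV - {\<rho>})"
  proof (rule holomorphic_transform[of "\<lambda>w. g w / (w - \<rho>) ^ n"])
    show "(\<lambda>w. g w / (w - \<rho>) ^ n) holomorphic_on (UNIV - {\<rho>})"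
      by (intro holomorphic_intros holomorphic_on_subset[OF g]) auto
  qed (auto simp: k_def)
  have "k holomorphic_on (ball \<rho> r \<union> (UNIV - {\<rho>}))"
    using 1 2 by (intro holomorphic_on_Un) (auto simp: open_delete)
  also have "ball \<rho> r \<union> (UNIV - {\<rho>}) = UNIV" using r by auto
  finally have k: "k holomorphic_on UNIV" .
  have gk: "g s = k s * (s - \<rho>) ^ n" for s
    using gh[of \<rho>] r by (auto simp: k_def)
  have "f s = k s * (\<Prod>\<rho>\<in>insert \<rho> S. (s - \<rho>) ^ nat (zorder f \<rho>))" for s
    using insert gk[of s] fg[of s] by (simp add: zo n_def mult_ac)
  moreover have "k \<rho> \<noteq> 0" using gh[of \<rho>] r by (auto simp: k_def)
  moreover have "k \<tau> \<noteq> 0" if "\<tau> \<in> S" for \<tau> using gS that gk[of \<tau>] by auto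
  ultimately show ?case using k by blast
qed

text \<open>Each factor equals (\<rho> - s) / (\<rho> - \<sigma>), so its normalisation at \<sigma>
  drops out of the logarithmic derivative m / (s - \<rho>). The multiplied-out form suits the
  product rule in the induction.\<close>

lemma has_field_derivative_prod_linear_factors:
  fixes \<sigma> s :: complex
  assumes "finite S" "\<sigma> \<notin> S" "s \<notin> S"
  shows "((\<lambda>s. \<Prod>\<rho>\<in>S. (1 - (s - \<sigma>) / (\<rho> - \<sigma>)) ^ m \<rho>) has_field_derivative
     (\<Prod>\<rho>\<in>S. (1 - (s - \<sigma>) / (\<rho> - \<sigma>)) ^ m \<rho>) * (\<Sum>\<rho>\<in>S. of_nat (m \<rho>) / (s - \<rho>))) (at s)"
  using assms
proof (induction S rule: finite_induct)
  case (insert \<rho> S)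
  have ne: "\<rho> - \<sigma> \<noteq> 0" "s - \<rho> \<noteq> 0" using insert.prems by auto
  let ?q = "1 - (s - \<sigma>) / (\<rho> - \<sigma>)"
  have q: "?q = (\<rho> - s) / (\<rho> - \<sigma>)" using ne by (simp add: field_simps)
  hence q0: "?q \<noteq> 0" using ne by auto
  have d: "((\<lambda>s. (1 - (s - \<sigma>) / (\<rho> - \<sigma>)) ^ m \<rho>) has_field_derivative ?q ^ m \<rho> * (of_nat (m \<rho>) / (s - \<rho>))) (at s)"
  proof (cases "m \<rho>")
    case (Suc k)
    have "- 1 / (\<rho> - \<sigma>) = ?q / (s - \<rho>)"
      unfolding q using ne minus_divide_right[of "\<rho> - s" "s - \<rho>"] by (simp add: divide_simps)
    hence "of_nat (Suc k) * ?q ^ k * (- 1 / (\<rho> - \<sigma>)) = ?q ^ Suc k * (of_nat (Suc k) / (s - \<rho>))"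
      by simp
    moreover have dq: "((\<lambda>s. 1 - (s - \<sigma>) / (\<rho> - \<sigma>)) has_field_derivative (- 1 / (\<rho> - \<sigma>))) (at s)"
      using ne by (auto intro!: derivative_eq_intros)
    have "((\<lambda>s. (1 - (s - \<sigma>) / (\<rho> - \<sigma>)) ^ Suc k) has_field_derivative of_nat (Suc k) * ?q ^ k * (- 1 / (\<rho> - \<sigma>))) (at s)"
      using DERIV_power[OF dq, of "Suc k"] by (simp add: mult_ac del: of_nat_Suc)
    ultimately show ?thesis using Suc by simp
  qed simp
  have IH: "((\<lambda>s. \<Prod>\<rho>\<in>S. (1 - (s - \<sigma>) / (\<rho> - \<sigma>)) ^ m \<rho>) has_field_derivative
     (\<Prod>\<rho>\<in>S. (1 - (s - \<sigma>) / (\<rho> - \<sigma>)) ^ m \<rho>) * (\<Sum>\<rho>\<in>S. of_nat (m \<rho>) / (s - \<rho>))) (at s)"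
    using insert by auto
  show ?case using DERIV_mult[OF d IH] insert.hyps by (simp add: algebra_simps)
qed auto

text \<open>Away from the finite set \<open>X\<close> the product is the exponential of an unordered
  sum, which converges. The factors in \<open>X\<close>, which may vanish or lie far from 1, are
  multiplied back in once \<open>F\<close> contains \<open>X\<close>.\<close>

lemma tendsto_prod_finite_subsets:
  fixes a :: "'i \<Rightarrow> complex"
  assumes X: "finite X" "X \<subseteq> A" and l: "\<And>i. i \<in> A - X \<Longrightarrow> a i = exp (l i)" and sl: "l summable_on (A - X)"
  shows "\<exists>P. ((\<lambda>F. prod a F) \<longlongrightarrow> P) (finite_subsets_at_top A)"
proof -
  define L where "L i = (if i \<in> X then 0 else l i)" for i
  have "L summable_on A"
    using sl by (rule summable_on_cong_neutral[THEN iffD1, rotated -1]) (auto simp: L_def)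
  hence "((\<lambda>F. sum L F) \<longlongrightarrow> infsum L A) (finite_subsets_at_top A)"
    using has_sum_infsum has_sum_def by blast
  hence lim: "((\<lambda>F. exp (sum L F) * prod a X) \<longlongrightarrow> exp (infsum L A) * prod a X) (finite_subsets_at_top A)"
    by (intro tendsto_intros)
  have "eventually (\<lambda>F. exp (sum L F) * prod a X = prod a F) (finite_subsets_at_top A)"
    unfolding eventually_finite_subsets_at_top
  proof (intro exI[of _ X] conjI allI impI X)
    fix F assume F: "finite F \<and> X \<subseteq> F \<and> F \<subseteq> A"
    hence "prod a F = prod a (F - X) * prod a X"
      by (metis prod.subset_diff)
    also have "prod a (F - X) = (\<Prod>i\<in>F-X. exp (L i))"
      using F l by (intro prod.cong) (auto simp: L_def)
    also have "\<dots> = exp (sum L (F - X))" using F by (simp add: exp_sum)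
    also have "sum L (F - X) = sum L F"
      using F by (intro sum.mono_neutral_left) (auto simp: L_def)
    finally show "exp (sum L F) * prod a X = prod a F" by simp
  qed
  with lim show ?thesis using tendsto_cong by fast
qed

text \<open>A one-sided bound on the real part controls the modulus: \<open>h / (4 * A - h)\<close>
  maps into the unit disc and fixes 0, so Schwarz's lemma applies. Cauchy's estimate for the second
  derivative then bounds two remainders, that of the linear Taylor polynomial for the product
  formula and that of its derivative for the logarithmic derivative.\<close>

lemma Borel_Caratheodory_taylor:
  fixes h :: "complex \<Rightarrow> complex"
  assumes h: "h holomorphic_on ball 0 R" and h0: "h 0 = 0" and R: "R > 0" and A: "A > 0"
    and re: "\<And>w. norm w < R \<Longrightarrow> Re (h w) \<le> A" and w: "norm w \<le> R / 8"
  shows "norm (h w - deriv h 0 * w) \<le> 160 * A / R^2 * norm w ^ 2"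
    "norm (deriv h w - deriv h 0) \<le> 160 * A / R^2 * norm w"
proof -
  have bound: "norm (h w) \<le> 4 * A" if w: "norm w \<le> R / 2" for w
  proof -
    \<comment> \<open>With \<open>4 * A\<close> in place of the classical \<open>2 * A\<close>, the
      weak bound \<open>Re h \<le> A\<close> gives the strict inequality that Schwarz's lemma
      wants.\<close>
    define k where "k u = h (R * u) / (4 * A - h (R * u))" for u :: complex
    have nz: "4 * of_real A - h (R * u) \<noteq> 0" if "norm u < 1" for u :: complex
    proof
      assume "4 * of_real A - h (R * u) = 0"
      hence "Re (h (R * u)) = 4 * A" by (metis Re_complex_of_real eq_iff_diff_eq_0 of_real_mult of_real_numeral)
      moreover have "Re (h (R * u)) \<le> A" using that R by (intro re) (auto simp: norm_mult)
      ultimately show False using A by auto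
    qed
    have "k holomorphic_on ball 0 1" unfolding k_def
      using nz R by (intro holomorphic_intros holomorphic_on_compose_gen[OF _ h, unfolded o_def])
        (auto simp: norm_mult)
    moreover have "k 0 = 0" by (simp add: k_def h0)
    moreover have "norm (k u) < 1" if "norm u < 1" for u :: complex
    proof -
      let ?z = "h (R * u)"
      have "Re ?z \<le> A" using that R by (intro re) (auto simp: norm_mult)
      hence "A * Re ?z \<le> A * A" using A by (simp add: mult_left_mono)
      hence "A * Re ?z < 2 * (A * A)" using A by (smt (verit) mult_pos_pos)
      hence "(norm ?z)^2 < (norm (4 * of_real A - ?z))^2"
        unfolding cmod_power2 using A by (simp add: power2_eq_square algebra_simps)
      hence "norm ?z < norm (4 * of_real A - ?z)" by (simp add: power_less_imp_less_base)
      thus ?thesis by (simp add: k_def norm_divide divide_less_eq)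
    qed
    moreover have u: "norm (w / R) < 1" using w R by (simp add: norm_divide field_simps)
    ultimately have "norm (k (w / R)) \<le> norm (w / R)" by (rule Schwarz_Lemma)
    also have "\<dots> \<le> 1/2" using w R by (simp add: norm_divide field_simps)
    finally have "norm (k (w/R)) \<le> 1/2" .
    hence "norm (h w) \<le> 1/2 * norm (4 * of_real A - h w)" using nz[OF u] R
      by (simp add: k_def norm_divide divide_le_eq)
    also have "\<dots> \<le> 1/2 * (4 * A + norm (h w))"
      using norm_triangle_ineq4[of "4 * of_real A" "h w"] A by (simp add: norm_mult)
    finally show ?thesis by simp
  qed
  have h': "h holomorphic_on ball 0 (R)" "open (ball (0::complex) R)" using h by auto
  define B where "B = 160 * A / R^2"
  \<comment> \<open>Within distance R/4 of u the values stay in the open ball of radius 5 * A, since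
    their modulus is at most 4 * A; Cauchy's bound is then 2 * 5 * 16 = 160 times A / R^2.\<close>
  have d2: "norm ((deriv ^^ 2) h u) \<le> B" if "norm u < R / 4" for u
  proof -
    have "norm ((deriv ^^ 2) h u) \<le> fact 2 * (5 * A) / (R/4) ^ 2"
    proof (rule Cauchy_higher_deriv_bound[where y = 0])
      have sub: "cball u (R/4) \<subseteq> ball 0 R"
      proof
        fix x assume "x \<in> cball u (R/4)"
        hence "norm (x - u) \<le> R/4" by (simp add: dist_norm norm_minus_commute)
        thus "x \<in> ball 0 R" using norm_triangle_ineq[of u "x - u"] that R by (simp)
      qed
      show "h holomorphic_on ball u (R/4)" using h sub ball_subset_cball holomorphic_on_subset by blast
      show "continuous_on (cball u (R/4)) h" using h sub holomorphic_on_imp_continuous_on holomorphic_on_subset by blast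
      show "h x \<in> ball 0 (5 * A)" if "x \<in> ball u (R/4)" for x
      proof -
        have "norm (x - u) \<le> R/4" using that by (simp add: dist_norm norm_minus_commute)
        hence "norm x \<le> R/2" using norm_triangle_ineq[of u "x - u"] \<open>norm u < R/4\<close> by simp
        from bound[OF this] A show ?thesis by simp
      qed
    qed (use R in auto)
    also have "\<dots> = 160 * A / R^2" by (simp add: power2_eq_square fact_numeral)
    finally show ?thesis by (simp add: B_def)
  qed
  have der: "((deriv ^^ i) h has_field_derivative (deriv ^^ Suc i) h u) (at u)" if "norm u < R" for i u
  proof -
    have "(deriv ^^ i) h holomorphic_on ball 0 R" by (rule holomorphic_higher_deriv[OF h'])
    thus ?thesis using that holomorphic_derivI[of "(deriv ^^ i) h" "ball 0 R" u UNIV] by simp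
  qed
  have B0: "0 \<le> B" using A R by (simp add: B_def)
  have w4: "norm w < R/4" using w R by simp
  have "norm ((deriv^^0) h w - (\<Sum>i\<le>1. (deriv^^i) h 0 * (w-0)^i / fact i)) \<le> B * norm (w - 0)^(Suc 1) / fact 1"
  proof (rule complex_Taylor[of "ball 0 (R/4)"])
    show "((deriv ^^ i) h has_field_derivative (deriv ^^ Suc i) h u) (at u within ball 0 (R/4))"
      if "u \<in> ball 0 (R/4)" for i u using der[of u i] that R has_field_derivative_at_within by simp
  next
    fix x assume "x \<in> ball (0::complex) (R / 4)"
    then show "norm ((deriv ^^ Suc 1) h x) \<le> B" using d2[of x] by (simp add: numeral_2_eq_2)
  qed (use w4 R in auto)
  thus "norm (h w - deriv h 0 * w) \<le> 160 * A / R^2 * norm w ^ 2"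
    by (simp add: h0 B_def numeral_2_eq_2)
  have "norm (deriv h w - deriv h 0) \<le> B * norm (w - 0)"
  proof (rule field_differentiable_bound[of "ball 0 (R/4)"])
    show "(deriv h has_field_derivative (deriv^^2) h z) (at z within ball 0 (R/4))" if "z \<in> ball 0 (R/4)" for z
      using der[of z 1] that R has_field_derivative_at_within by (simp add: numeral_2_eq_2)
    show "norm ((deriv ^^ 2) h z) \<le> B" if "z \<in> ball 0 (R/4)" for z
      using that by (intro d2) simp
  qed (use w4 R in auto)
  thus "norm (deriv h w - deriv h 0) \<le> 160 * A / R^2 * norm w"
    by (simp add: B_def)
qed

section \<open>The canonical product of an entire function of growth exponent 3/2\<close>

lemma weierstrass_factor_one: "weierstrass_factor 1 z = (1 - z) * exp z"
  by (simp add: weierstrass_factor_def)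

text \<open>The bound is relative to the modulus of \<open>f \<sigma>\<close>, so that a quotient
  normalised to 1 at \<sigma> inherits it without a further constant.\<close>

locale entire_order_less_two =
  fixes f :: "complex \<Rightarrow> complex" and \<sigma> :: complex and C :: real
  assumes holo: "f holomorphic_on UNIV" and nonzero: "f \<sigma> \<noteq> 0" and C: "C > 0"
    and growth: "\<And>s. norm (f s) \<le> norm (f \<sigma>) * exp (C * (1 + norm (s - \<sigma>)) powr (3/2))"
begin

definition Z where "Z = {\<rho>. f \<rho> = 0}"
definition m where "m \<rho> = nat (zorder f \<rho>)"
definition ZR where "ZR R = {\<rho>\<in>Z. norm (\<rho> - \<sigma>) \<le> R}"
definition P where "P S s = (\<Prod>\<rho>\<in>S. (1 - (s - \<sigma>) / (\<rho> - \<sigma>)) ^ m \<rho>)"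

lemma sigma_notin: "\<sigma> \<notin> Z" using nonzero by (auto simp: Z_def)

lemma finite_ZR [simp]: "finite (ZR R)"
proof (cases "f constant_on UNIV")
  case True
  hence "ZR R = {}" using nonzero by (auto simp: constant_on_def ZR_def Z_def)
  thus ?thesis by simp
next
  case False
  have "finite {z\<in>cball \<sigma> R. f z = 0}"
    by (rule holomorphic_compact_finite_zeros[OF holo]) (use False in auto)
  also have "{z\<in>cball \<sigma> R. f z = 0} = ZR R" by (auto simp: ZR_def Z_def dist_norm norm_minus_commute)
  finally show ?thesis .
qed

lemma quotient:
  assumes "finite S" "S \<subseteq> Z"
  obtains G where "G holomorphic_on UNIV" "\<And>s. f s = f \<sigma> * G s * P S s" "\<And>\<rho>. \<rho> \<in> S \<Longrightarrow> G \<rho> \<noteq> 0" "G \<sigma> = 1"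
proof -
  from divide_out_zeros[OF holo nonzero assms(1)] assms(2) obtain g where g: "g holomorphic_on UNIV"
    "\<And>s. f s = g s * (\<Prod>\<rho>\<in>S. (s - \<rho>) ^ m \<rho>)" "\<And>\<rho>. \<rho> \<in> S \<Longrightarrow> g \<rho> \<noteq> 0"
    unfolding Z_def m_def by metis
  define c where "c = (\<Prod>\<rho>\<in>S. (\<sigma> - \<rho>) ^ m \<rho>)"
  have c: "c \<noteq> 0" using assms sigma_notin by (auto simp: c_def)
  have "(\<Prod>\<rho>\<in>S. (s - \<rho>) ^ m \<rho>) = c * P S s" for s
    unfolding c_def P_def prod.distrib[symmetric] power_mult_distrib[symmetric]
  proof (intro prod.cong refl arg_cong2[where f = power])
    fix \<rho> assume "\<rho> \<in> S"
    hence "\<rho> - \<sigma> \<noteq> 0" using assms sigma_notin by auto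
    thus "s - \<rho> = (\<sigma> - \<rho>) * (1 - (s - \<sigma>) / (\<rho> - \<sigma>))" by (simp add: field_simps)
  qed
  hence eq: "f s = g s * c * P S s" for s using g(2)[of s] by simp
  have "P S \<sigma> = 1" by (simp add: P_def)
  hence fs: "f \<sigma> = g \<sigma> * c" using eq[of \<sigma>] by simp
  show ?thesis
  proof (rule that[of "\<lambda>s. g s * c / f \<sigma>"])
    show "(\<lambda>s. g s * c / f \<sigma>) holomorphic_on UNIV" using g(1) nonzero by (intro holomorphic_intros) auto
  qed (use nonzero fs eq g(3) c in \<open>auto simp: field_simps\<close>)
qed

text \<open>
  On the circle of radius \<open>3 * R\<close> every factor \<open>1 - (s - \<sigma>) / (\<rho> - \<sigma>)\<close> with \<open>norm (\<rho> - \<sigma>) \<le> R\<close> has modulus at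
  least \<open>2\<close>; the maximum principle then bounds the quotient and, at \<open>s = \<sigma>\<close>, the number of zeros.
\<close>

lemma quotient_bound:
  assumes S: "S \<subseteq> ZR R" and R: "R > 0" and s: "norm (s - \<sigma>) \<le> 3 * R"
    and G: "G holomorphic_on UNIV" "\<And>s. f s = f \<sigma> * G s * P S s"
  shows "norm (G s) * 2 ^ (\<Sum>\<rho>\<in>S. m \<rho>) \<le> exp (C * (1 + 3 * R) powr (3/2))" (is "_ * 2 ^ ?N \<le> ?B")
proof -
  have "norm (G s) \<le> ?B / 2 ^ ?N"
  proof (rule maximum_modulus_frontier[where S = "cball \<sigma> (3 * R)" and f = G and \<xi> = s])
    fix z assume "z \<in> frontier (cball \<sigma> (3 * R))"
    hence z: "norm (z - \<sigma>) = 3 * R" using R by (simp add: dist_norm norm_minus_commute)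
    have "2 ^ ?N \<le> norm (P S z)"
      unfolding P_def power_sum prod_norm[symmetric] norm_power
    proof (intro prod_mono conjI power_mono)
      fix \<rho> assume "\<rho> \<in> S"
      hence \<rho>: "norm (\<rho> - \<sigma>) \<le> R" "\<rho> \<noteq> \<sigma>" using S sigma_notin by (auto simp: ZR_def)
      have "3 \<le> norm ((z - \<sigma>) / (\<rho> - \<sigma>))" using \<rho> z by (simp add: norm_divide field_simps)
      thus "2 \<le> norm (1 - (z - \<sigma>) / (\<rho> - \<sigma>))"
        using norm_triangle_ineq2[of "(z - \<sigma>) / (\<rho> - \<sigma>)" 1] by (simp add: norm_minus_commute)
    qed auto
    hence "norm (f \<sigma>) * (norm (G z) * 2 ^ ?N) \<le> norm (f \<sigma>) * (norm (G z) * norm (P S z))"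
      by (intro mult_left_mono) auto
    also have "\<dots> = norm (f z)" by (simp add: G(2)[of z] norm_mult)
    also have "\<dots> \<le> norm (f \<sigma>) * ?B" using growth[of z] z by simp
    finally have "norm (G z) * 2 ^ ?N \<le> ?B" using nonzero by simp
    thus "norm (G z) \<le> ?B / 2 ^ ?N" by (simp add: field_simps)
  qed (use G s in \<open>auto intro: holomorphic_on_imp_continuous_on holomorphic_on_subset simp: dist_norm norm_minus_commute\<close>)
  thus ?thesis by (simp add: field_simps)
qed

lemma count_bound:
  assumes S: "S \<subseteq> ZR R" and R: "R > 0"
  shows "real (\<Sum>\<rho>\<in>S. m \<rho>) \<le> 2 * C * (1 + 3 * R) powr (3/2)"
proof -
  have fS: "finite S" "S \<subseteq> Z" using finite_subset[OF S finite_ZR] S by (auto simp: ZR_def)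
  obtain G where G: "G holomorphic_on UNIV" "\<And>s. f s = f \<sigma> * G s * P S s" "G \<sigma> = 1"
    using quotient[OF fS] by metis
  have "2 ^ (\<Sum>\<rho>\<in>S. m \<rho>) \<le> exp (C * (1 + 3 * R) powr (3/2))"
    using quotient_bound[OF S R _ G(1,2), of \<sigma>] G(3) R by simp
  hence "ln (2 ^ (\<Sum>\<rho>\<in>S. m \<rho>)) \<le> C * (1 + 3 * R) powr (3/2)"
    by (subst (asm) ln_le_cancel_iff[symmetric]) auto
  hence "real (\<Sum>\<rho>\<in>S. m \<rho>) * ln 2 \<le> C * (1 + 3 * R) powr (3/2)" by (simp add: ln_realpow)
  moreover have "real (\<Sum>\<rho>\<in>S. m \<rho>) * (1/2) \<le> real (\<Sum>\<rho>\<in>S. m \<rho>) * ln 2"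
    by (intro mult_left_mono) (use ln2_ge_two_thirds in \<open>auto simp: sum_nonneg\<close>)
  ultimately show ?thesis by simp
qed

text \<open>A zero with 2^(k-1) < |\<rho> - \<sigma>| \<le> 2^k contributes at most 4 / 4^k, and by
  \<open>count_bound\<close> the disc of radius 2^k holds O(2^(3k/2)) zeros with multiplicity. The
  dyadic series is therefore geometric with ratio \<open>q\<close>, that is 2^(-1/2).\<close>

lemma summable_inverse_square: "(\<lambda>\<rho>. real (m \<rho>) / norm (\<rho> - \<sigma>) ^ 2) summable_on Z"
proof -
  define q where "q = (2::real) powr (-1/2)"
  have q: "0 < q" "q < 1" by (auto simp: q_def powr_less_one)
  have "(\<lambda>\<rho>. real (m \<rho>) / norm (\<rho> - \<sigma>) ^ 2) summable_on (Z - ZR 1)"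
  proof (rule nonneg_bdd_above_summable_on)
    have "sum (\<lambda>\<rho>. real (m \<rho>) / norm (\<rho> - \<sigma>) ^ 2) S \<le> 4 * (2 * C * 8) * (1 / (1 - q))"
      if S: "S \<subseteq> Z - ZR 1" "finite S" for S
    proof -
      \<comment> \<open>A zero is counted in every dyadic disc that contains it, not only in its own
        shell. The overcount is harmless for an upper bound and lets \<open>count_bound\<close> be
        applied to whole discs.\<close>
      define ind :: "nat \<Rightarrow> complex \<Rightarrow> real" where "ind k \<rho> = (if norm (\<rho> - \<sigma>) \<le> 2 ^ k then 1 / 4 ^ k else 0)" for k \<rho>
      have si: "summable (\<lambda>k. ind k \<rho>)" for \<rho>
        by (rule summable_comparison_test'[OF summable_geometric[of "1/4"], where N = 0]) (auto simp: ind_def power_one_over)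
      have 1: "1 / norm (\<rho> - \<sigma>) ^ 2 \<le> 4 * (\<Sum>k. ind k \<rho>)" if "\<rho> \<in> S" for \<rho>
      proof -
        have n1: "norm (\<rho> - \<sigma>) > 1" using S that by (auto simp: ZR_def)
        define k where "k = (LEAST k. norm (\<rho> - \<sigma>) \<le> 2 ^ k)"
        have ex: "\<exists>k. norm (\<rho> - \<sigma>) \<le> 2 ^ k"
          using real_arch_pow[of 2 "norm (\<rho> - \<sigma>)"] less_imp_le by auto
        have k: "norm (\<rho> - \<sigma>) \<le> 2 ^ k" unfolding k_def by (rule LeastI_ex[OF ex])
        have k0: "k \<noteq> 0" using k n1 by (intro notI) auto
        have "\<not> norm (\<rho> - \<sigma>) \<le> 2 ^ (k - 1)"
          using not_less_Least[of "k - 1" "\<lambda>k. norm (\<rho> - \<sigma>) \<le> 2 ^ k"] k0 by (simp add: k_def)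
        hence "2 ^ k < 2 * norm (\<rho> - \<sigma>)" using k0 by (cases k) auto
        hence "(2 ^ k)^2 \<le> (2 * norm (\<rho> - \<sigma>))^2" by (intro power_mono) auto
        hence "4 ^ k \<le> 4 * norm (\<rho> - \<sigma>) ^ 2" by (simp add: power_mult_distrib power_mult[symmetric] power_even_eq[symmetric] mult.commute[of k] power_mult)
        moreover have "norm (\<rho> - \<sigma>) ^ 2 > 0" using n1 by auto
        ultimately have "1 / norm (\<rho> - \<sigma>) ^ 2 \<le> 4 * (1 / 4 ^ k)" by (simp add: divide_simps)
        also have "1 / 4 ^ k = ind k \<rho>" using k by (simp add: ind_def)
        also have "ind k \<rho> \<le> (\<Sum>k. ind k \<rho>)"
          using sum_le_suminf[OF si, of "{k}"] by (auto simp: ind_def)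
        finally show ?thesis by simp
      qed
      have "sum (\<lambda>\<rho>. real (m \<rho>) / norm (\<rho> - \<sigma>) ^ 2) S \<le> (\<Sum>\<rho>\<in>S. real (m \<rho>) * (4 * (\<Sum>k. ind k \<rho>)))"
        using mult_left_mono[OF 1, of _ "real (m _)"] by (intro sum_mono) simp
      also have "\<dots> = 4 * (\<Sum>\<rho>\<in>S. (\<Sum>k. real (m \<rho>) * ind k \<rho>))"
        unfolding suminf_mult[OF si] sum_distrib_left by (simp add: mult_ac)
      also have "(\<Sum>\<rho>\<in>S. (\<Sum>k. real (m \<rho>) * ind k \<rho>)) = (\<Sum>k. \<Sum>\<rho>\<in>S. real (m \<rho>) * ind k \<rho>)"
        by (rule suminf_sum[symmetric]) (intro summable_mult si)
      also have "\<dots> \<le> (\<Sum>k. 2 * C * 8 * q ^ k)"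
      proof (rule suminf_le)
        fix k :: nat
        have "(\<Sum>\<rho>\<in>S. real (m \<rho>) * ind k \<rho>) = (\<Sum>\<rho>\<in>S \<inter> ZR (2^k). real (m \<rho>)) / 4 ^ k"
          unfolding sum_divide_distrib
          by (rule sum.mono_neutral_cong_right) (use S in \<open>auto simp: ind_def ZR_def\<close>)
        also have "\<dots> \<le> 2 * C * (1 + 3 * 2 ^ k) powr (3/2) / 4 ^ k"
          using count_bound[of "S \<inter> ZR (2^k)" "2^k"] by (intro divide_right_mono) auto
        also have "\<dots> \<le> 2 * C * (4 * 2 ^ k) powr (3/2) / 4 ^ k"
          using C by (intro divide_right_mono mult_left_mono powr_mono2) auto
        also have "(4 * 2 ^ k) powr (3/2) = 8 * ((2::real) powr (3/2)) ^ k"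
        proof -
          have "(4::real) powr (3/2) = (2 powr 2) powr (3/2)" by simp
          also have "\<dots> = 8" unfolding powr_powr by simp
          finally show ?thesis by (simp add: powr_mult powr_realpow[symmetric] powr_powr mult.commute)
        qed
        also have "2 * C * (8 * (2 powr (3/2)) ^ k) / 4 ^ k = 2 * C * 8 * ((2 powr (3/2)) / 4) ^ k"
          by (simp add: power_divide)
        also have "(2::real) powr (3/2) / 4 = q"
          using powr_add[of 2 "-1/2" "2::real"] by (simp add: q_def)
        finally show "(\<Sum>\<rho>\<in>S. real (m \<rho>) * ind k \<rho>) \<le> 2 * C * 8 * q ^ k" .
      qed (use q si in \<open>auto intro!: summable_sum summable_mult summable_geometric\<close>)
      also have "\<dots> = 2 * C * 8 * (1 / (1 - q))" using q by (simp add: suminf_mult suminf_geometric summable_geometric)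
      finally show ?thesis by simp
    qed
    thus "bdd_above (sum (\<lambda>\<rho>. real (m \<rho>) / norm (\<rho> - \<sigma>) ^ 2) ` {F. F \<subseteq> Z - ZR 1 \<and> finite F})"
      by (intro bdd_aboveI2) auto
  qed auto
  hence "(\<lambda>\<rho>. real (m \<rho>) / norm (\<rho> - \<sigma>) ^ 2) summable_on (Z - ZR 1 \<union> ZR 1)"
    by (intro summable_on_Un_disjoint) auto
  also have "Z - ZR 1 \<union> ZR 1 = Z" by (auto simp: ZR_def)
  finally show ?thesis .
qed

text \<open>Once the zeros in the disc of radius R are divided out, the quotient is exp h there,
  with Re h \<le> A = O(R^(3/2)). Borel-Caratheodory makes the deviation of h from its linear part
  O(A / R^2) = O(R^(-1/2)) for fixed s, so only a linear exponent survives as R grows. Its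
  coefficient is found by comparing logarithmic derivatives at \<sigma>. The witnesses
  \<open>e\<close> and \<open>d\<close> are the remainders of h and of its derivative.\<close>

lemma finite_quotient:
  assumes R: "R > 0" and s: "norm (s - \<sigma>) \<le> R / 8"
  defines "A \<equiv> C * (1 + 3 * R) powr (3/2)"
  obtains e d where "norm e \<le> 160 * A / R^2 * norm (s - \<sigma>) ^ 2" "norm d \<le> 160 * A / R^2 * norm (s - \<sigma>)"
    "f s * exp (- (s - \<sigma>) * (deriv f \<sigma> / f \<sigma> + (\<Sum>\<rho>\<in>ZR R. of_nat (m \<rho>) / (\<rho> - \<sigma>)))) = f \<sigma> * P (ZR R) s * exp e"
    "f s \<noteq> 0 \<Longrightarrow> deriv f s / f s - deriv f \<sigma> / f \<sigma> - (\<Sum>\<rho>\<in>ZR R. of_nat (m \<rho>) * (1 / (s - \<rho>) + 1 / (\<rho> - \<sigma>))) = d"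
proof -
  define S where "S = ZR R"
  have fS: "finite S" "S \<subseteq> Z" "\<sigma> \<notin> S" using sigma_notin finite_ZR[of R] unfolding S_def by (auto simp: ZR_def)
  obtain G where G: "G holomorphic_on UNIV" "\<And>s. f s = f \<sigma> * G s * P S s" "\<And>\<rho>. \<rho> \<in> S \<Longrightarrow> G \<rho> \<noteq> 0" "G \<sigma> = 1"
    using quotient[OF fS(1,2)] by metis
  have G_nz: "G (\<sigma> + w) \<noteq> 0" if "norm w < R" for w
  proof
    assume 0: "G (\<sigma> + w) = 0"
    hence "f (\<sigma> + w) = 0" using G(2)[of "\<sigma> + w"] by simp
    hence "\<sigma> + w \<in> S" using that by (auto simp: S_def ZR_def Z_def)
    with G(3) 0 show False by blast
  qed
  have holG: "(\<lambda>w. G (\<sigma> + w)) holomorphic_on ball 0 R"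
    by (intro holomorphic_on_compose_gen[OF _ G(1), unfolded o_def] holomorphic_intros) auto
  obtain g where g: "g holomorphic_on ball 0 R" "\<And>w. w \<in> ball 0 R \<Longrightarrow> G (\<sigma> + w) = exp (g w)"
    by (rule contractible_imp_holomorphic_log[OF holG]) (use G_nz in \<open>auto intro: convex_imp_contractible\<close>)
  define h where "h w = g w - g 0" for w
  have h: "h holomorphic_on ball 0 R" unfolding h_def by (intro holomorphic_intros g)
  have "exp (g 0) = 1" using g(2)[of 0] R G(4) by simp
  hence hG: "G (\<sigma> + w) = exp (h w)" if "norm w < R" for w using g(2)[of w] that by (simp add: h_def exp_diff)
  have A: "A > 0" using C R by (simp add: A_def)
  have re: "Re (h w) \<le> A" if "norm w < R" for w
  proof -
    have "norm (G (\<sigma> + w)) * 2 ^ (\<Sum>\<rho>\<in>S. m \<rho>) \<le> exp A" unfolding A_def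
      by (rule quotient_bound[OF _ R _ G(1,2)]) (use that R in \<open>auto simp: S_def\<close>)
    moreover have "norm (G (\<sigma> + w)) * 1 \<le> norm (G (\<sigma> + w)) * 2 ^ (\<Sum>\<rho>\<in>S. m \<rho>)"
      by (intro mult_left_mono) auto
    ultimately have "norm (G (\<sigma> + w)) \<le> exp A" by simp
    thus ?thesis using hG[OF that] by simp
  qed
  have dh: "deriv G (\<sigma> + w) = G (\<sigma> + w) * deriv h w" if "norm w < R" for w
  proof -
    have 1: "((\<lambda>w. G (\<sigma> + w)) has_field_derivative deriv G (\<sigma> + w) * 1) (at w)"
      by (rule DERIV_chain2[OF holomorphic_derivI[OF G(1)]]) (auto intro!: derivative_eq_intros)
    have 2: "((\<lambda>w. exp (h w)) has_field_derivative exp (h w) * deriv h w) (at w)"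
      by (rule DERIV_chain2[OF DERIV_exp holomorphic_derivI[OF h]]) (use that in auto)
    have "((\<lambda>w. G (\<sigma> + w)) has_field_derivative exp (h w) * deriv h w) (at w)"
      by (rule DERIV_cong_ev[THEN iffD1, OF refl _ refl 2])
         (use hG that in \<open>auto intro!: eventually_nhds_in_open[of "ball 0 R", THEN eventually_mono]\<close>)
    from DERIV_unique[OF 1 this] show ?thesis using hG that by simp
  qed
  have logder: "deriv f (\<sigma> + w) / f (\<sigma> + w) = deriv h w + (\<Sum>\<rho>\<in>S. of_nat (m \<rho>) / (\<sigma> + w - \<rho>))"
    if w: "norm w < R" and nz: "f (\<sigma> + w) \<noteq> 0" for w
  proof -
    let ?s = "\<sigma> + w"
    have sS: "?s \<notin> S" using nz fS(2) by (auto simp: Z_def)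
    have dP: "(P S has_field_derivative P S ?s * (\<Sum>\<rho>\<in>S. of_nat (m \<rho>) / (?s - \<rho>))) (at ?s)"
      unfolding P_def by (rule has_field_derivative_prod_linear_factors[OF fS(1,3) sS])
    have "((\<lambda>s. f \<sigma> * (G s * P S s)) has_field_derivative
        f \<sigma> * (deriv G ?s * P S ?s + P S ?s * (\<Sum>\<rho>\<in>S. of_nat (m \<rho>) / (?s - \<rho>)) * G ?s)) (at ?s)"
      by (intro DERIV_cmult DERIV_mult holomorphic_derivI[OF G(1)] dP) auto
    moreover have "(\<lambda>s. f \<sigma> * (G s * P S s)) = f" by (rule ext) (simp only: mult.assoc[symmetric] G(2)[symmetric])
    ultimately have "deriv f ?s = f \<sigma> * (deriv G ?s * P S ?s + P S ?s * (\<Sum>\<rho>\<in>S. of_nat (m \<rho>) / (?s - \<rho>)) * G ?s)"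
      by (simp add: DERIV_imp_deriv)
    also have "\<dots> = f ?s * (deriv h w + (\<Sum>\<rho>\<in>S. of_nat (m \<rho>) / (?s - \<rho>)))"
      unfolding G(2)[of ?s] dh[OF w] by (simp add: algebra_simps)
    finally show ?thesis using nz by simp
  qed
  have "(\<Sum>\<rho>\<in>S. of_nat (m \<rho>) / (\<sigma> - \<rho>)) = - (\<Sum>\<rho>\<in>S. of_nat (m \<rho>) / (\<rho> - \<sigma>))"
    unfolding sum_negf[symmetric] by (intro sum.cong refl) (metis minus_diff_eq minus_divide_right)
  hence dh0: "deriv h 0 = deriv f \<sigma> / f \<sigma> + (\<Sum>\<rho>\<in>S. of_nat (m \<rho>) / (\<rho> - \<sigma>))"
    using logder[of 0] R nonzero by simp
  let ?w = "s - \<sigma>"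
  have w: "norm ?w < R" using s R by simp
  note BC = Borel_Caratheodory_taylor[OF h _ R A re s]
  show ?thesis
  proof (rule that[of "h ?w - deriv h 0 * ?w" "deriv h ?w - deriv h 0"])
    show "norm (h ?w - deriv h 0 * ?w) \<le> 160 * A / R^2 * norm ?w ^ 2" "norm (deriv h ?w - deriv h 0) \<le> 160 * A / R^2 * norm ?w"
      by (rule BC; simp add: h_def)+
    have "f s = f \<sigma> * exp (h ?w) * P S s" using G(2)[of s] hG[OF w] by simp
    moreover have "exp (- ?w * deriv h 0) = exp (- (deriv h 0 * ?w))"
      by (rule arg_cong[of _ _ exp]) (simp add: algebra_simps)
    moreover have "exp (h ?w - deriv h 0 * ?w) = exp (h ?w) * exp (- (deriv h 0 * ?w))"
      by (simp only: exp_add[symmetric] add_uminus_conv_diff)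
    ultimately have "f s * exp (- ?w * deriv h 0) = f \<sigma> * P S s * exp (h ?w - deriv h 0 * ?w)"
      by (simp only: mult_ac)
    thus "f s * exp (- (s - \<sigma>) * (deriv f \<sigma> / f \<sigma> + (\<Sum>\<rho>\<in>ZR R. of_nat (m \<rho>) / (\<rho> - \<sigma>)))) = f \<sigma> * P (ZR R) s * exp (h ?w - deriv h 0 * ?w)"
      by (simp only: dh0 S_def)
    assume "f s \<noteq> 0"
    hence "deriv f s / f s = deriv h ?w + (\<Sum>\<rho>\<in>S. of_nat (m \<rho>) / (s - \<rho>))" using logder[OF w] by simp
    thus "deriv f s / f s - deriv f \<sigma> / f \<sigma> - (\<Sum>\<rho>\<in>ZR R. of_nat (m \<rho>) * (1 / (s - \<rho>) + 1 / (\<rho> - \<sigma>))) = deriv h ?w - deriv h 0"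
      by (simp add: dh0 S_def algebra_simps sum.distrib)
  qed
qed

text \<open>Once an unordered limit is known to exist, its value may be computed along growing
  discs. This is how the finite quotients determine the sum and the product below.\<close>

lemma filterlim_ZR: "filterlim (\<lambda>n. ZR (real n)) (finite_subsets_at_top Z) sequentially"
  unfolding filterlim_def le_filter_def eventually_filtermap
proof (intro allI impI)
  fix Q assume "eventually Q (finite_subsets_at_top Z)"
  from this[unfolded eventually_finite_subsets_at_top]
  obtain X where X: "finite X" "X \<subseteq> Z" "\<forall>Y. finite Y \<and> X \<subseteq> Y \<and> Y \<subseteq> Z \<longrightarrow> Q Y"
    by blast
  obtain B where B: "\<And>\<rho>. \<rho> \<in> X \<Longrightarrow> norm (\<rho> - \<sigma>) \<le> B"
    using finite_imageI[OF X(1)] finite_imp_bounded[of "(\<lambda>\<rho>. \<rho> - \<sigma>) ` X"] by (auto simp: bounded_iff)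
  have "eventually (\<lambda>n. real n \<ge> B) sequentially" by real_asymp
  thus "eventually (\<lambda>n. Q (ZR (real n))) sequentially"
  proof eventually_elim
    case (elim n)
    have "X \<subseteq> ZR (real n)" using X(2) B elim by (force simp: ZR_def)
    moreover have "ZR (real n) \<subseteq> Z" by (auto simp: ZR_def)
    ultimately show ?case using X(3) finite_ZR by blast
  qed
qed

lemma error_tendsto_0: "(\<lambda>n. 160 * (C * (1 + 3 * real n) powr (3/2)) / (real n)^2 * K) \<longlonglongrightarrow> 0"
proof -
  have "(\<lambda>n. (1 + 3 * real n) powr (3/2) / (real n)^2) \<longlonglongrightarrow> 0" by real_asymp
  from tendsto_mult_right_zero[OF this, of "160 * C * K"] show ?thesis by (simp add: mult_ac)
qed

text \<open>The remainders depend on the radius, so choice turns them into sequences; for fixed s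
  both are O(n^(-1/2)).\<close>

lemma eventually_finite_quotient:
  obtains e d where "e \<longlonglongrightarrow> 0" "d \<longlonglongrightarrow> 0"
    "eventually (\<lambda>n. f s * exp (- (s - \<sigma>) * (deriv f \<sigma> / f \<sigma> + (\<Sum>\<rho>\<in>ZR (real n). of_nat (m \<rho>) / (\<rho> - \<sigma>)))) = f \<sigma> * P (ZR (real n)) s * exp (e n)) sequentially"
    "f s \<noteq> 0 \<Longrightarrow> eventually (\<lambda>n. deriv f s / f s - deriv f \<sigma> / f \<sigma> - (\<Sum>\<rho>\<in>ZR (real n). of_nat (m \<rho>) * (1 / (s - \<rho>) + 1 / (\<rho> - \<sigma>))) = d n) sequentially"
proof -
  define good where "good n \<longleftrightarrow> real n > 0 \<and> norm (s - \<sigma>) \<le> real n / 8" for n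
  have ev: "eventually good sequentially" unfolding good_def by (rule eventually_conj; real_asymp)
  let ?A = "\<lambda>n. C * (1 + 3 * real n) powr (3/2)"
  define Q where "Q n e d \<longleftrightarrow> (good n \<longrightarrow> norm e \<le> 160 * ?A n / (real n)^2 * norm (s - \<sigma>) ^ 2 \<and> norm d \<le> 160 * ?A n / (real n)^2 * norm (s - \<sigma>) \<and>
    f s * exp (- (s - \<sigma>) * (deriv f \<sigma> / f \<sigma> + (\<Sum>\<rho>\<in>ZR (real n). of_nat (m \<rho>) / (\<rho> - \<sigma>)))) = f \<sigma> * P (ZR (real n)) s * exp e \<and>
    (f s \<noteq> 0 \<longrightarrow> deriv f s / f s - deriv f \<sigma> / f \<sigma> - (\<Sum>\<rho>\<in>ZR (real n). of_nat (m \<rho>) * (1 / (s - \<rho>) + 1 / (\<rho> - \<sigma>))) = d))"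
    for n e d
  have "\<exists>e d. Q n e d" for n
  proof (cases "good n")
    case True
    hence g: "real n > 0" "norm (s - \<sigma>) \<le> real n / 8" by (auto simp: good_def)
    show ?thesis unfolding Q_def by (rule finite_quotient[OF g]) blast
  qed (simp add: Q_def)
  hence "\<exists>e. \<forall>n. \<exists>d. Q n (e n) d" by (intro choice) blast
  then obtain e where "\<forall>n. \<exists>d. Q n (e n) d" by blast
  from choice[OF this] obtain d where Q: "\<And>n. Q n (e n) (d n)" by blast
  note ed = Q[unfolded Q_def, rule_format, THEN conjunct1] Q[unfolded Q_def, rule_format, THEN conjunct2, THEN conjunct1]
    Q[unfolded Q_def, rule_format, THEN conjunct2, THEN conjunct2, THEN conjunct1]
    Q[unfolded Q_def, rule_format, THEN conjunct2, THEN conjunct2, THEN conjunct2, THEN mp]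
  show ?thesis
  proof (rule that[of e d])
    show "e \<longlonglongrightarrow> 0"
      by (rule Lim_null_comparison[OF _ error_tendsto_0]) (rule eventually_mono[OF ev], rule ed(1))
    show "d \<longlonglongrightarrow> 0"
      by (rule Lim_null_comparison[OF _ error_tendsto_0]) (rule eventually_mono[OF ev], rule ed(2))
  qed (rule eventually_mono[OF ev], erule ed(3), rule eventually_mono[OF ev], erule ed(4), assumption)
qed

text \<open>The two fractions combine to (s - \<sigma>) / ((s - \<rho>) * (\<rho> - \<sigma>)). For
  |\<rho> - \<sigma>| > 1 + 2 * |s - \<sigma>| the distance from s is at least half of that from
  \<sigma>, so the terms are dominated by those of \<open>summable_inverse_square\<close>.\<close>

lemma summable_partial_fractions: "(\<lambda>\<rho>. of_nat (m \<rho>) * (1 / (s - \<rho>) + 1 / (\<rho> - \<sigma>))) summable_on Z" if "f s \<noteq> 0"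
proof -
  let ?B = "1 + 2 * norm (s - \<sigma>)"
  let ?t = "\<lambda>\<rho>. of_nat (m \<rho>) * (1 / (s - \<rho>) + 1 / (\<rho> - \<sigma>))"
  have "?t summable_on (Z - ZR ?B)"
  proof (rule abs_summable_summable, rule summable_on_comparison_test)
    show "(\<lambda>\<rho>. 2 * norm (s - \<sigma>) * (real (m \<rho>) / norm (\<rho> - \<sigma>) ^ 2)) summable_on (Z - ZR ?B)"
      by (intro summable_on_cmult_right summable_on_subset_banach[OF summable_inverse_square]) auto
    fix \<rho> assume "\<rho> \<in> Z - ZR ?B"
    hence \<rho>: "norm (\<rho> - \<sigma>) > ?B" "\<rho> \<noteq> s" "\<rho> \<noteq> \<sigma>" using that nonzero by (auto simp: ZR_def Z_def)
    have "norm (s - \<rho>) \<ge> norm (\<rho> - \<sigma>) - norm (s - \<sigma>)"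
      using norm_triangle_ineq[of "\<rho> - s" "s - \<sigma>"] by (simp add: norm_minus_commute)
    hence "norm (s - \<rho>) \<ge> norm (\<rho> - \<sigma>) / 2" using \<rho> by simp
    hence "norm (\<rho> - \<sigma>) ^ 2 \<le> 2 * norm ((s - \<rho>) * (\<rho> - \<sigma>))"
      using mult_right_mono[of "norm (\<rho> - \<sigma>)" "norm (s - \<rho>) * 2" "norm (\<rho> - \<sigma>)"]
      unfolding norm_mult power2_eq_square by (simp add: mult_ac)
    moreover have "1 / (s - \<rho>) + 1 / (\<rho> - \<sigma>) = (s - \<sigma>) / ((s - \<rho>) * (\<rho> - \<sigma>))" using \<rho> by (simp add: field_simps)
    moreover have "norm ((s - \<rho>) * (\<rho> - \<sigma>)) > 0" "norm (\<rho> - \<sigma>) ^ 2 > 0" using \<rho> by auto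
    ultimately have "norm (1 / (s - \<rho>) + 1 / (\<rho> - \<sigma>)) \<le> 2 * norm (s - \<sigma>) / norm (\<rho> - \<sigma>) ^ 2"
      using mult_left_mono[of "norm (\<rho> - \<sigma>) ^ 2" "2 * norm ((s - \<rho>) * (\<rho> - \<sigma>))" "norm (s - \<sigma>)"]
      by (simp add: norm_divide divide_simps mult_ac del: norm_mult)
    thus "norm (?t \<rho>) \<le> 2 * norm (s - \<sigma>) * (real (m \<rho>) / norm (\<rho> - \<sigma>) ^ 2)"
      using mult_left_mono[of "norm (1 / (s - \<rho>) + 1 / (\<rho> - \<sigma>))" "2 * norm (s - \<sigma>) / norm (\<rho> - \<sigma>) ^ 2" "real (m \<rho>)"]
      by (simp add: norm_mult mult_ac)
  qed auto
  hence "?t summable_on (Z - ZR ?B \<union> ZR ?B)" by (intro summable_on_Un_disjoint) auto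
  also have "Z - ZR ?B \<union> ZR ?B = Z" by (auto simp: ZR_def)
  finally show ?thesis .
qed

text \<open>The remainder \<open>d\<close> already measures the derivative of the logarithm, so the
  series comes straight from the finite quotients and the infinite product is never
  differentiated.\<close>

theorem hadamard_log_derivative:
  assumes "f s \<noteq> 0"
  shows "((\<lambda>\<rho>. of_nat (m \<rho>) * (1 / (s - \<rho>) + 1 / (\<rho> - \<sigma>))) has_sum (deriv f s / f s - deriv f \<sigma> / f \<sigma>)) Z"
proof -
  let ?t = "\<lambda>\<rho>. of_nat (m \<rho>) * (1 / (s - \<rho>) + 1 / (\<rho> - \<sigma>))"
  obtain d where d: "d \<longlonglongrightarrow> 0" "eventually (\<lambda>n. deriv f s / f s - deriv f \<sigma> / f \<sigma> - sum ?t (ZR (real n)) = d n) sequentially"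
    by (rule eventually_finite_quotient[of s]) (use assms in blast)
  have hs: "(?t has_sum infsum ?t Z) Z" using summable_partial_fractions[OF assms] by simp
  hence "(\<lambda>n. sum ?t (ZR (real n))) \<longlonglongrightarrow> infsum ?t Z"
    unfolding has_sum_def by (rule filterlim_compose[OF _ filterlim_ZR])
  moreover have "(\<lambda>n. sum ?t (ZR (real n))) \<longlonglongrightarrow> deriv f s / f s - deriv f \<sigma> / f \<sigma> - 0"
    by (rule Lim_transform_eventually[OF tendsto_diff[OF tendsto_const d(1)]])
       (use d(2) in eventually_elim, simp add: algebra_simps)
  ultimately show ?thesis using hs LIMSEQ_unique by fastforce
qed

lemma convergent_hadamard_product:
  "\<exists>L. ((\<lambda>F. \<Prod>\<rho>\<in>F. weierstrass_factor 1 ((s - \<sigma>) / (\<rho> - \<sigma>)) ^ m \<rho>) \<longlongrightarrow> L) (finite_subsets_at_top Z)"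
proof (rule tendsto_prod_finite_subsets)
  let ?X = "ZR (1 + 3 * norm (s - \<sigma>))"
  let ?z = "\<lambda>\<rho>. (s - \<sigma>) / (\<rho> - \<sigma>)"
  let ?l = "\<lambda>\<rho>. of_nat (m \<rho>) * Ln (weierstrass_factor 1 (?z \<rho>))"
  \<comment> \<open>1/3 makes 3 * |z|^2 smaller than 1/2, the range in which |Ln w| \<le> 2 * |w -
    1|.\<close>
  have small: "norm (?z \<rho>) < 1/3" if "\<rho> \<in> Z - ?X" for \<rho>
  proof -
    have "norm (\<rho> - \<sigma>) > 1 + 3 * norm (s - \<sigma>)" using that by (auto simp: ZR_def)
    thus ?thesis unfolding norm_divide using norm_ge_zero[of "s - \<sigma>"] by (subst divide_less_eq) auto
  qed
  show "weierstrass_factor 1 (?z \<rho>) ^ m \<rho> = exp (?l \<rho>)" if "\<rho> \<in> Z - ?X" for \<rho>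
  proof -
    have "?z \<rho> \<noteq> 1" using small[OF that] by auto
    hence "exp (Ln (weierstrass_factor 1 (?z \<rho>))) = weierstrass_factor 1 (?z \<rho>)" by (intro exp_Ln) simp
    thus ?thesis by (simp add: exp_of_nat_mult)
  qed
  show "?l summable_on (Z - ?X)"
  proof (rule abs_summable_summable, rule summable_on_comparison_test)
    show "(\<lambda>\<rho>. 6 * norm (s - \<sigma>) ^ 2 * (real (m \<rho>) / norm (\<rho> - \<sigma>) ^ 2)) summable_on (Z - ?X)"
      by (intro summable_on_cmult_right summable_on_subset_banach[OF summable_inverse_square]) auto
    fix \<rho> assume "\<rho> \<in> Z - ?X"
    note sm = small[OF this]
    let ?E = "weierstrass_factor 1 (?z \<rho>)"
    have b: "norm (?E - 1) \<le> 3 * norm (?z \<rho>) ^ 2"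
      using weierstrass_factor_bound[of "?z \<rho>" 1] sm by (simp add: numeral_2_eq_2)
    also have "norm (?z \<rho>) ^ 2 < (1/3)^2" by (rule power_strict_mono) (use sm in auto)
    finally have "norm (?E - 1) < 1/2" by (simp add: power2_eq_square)
    from norm_Ln_le[OF this] have "norm (Ln ?E) \<le> 6 * norm (?z \<rho>) ^ 2" using b by simp
    thus "norm (?l \<rho>) \<le> 6 * norm (s - \<sigma>) ^ 2 * (real (m \<rho>) / norm (\<rho> - \<sigma>) ^ 2)"
      using mult_left_mono[of "norm (Ln ?E)" "6 * norm (?z \<rho>) ^ 2" "real (m \<rho>)"]
      by (simp add: norm_mult norm_divide power_divide mult_ac)
  qed auto
qed (use finite_ZR in blast, auto simp: ZR_def)

text \<open>The exponentials in the factors \<open>E_1\<close>, collected over a disc, give exp of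
  (s - \<sigma>) times the sum of m / (\<rho> - \<sigma>). The exponent in
  \<open>finite_quotient\<close> contains the negative of exactly this, so only the logarithmic
  derivative at \<sigma> is left.\<close>

theorem hadamard_product:
  "((\<lambda>F. \<Prod>\<rho>\<in>F. weierstrass_factor 1 ((s - \<sigma>) / (\<rho> - \<sigma>)) ^ m \<rho>) \<longlongrightarrow>
     f s / f \<sigma> * exp (- (s - \<sigma>) * (deriv f \<sigma> / f \<sigma>))) (finite_subsets_at_top Z)"
proof -
  let ?p = "\<lambda>F. \<Prod>\<rho>\<in>F. weierstrass_factor 1 ((s - \<sigma>) / (\<rho> - \<sigma>)) ^ m \<rho>"
  let ?L = "f s / f \<sigma> * exp (- (s - \<sigma>) * (deriv f \<sigma> / f \<sigma>))"
  obtain L where L: "(?p \<longlongrightarrow> L) (finite_subsets_at_top Z)" using convergent_hadamard_product by blast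
  obtain e where e: "e \<longlonglongrightarrow> 0" and
    ev: "eventually (\<lambda>n. f s * exp (- (s - \<sigma>) * (deriv f \<sigma> / f \<sigma> + (\<Sum>\<rho>\<in>ZR (real n). of_nat (m \<rho>) / (\<rho> - \<sigma>)))) = f \<sigma> * P (ZR (real n)) s * exp (e n)) sequentially"
    by (rule eventually_finite_quotient[of s]) blast
  have p: "?p F = P F s * exp ((s - \<sigma>) * (\<Sum>\<rho>\<in>F. of_nat (m \<rho>) / (\<rho> - \<sigma>)))" if "finite F" for F
  proof -
    have "?p F = P F s * (\<Prod>\<rho>\<in>F. exp (of_nat (m \<rho>) * ((s - \<sigma>) / (\<rho> - \<sigma>))))"
      unfolding P_def weierstrass_factor_one power_mult_distrib prod.distrib exp_of_nat_mult ..
    also have "(\<Prod>\<rho>\<in>F. exp (of_nat (m \<rho>) * ((s - \<sigma>) / (\<rho> - \<sigma>)))) = exp (\<Sum>\<rho>\<in>F. of_nat (m \<rho>) * ((s - \<sigma>) / (\<rho> - \<sigma>)))"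
      using that by (simp only: exp_sum)
    also have "(\<Sum>\<rho>\<in>F. of_nat (m \<rho>) * ((s - \<sigma>) / (\<rho> - \<sigma>))) = (s - \<sigma>) * (\<Sum>\<rho>\<in>F. of_nat (m \<rho>) / (\<rho> - \<sigma>))"
      unfolding sum_distrib_left by (intro sum.cong refl) simp
    finally show ?thesis .
  qed
  have ex: "exp (- x * (a + T)) * exp (x * T) = exp (- x * a)" for x a T :: complex
    unfolding exp_add[symmetric] by (rule arg_cong[of _ _ exp]) (simp add: algebra_simps)
  have "(\<lambda>n. ?L * exp (- e n)) \<longlonglongrightarrow> ?L * exp (- 0)" by (intro tendsto_intros e)
  moreover have "eventually (\<lambda>n. ?L * exp (- e n) = ?p (ZR (real n))) sequentially"
    using ev
  proof eventually_elim
    case (elim n)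
    let ?T = "\<Sum>\<rho>\<in>ZR (real n). of_nat (m \<rho>) / (\<rho> - \<sigma>)"
    have "f \<sigma> * ?p (ZR (real n)) = f \<sigma> * P (ZR (real n)) s * exp (e n) * exp (- e n) * exp ((s - \<sigma>) * ?T)"
      unfolding p[OF finite_ZR] by (simp add: exp_minus)
    also have "\<dots> = f s * (exp (- (s - \<sigma>) * (deriv f \<sigma> / f \<sigma> + ?T)) * exp ((s - \<sigma>) * ?T)) * exp (- e n)"
      unfolding elim[symmetric] by (simp only: mult_ac)
    also have "\<dots> = f s * exp (- (s - \<sigma>) * (deriv f \<sigma> / f \<sigma>)) * exp (- e n)"
      unfolding ex ..
    finally show ?case using nonzero by (simp add: field_simps)
  qed
  ultimately have "(\<lambda>n. ?p (ZR (real n))) \<longlonglongrightarrow> ?L" by (simp add: Lim_transform_eventually)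
  moreover have "(\<lambda>n. ?p (ZR (real n))) \<longlonglongrightarrow> L" by (rule filterlim_compose[OF L filterlim_ZR])
  ultimately show ?thesis using L LIMSEQ_unique by blast
qed

end

section \<open>Inversion of the theta series\<close>

text \<open>With y = c * u and c^2 = 2 * pi * x this is the characteristic function of the standard
  normal law at - 2 * pi * k / c.\<close>

lemma gaussian_fourier:
  fixes x :: real and k :: int
  assumes x: "x > 0"
  shows "integrable lborel (\<lambda>u. exp (- pi * x * u^2) * exp (- 2 * pi * \<i> * k * u) :: complex)" (is ?A)
    "(LINT u|lborel. exp (- pi * x * u^2) * exp (- 2 * pi * \<i> * k * u)) = of_real (exp (- pi * k^2 / x) / sqrt x)" (is ?B)
proof -
  define c where "c = sqrt (2 * pi * x)"
  have c: "c > 0" "c^2 = 2 * pi * x" using x by (auto simp: c_def)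
  define t where "t = - 2 * pi * k / c"
  let ?F = "\<lambda>y. std_normal_density y *\<^sub>R iexp (t * y)"
  have intF: "integrable lborel ?F"
    by (rule Bochner_Integration.integrable_bound[OF integrable_normal_density[of 1 0]]) auto
  have val: "integral\<^sup>L lborel ?F = of_real (exp (- (t^2) / 2))"
    using fun_cong[OF char_std_normal_distribution, of t] unfolding char_def
    by (subst (asm) integral_density) auto
  have eq: "?F (0 + c * u) = (1 / sqrt (2 * pi)) *\<^sub>R (exp (- pi * x * u^2) * exp (- 2 * pi * \<i> * k * u))" for u :: real
  proof -
    have "(c * u)^2 / 2 = pi * x * u^2" using c by (simp add: power_mult_distrib)
    moreover have "t * (c * u) = - 2 * pi * k * u" using c by (simp add: t_def)
    ultimately show ?thesis unfolding std_normal_density_def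
      by (simp add: scaleR_conv_of_real exp_of_real[symmetric] mult_ac)
  qed
  have "integrable lborel (\<lambda>u. ?F (0 + c * u))" using c by (intro lborel_integrable_real_affine intF) auto
  hence "integrable lborel (\<lambda>u. sqrt (2*pi) *\<^sub>R ?F (0 + c * u))" by (rule integrable_scaleR_right)
  thus ?A unfolding eq by simp
  have "of_real (exp (- (t^2) / 2)) = \<bar>c\<bar> *\<^sub>R (LINT u|lborel. ?F (0 + c * u))"
    unfolding val[symmetric] by (rule lborel_integral_real_affine) (use c in auto)
  also have "\<dots> = (c / sqrt (2 * pi)) *\<^sub>R (LINT u|lborel. exp (- pi * x * u^2) * exp (- 2 * pi * \<i> * k * u))"
    unfolding eq using c by simp
  also have "c / sqrt (2 * pi) = sqrt x" by (simp add: c_def real_sqrt_mult)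
  finally have "(LINT u|lborel. exp (- pi * x * u^2) * exp (- 2 * pi * \<i> * k * u)) = (1 / sqrt x) *\<^sub>R of_real (exp (- (t^2) / 2))"
    using x by simp
  moreover have "(t^2) / 2 = pi * k^2 / x" using x pi_gt_zero
    unfolding t_def power_divide c(2) by (simp add: field_simps power2_eq_square)
  ultimately show ?B by (simp add: scaleR_conv_of_real)
qed

lemma cesaro_mean_tendsto:
  fixes a :: "nat \<Rightarrow> complex"
  assumes "a \<longlonglongrightarrow> l"
  shows "(\<lambda>N. (\<Sum>k<N. a k) / of_nat N) \<longlonglongrightarrow> l"
proof -
  have "(\<lambda>N. (\<Sum>k<N. a k - l) / of_nat N) \<longlonglongrightarrow> 0"
  proof (rule LIMSEQ_I)
    fix e :: real assume e: "e > 0"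
    have "(\<lambda>k. a k - l) \<longlonglongrightarrow> 0" using assms by (simp add: LIM_zero)
    from LIMSEQ_D[OF this, of "e/2"] e obtain K where K: "\<And>k. k \<ge> K \<Longrightarrow> norm (a k - l) < e/2" by auto
    define B where "B = (\<Sum>k<K. norm (a k - l))"
    have "eventually (\<lambda>N. real N > 2 * B / e \<and> N > 0) sequentially"
      by (rule eventually_conj; real_asymp)
    then obtain N0 where N0: "\<And>N. N \<ge> N0 \<Longrightarrow> real N > 2 * B / e \<and> N > 0" by (auto simp: eventually_sequentially)
    have "norm ((\<Sum>k<N. a k - l) / of_nat N - 0) < e" if N: "N \<ge> N0" for N
    proof -
      have "norm (\<Sum>k<N. a k - l) \<le> (\<Sum>k<N. norm (a k - l))" by (rule norm_sum)
      also have "\<dots> \<le> (\<Sum>k<N. (if k \<in> {..<K} then norm (a k - l) else 0) + e/2)"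
        using K e by (intro sum_mono) (auto simp: less_imp_le not_less)
      also have "\<dots> = (\<Sum>k\<in>{..<N} \<inter> {..<K}. norm (a k - l)) + real N * (e/2)"
        by (simp only: sum.distrib sum.inter_restrict[OF finite_lessThan] sum_constant card_lessThan)
      also have "(\<Sum>k\<in>{..<N} \<inter> {..<K}. norm (a k - l)) + real N * (e/2) \<le> B + real N * (e/2)"
        unfolding B_def by (intro add_right_mono sum_mono2) auto
      also have "\<dots> < real N * e" using N0[OF N] e by (simp add: field_simps)
      finally show ?thesis using N0[OF N] by (simp add: norm_divide field_simps)
    qed
    thus "\<exists>N0. \<forall>N\<ge>N0. norm ((\<Sum>k<N. a k - l) / of_nat N - 0) < e" by blast
  qed
  moreover have "eventually (\<lambda>N. (\<Sum>k<N. a k - l) / of_nat N = (\<Sum>k<N. a k) / of_nat N - l) sequentially"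
    using eventually_gt_at_top[of 0] by eventually_elim (simp add: sum_subtractf field_simps)
  ultimately have "(\<lambda>N. (\<Sum>k<N. a k) / of_nat N - l) \<longlonglongrightarrow> 0" using tendsto_cong by fast
  thus ?thesis by (simp add: LIM_zero_cancel)
qed

text \<open>Euler's integral in the variable u = ln t. Dilations of t become translations of u, so
  \<open>gamma_term\<close> can insert the scale pi * (n + 1)^2 by translation invariance of
  Lebesgue measure.\<close>

lemma Gamma_integral_exp_substitution:
  assumes z: "Re z > 0"
  shows "has_bochner_integral lborel (\<lambda>u. exp (- of_real (exp u)) * exp (of_real u * z)) (Gamma z)"
proof -
  let ?f = "\<lambda>t. of_real t powr (z - 1) / of_real (exp t) :: complex"
  have "x \<in> range exp" if "x > 0" for x :: real using that by (intro image_eqI[of _ _ "ln x"]) auto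
  hence img: "range exp = {0::real<..}" by auto
  have "(\<lambda>u. \<bar>exp u\<bar> *\<^sub>R ?f (exp u)) absolutely_integrable_on UNIV \<and> integral UNIV (\<lambda>u. \<bar>exp u\<bar> *\<^sub>R ?f (exp u)) = Gamma z \<longleftrightarrow>
      ?f absolutely_integrable_on (range exp) \<and> integral (range exp) ?f = Gamma z"
  proof (rule has_absolute_integral_change_of_variables_real[where g = exp and h = exp and f = "?f" and S = UNIV])
    show "(exp has_field_derivative exp x) (at x within UNIV)" for x :: real by (rule DERIV_exp)
    show "inj_on (exp :: real \<Rightarrow> real) UNIV" by (simp add: inj_on_def)
  qed simp
  moreover have "?f absolutely_integrable_on (range exp) \<and> integral (range exp) ?f = Gamma z"
    unfolding img using absolutely_integrable_Gamma_integral'[OF z] Gamma_integral_complex'[OF z] by (auto intro: integral_unique)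
  moreover have eq: "(\<lambda>u. \<bar>exp u\<bar> *\<^sub>R ?f (exp u)) = (\<lambda>u. exp (- of_real (exp u)) * exp (of_real u * z))"
  proof
    fix u :: real
    have "complex_of_real (exp u) powr (z - 1) = exp ((z - 1) * of_real u)"
      by (simp add: powr_def Ln_of_real)
    thus "\<bar>exp u\<bar> *\<^sub>R ?f (exp u) = exp (- of_real (exp u)) * exp (of_real u * z)"
      by (simp add: scaleR_conv_of_real exp_of_real[symmetric] exp_minus exp_diff algebra_simps divide_inverse)
  qed
  ultimately have *: "(\<lambda>u. exp (- of_real (exp u)) * exp (of_real u * z)) absolutely_integrable_on UNIV"
    "integral UNIV (\<lambda>u. exp (- of_real (exp u)) * exp (of_real u * z)) = Gamma z" by simp_all
  have meas: "(\<lambda>u. exp (- of_real (exp u)) * exp (of_real u * z)) \<in> borel_measurable lborel"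
    unfolding measurable_lborel2 by (intro borel_measurable_continuous_onI continuous_intros)
  have int: "integrable lborel (\<lambda>u. exp (- of_real (exp u)) * exp (of_real u * z))"
    using * meas by (simp add: set_integrable_def integrable_completion)
  with * have "integral\<^sup>L lborel (\<lambda>u. exp (- of_real (exp u)) * exp (of_real u * z)) = Gamma z"
    by (simp add: integral_lborel)
  with int show ?thesis by (simp add: has_bochner_integral_iff)
qed

lemma exp_2pi_int: "exp (2 * pi * \<i> * of_int k) = 1" "exp (- 2 * pi * \<i> * of_int k) = 1"
  using exp_integer_2pi[of "of_int k"] exp_integer_2pi[of "of_int (- k)"] by (simp_all add: mult_ac)

text \<open>
  Poisson summation for the Gaussian by Chernoff's argument: \<open>h\<close> is the periodized Gaussian with Fourier
  coefficients \<open>c k\<close>. Since \<open>h\<close> is Lipschitz, \<open>q u = (h u - h 0) / (e (-1) u - 1)\<close> is bounded, and its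
  coefficients \<open>b k\<close> make \<open>c k - h 0 * [k = 0]\<close> telescope. Averaging the symmetric partial
  sums replaces the Riemann-Lebesgue lemma by dominated convergence.
\<close>

context
  fixes x :: real
  assumes x: "x > 0"
begin

private definition r where "r = exp (- pi * x)"
private definition g where "g y = exp (- pi * x * y^2)"
text \<open>Since \<open>g\<close> is even, pairing the translates by n and by - n - 1 turns the
  two-sided periodization into a series over the naturals.\<close>

private definition t where "t n u = g (real n + u) + g (real n + 1 - u)"
private definition h where "h u = (\<Sum>n. t n u)"
private definition e :: "int \<Rightarrow> real \<Rightarrow> complex" where "e k u = exp (- 2 * pi * \<i> * of_int k * of_real u)"
private definition I where "I = (indicator {0..<1} :: real \<Rightarrow> real)"
private definition L where "L = (\<Sum>n. 4 * pi * x * (real (Suc n) * r ^ n))"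

private lemma r: "0 < r" "r < 1" using x by (auto simp: r_def)

private lemma g_bound: "g y \<le> r ^ n" if "y \<ge> real n"
proof -
  have "real n \<le> real n ^ 2" using of_nat_mono[OF le_square[of n], where 'a = real] by (simp add: power2_eq_square)
  also have "\<dots> \<le> y^2" using that by (intro power_mono) auto
  finally have "pi * x * real n \<le> pi * x * y^2" using x by (intro mult_left_mono) auto
  hence "g y \<le> exp (- pi * x * real n)" by (simp add: g_def)
  also have "\<dots> = r ^ n" by (simp add: r_def exp_of_nat_mult[symmetric] mult_ac)
  finally show ?thesis .
qed

private lemma g_nonneg: "g y \<ge> 0" by (simp add: g_def)

private lemma t_bound: "norm (t n u) \<le> 2 * r ^ n" if "u \<in> {0..1}"
  using g_bound[of n "real n + u"] g_bound[of n "real n + 1 - u"] g_nonneg[of "real n + u"] g_nonneg[of "real n + 1 - u"] that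
  by (simp add: t_def)

private lemma summable_r: "summable (\<lambda>n. 2 * r ^ n)"
  using r by (intro summable_mult summable_geometric) auto

private lemma summable_t: "summable (\<lambda>n. t n u)" if "u \<in> {0..1}"
  by (rule summable_comparison_test'[OF summable_r]) (rule t_bound[OF that])

private lemma g_lipschitz: "\<bar>g a - g b\<bar> \<le> 2 * pi * x * (real (Suc n) * r ^ n) * \<bar>a - b\<bar>"
  if "a \<in> {real n..real n + 1}" "b \<in> {real n..real n + 1}"
proof -
  have "norm (g a - g b) \<le> 2 * pi * x * (real (Suc n) * r ^ n) * norm (a - b)"
  proof (rule field_differentiable_bound[where S = "{real n..real n + 1}"])
    show "(g has_field_derivative (- 2 * pi * x * z * g z)) (at z within {real n..real n + 1})" for z
      unfolding g_def by (auto intro!: derivative_eq_intros)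
    fix z assume z: "z \<in> {real n..real n + 1}"
    hence "z * g z \<le> real (Suc n) * r ^ n" using g_bound[of n z] g_nonneg[of z] by (intro mult_mono) auto
    hence "2 * pi * x * (z * g z) \<le> 2 * pi * x * (real (Suc n) * r ^ n)" using x by (intro mult_left_mono) auto
    thus "norm (- 2 * pi * x * z * g z) \<le> 2 * pi * x * (real (Suc n) * r ^ n)"
      using z x g_nonneg[of z] by (simp add: abs_mult mult_ac)
  qed (use that in auto)
  thus ?thesis by simp
qed

private lemma summable_L: "summable (\<lambda>n. 4 * pi * x * (real (Suc n) * r ^ n))"
  using r geometric_deriv_sums[of r] by (intro summable_mult) (auto simp: sums_iff)

private lemma h_lipschitz: "\<bar>h u - h v\<bar> \<le> L * \<bar>u - v\<bar>" if u: "u \<in> {0..1}" and v: "v \<in> {0..1}"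
proof -
  have b: "norm (t n u - t n v) \<le> 4 * pi * x * (real (Suc n) * r ^ n) * \<bar>u - v\<bar>" for n
    using g_lipschitz[of "real n + u" n "real n + v"] g_lipschitz[of "real n + 1 - u" n "real n + 1 - v"] u v
    by (simp add: t_def abs_minus_commute[of v u])
  have s: "summable (\<lambda>n. 4 * pi * x * (real (Suc n) * r ^ n) * \<bar>u - v\<bar>)" by (intro summable_mult2 summable_L)
  have "h u - h v = (\<Sum>n. t n u - t n v)" unfolding h_def by (intro suminf_diff summable_t u v)
  also have "norm \<dots> \<le> (\<Sum>n. 4 * pi * x * (real (Suc n) * r ^ n) * \<bar>u - v\<bar>)"
    by (rule norm_suminf_le[OF b s])
  also have "\<dots> = L * \<bar>u - v\<bar>" unfolding L_def by (rule suminf_mult2[OF summable_L, symmetric])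
  finally show ?thesis by simp
qed

private lemma h_1: "h 1 = h 0" by (simp add: h_def t_def add_ac)

private lemma h_measurable [measurable]: "h \<in> borel_measurable borel"
  unfolding h_def t_def g_def by measurable

private lemma e_measurable [measurable]: "e k \<in> borel_measurable borel"
  unfolding e_def by (intro borel_measurable_continuous_onI continuous_intros)

private lemma norm_e [simp]: "norm (e k u) = 1"
  by (simp add: e_def)

private lemma e_shift: "e k (u + real n) = e k u" "e k (u - real n) = e k u"
  using exp_2pi_int[of "k * int n"]
  by (simp_all add: e_def algebra_simps exp_add exp_diff exp_minus inverse_eq_divide)

private lemma I_integrable: "integrable lborel (\<lambda>u. I u *\<^sub>R f u)" if "f \<in> borel_measurable borel" "\<And>u. u \<in> {0..<1} \<Longrightarrow> norm (f u) \<le> B"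
   for f :: "real \<Rightarrow> complex"
proof -
  have "set_integrable lborel {0..<1} f"
    unfolding set_integrable_def
  proof (rule Bochner_Integration.integrable_bound[of lborel "\<lambda>u. indicator {0..<1::real} u * \<bar>B\<bar>"])
    show "integrable lborel (\<lambda>u. indicator {0..<1::real} u * \<bar>B\<bar>)"
      by (intro integrable_mult_left integrable_real_indicator) auto
    show "AE u in lborel. norm (indicator {0..<1} u *\<^sub>R f u) \<le> norm (indicator {0..<1::real} u * \<bar>B\<bar>)"
      using that(2) by (intro AE_I2) (force simp: indicator_def)
  qed (use that in measurable)
  thus ?thesis by (simp add: set_integrable_def I_def)
qed

text \<open>Unfolding: the intervals [n, n + 1) and [- n - 1, - n) tile the line and
  \<open>e k\<close> has period 1, so integrating the periodization over [0, 1) yields the Fourier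
  transform of the Gaussian. The same series of integrals is summed twice, over the line in
  \<open>s1\<close> and under the integral over [0, 1) in \<open>s2\<close>.\<close>

private lemma coefficient: "(LINT u|lborel. I u *\<^sub>R (of_real (h u) * e k u)) = of_real (exp (- pi * k^2 / x) / sqrt x)"
proof -
  define G where "G y = of_real (g y) * e k y" for y
  have Gm [measurable]: "G \<in> borel_measurable borel" unfolding G_def g_def by measurable
  have G_eq: "G = (\<lambda>u. complex_of_real (exp (- pi * x * u^2)) * exp (- 2 * pi * \<i> * k * u))"
    by (simp add: fun_eq_iff G_def g_def e_def)
  have G: "integrable lborel G" "integral\<^sup>L lborel G = of_real (exp (- pi * k^2 / x) / sqrt x)"
    unfolding G_eq by (rule gaussian_fourier[OF x])+
  define f where "f n y = (indicator {real n..<real n + 1} y + indicator {- real n - 1..<- real n} y :: real) *\<^sub>R G y" for n y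
  have f_int: "integrable lborel (f n)" for n
    unfolding f_def scaleR_add_left using G(1) by (intro Bochner_Integration.integrable_add integrable_mult_indicator) auto
  have f_single: "\<exists>N. \<forall>n. f n y = (if n = N then G y else 0)" for y
  proof -
    \<comment> \<open>For y < 0 the tile is - N - 1 \<le> y < - N, that is N < - y \<le> N + 1,
      hence a ceiling lowered by one instead of a floor.\<close>
    define N where "N = (if y \<ge> 0 then nat \<lfloor>y\<rfloor> else nat (\<lceil>-y\<rceil> - 1))"
    have "f n y = (if n = N then G y else 0)" for n
    proof (cases "y \<ge> 0")
      case True
      hence "n = N \<longleftrightarrow> \<lfloor>y\<rfloor> = int n" unfolding N_def by auto
      thus ?thesis using True by (auto simp: f_def indicator_def floor_eq_iff)
    next
      case False
      hence "\<lceil>- y\<rceil> \<ge> 1" by linarith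
      hence "n = N \<longleftrightarrow> \<lceil>- y\<rceil> = int n + 1" unfolding N_def using False by auto
      thus ?thesis using False by (auto simp: f_def indicator_def ceiling_eq_iff)
    qed
    thus ?thesis by blast
  qed
  have f_sums: "(\<lambda>n. f n y) sums G y" and f_summable: "summable (\<lambda>n. norm (f n y))" for y
  proof -
    obtain N where N: "\<And>n. f n y = (if n = N then G y else 0)" using f_single[of y] by blast
    show "(\<lambda>n. f n y) sums G y" using sums_single[of N "\<lambda>_. G y"] by (simp add: N)
    have "(\<lambda>n. norm (f n y)) = (\<lambda>n. if n = N then norm (G y) else 0)" by (auto simp: N)
    thus "summable (\<lambda>n. norm (f n y))" using sums_summable[OF sums_single[of N "\<lambda>_. norm (G y)"]] by simp
  qed
  have f_shift: "integral\<^sup>L lborel (f n) = (LINT u|lborel. I u *\<^sub>R (of_real (t n u) * e k u))" for n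
  proof -
    have i: "integrable lborel (\<lambda>y. indicator {real n..<real n + 1} y *\<^sub>R G y)"
            "integrable lborel (\<lambda>y. indicator {- real n - 1..<- real n} y *\<^sub>R G y)"
      using G(1) by (auto intro!: integrable_mult_indicator)
    have "integral\<^sup>L lborel (f n) = (LINT y|lborel. indicator {real n..<real n + 1} y *\<^sub>R G y) + (LINT y|lborel. indicator {- real n - 1..<- real n} y *\<^sub>R G y)"
      unfolding f_def scaleR_add_left using i by (rule Bochner_Integration.integral_add)
    also have "(LINT y|lborel. indicator {real n..<real n + 1} y *\<^sub>R G y) = (LINT u|lborel. I u *\<^sub>R G (real n + u))"
      by (subst lborel_integral_real_affine[where c = 1 and t = "real n"]) (auto simp: I_def indicator_def intro!: Bochner_Integration.integral_cong)
    also have "(LINT y|lborel. indicator {- real n - 1..<- real n} y *\<^sub>R G y) = (LINT u|lborel. I u *\<^sub>R G (- real n - 1 + u))"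
      by (subst lborel_integral_real_affine[where c = 1 and t = "- real n - 1"]) (auto simp: I_def indicator_def intro!: Bochner_Integration.integral_cong)
    also have "(LINT u|lborel. I u *\<^sub>R G (real n + u)) + (LINT u|lborel. I u *\<^sub>R G (- real n - 1 + u)) =
       (LINT u|lborel. I u *\<^sub>R G (real n + u) + I u *\<^sub>R G (- real n - 1 + u))"
      using lborel_integrable_real_affine[OF i(1), of 1 "real n"] lborel_integrable_real_affine[OF i(2), of 1 "- real n - 1"]
      by (intro Bochner_Integration.integral_add[symmetric]) (auto simp: I_def indicator_def elim!: Bochner_Integration.integrable_cong[THEN iffD1, rotated 2])
    also have "(\<lambda>u. I u *\<^sub>R G (real n + u) + I u *\<^sub>R G (- real n - 1 + u)) = (\<lambda>u. I u *\<^sub>R (of_real (t n u) * e k u))"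
    proof
      fix u
      have "e k (real n + u) = e k u" "e k (- real n - 1 + u) = e k u"
        using e_shift(1)[of k u n] e_shift(2)[of k u "Suc n"] by (simp_all add: algebra_simps)
      moreover have "g (- real n - 1 + u) = g (real n + 1 - u)" by (simp add: g_def power2_eq_square algebra_simps)
      ultimately show "I u *\<^sub>R G (real n + u) + I u *\<^sub>R G (- real n - 1 + u) = I u *\<^sub>R (of_real (t n u) * e k u)"
        by (simp add: G_def t_def algebra_simps)
    qed
    finally show ?thesis .
  qed
  have bd: "norm (f n y) \<le> r ^ n * (indicator {real n..<real n + 1} y + indicator {- real n - 1..<- real n} y)" for n y
    using g_bound[of n y] g_bound[of n "- y"] g_nonneg[of y] by (auto simp: f_def G_def norm_mult indicator_def g_def)
  have ibd: "integrable lborel (\<lambda>y. r ^ n * (indicator {real n..<real n + 1} y + indicator {- real n - 1..<- real n} y))" for n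
    by (intro Bochner_Integration.integrable_mult_right Bochner_Integration.integrable_add) auto
  have "summable (\<lambda>n. LINT y|lborel. norm (f n y))"
  proof (rule summable_comparison_test'[OF summable_r])
    fix n :: nat
    have "(LINT y|lborel. norm (f n y)) \<le> (LINT y|lborel. r ^ n * (indicator {real n..<real n + 1} y + indicator {- real n - 1..<- real n} y))"
      using f_int ibd bd by (intro integral_mono) auto
    also have "\<dots> = r ^ n * ((LINT y|lborel. indicator {real n..<real n + 1} y) + (LINT y|lborel. indicator {- real n - 1..<- real n} y))"
      by (subst Bochner_Integration.integral_mult_right, intro Bochner_Integration.integrable_add, simp, simp, subst Bochner_Integration.integral_add) auto
    also have "\<dots> = 2 * r ^ n" by simp
    finally show "norm (LINT y|lborel. norm (f n y)) \<le> 2 * r ^ n" by simp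
  qed
  hence "(\<lambda>n. integral\<^sup>L lborel (f n)) sums (LINT y|lborel. (\<Sum>n. f n y))"
    by (intro sums_integral f_int AE_I2 f_summable)
  hence "(\<lambda>n. integral\<^sup>L lborel (f n)) sums integral\<^sup>L lborel G" using sums_unique[OF f_sums, symmetric] by simp
  hence s1: "(\<lambda>n. LINT u|lborel. I u *\<^sub>R (of_real (t n u) * e k u)) sums integral\<^sup>L lborel G" unfolding f_shift .
  have tm [measurable]: "t n \<in> borel_measurable borel" for n unfolding t_def g_def by measurable
  have int2: "integrable lborel (\<lambda>u. I u *\<^sub>R (of_real (t n u) * e k u))" for n
    by (rule I_integrable[where B = "2 * r ^ n"]) (use t_bound in \<open>auto simp: norm_mult\<close>)
  have bd2: "norm (I u *\<^sub>R (of_real (t n u) * e k u)) \<le> 2 * r ^ n * I u" for n u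
    using t_bound[of u n] by (auto simp: norm_mult I_def indicator_def)
  have intI: "integrable lborel I" "integral\<^sup>L lborel I = 1" by (auto simp: I_def)
  have s2: "(\<lambda>n. LINT u|lborel. I u *\<^sub>R (of_real (t n u) * e k u)) sums (LINT u|lborel. (\<Sum>n. I u *\<^sub>R (of_real (t n u) * e k u)))"
  proof (rule sums_integral[OF int2])
    show "AE u in lborel. summable (\<lambda>n. norm (I u *\<^sub>R (of_real (t n u) * e k u)))"
      by (rule AE_I2, rule summable_comparison_test'[OF summable_mult2[OF summable_r]]) (use bd2 in auto)
    show "summable (\<lambda>n. LINT u|lborel. norm (I u *\<^sub>R (of_real (t n u) * e k u)))"
    proof (rule summable_comparison_test'[OF summable_r])
      fix n :: nat
      have "(LINT u|lborel. norm (I u *\<^sub>R (of_real (t n u) * e k u))) \<le> (LINT u|lborel. 2 * r ^ n * I u)"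
        by (intro integral_mono integrable_norm int2 bd2 Bochner_Integration.integrable_mult_right intI(1))
      also have "\<dots> = 2 * r ^ n" using intI by simp
      finally show "norm (LINT u|lborel. norm (I u *\<^sub>R (of_real (t n u) * e k u))) \<le> 2 * r ^ n" by simp
    qed
  qed
  have "(\<Sum>n. I u *\<^sub>R (of_real (t n u) * e k u)) = I u *\<^sub>R (of_real (h u) * e k u)" for u
  proof (cases "u \<in> {0..<1}")
    case True
    hence "(\<lambda>n. t n u) sums h u" unfolding h_def using summable_t[of u] by (intro summable_sums) auto
    hence "(\<lambda>n. complex_of_real (t n u)) sums of_real (h u)" by (simp only: sums_of_real_iff)
    hence "(\<lambda>n. I u *\<^sub>R (of_real (t n u) * e k u)) sums (I u *\<^sub>R (of_real (h u) * e k u))"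
      by (intro sums_scaleR_right sums_mult2)
    thus ?thesis by (simp add: sums_iff)
  qed (auto simp: I_def)
  with s1 s2 G(2) show ?thesis by (simp add: sums_iff)
qed

text \<open>At u = 0 the denominator is 0 and the default quotient is 0; since the numerator
  vanishes there too, multiplying back by the denominator still restores it.\<close>

private definition q where "q u = (of_real (h u) - of_real (h 0)) / (e (- 1) u - 1)" for u :: real

private lemma q_measurable [measurable]: "q \<in> borel_measurable borel" unfolding q_def by measurable

private lemma e_eq_1_iff: "e k u = 1 \<longleftrightarrow> u = 0" if "u \<in> {0..<1}" "\<bar>k\<bar> = 1"
proof
  assume "e k u = 1"
  then obtain n :: int where "- 2 * pi * k * u = of_int (2 * n) * pi"
    unfolding e_def exp_eq_1 by auto
  hence "pi * (real_of_int n) = pi * (- real_of_int k * u)" by (simp add: mult_ac)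
  hence "real_of_int n = - real_of_int k * u" unfolding mult_cancel_left by simp
  hence *: "\<bar>real_of_int n\<bar> = u" using that by (simp add: abs_mult flip: of_int_abs)
  hence "real_of_int \<bar>n\<bar> < 1" using that by simp
  hence "n = 0" by linarith
  with * show "u = 0" by simp
qed (simp add: e_def)

text \<open>The bound |exp z - 1| \<ge> |z| / 2 is available for |z| \<le> 1/2. The restriction to
  1/16 secures this through pi < 4, and pi > 3 gives the slope.\<close>

private lemma norm_e_minus_1_ge: "norm (exp (2 * pi * \<i> * of_real u) - 1) \<ge> 3 * \<bar>u\<bar>" if "\<bar>u\<bar> \<le> 1/16"
proof -
  let ?z = "2 * pi * \<i> * of_real u"
  have n: "norm ?z = 2 * pi * \<bar>u\<bar>" by (simp add: norm_mult)
  have "pi * \<bar>u\<bar> \<le> 4 * (1/16)" using that pi_less_4 by (intro mult_mono) auto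
  hence "norm ?z \<le> 1/2" unfolding n by simp
  from norm_exp_bounds(1)[OF this] have "pi * \<bar>u\<bar> \<le> norm (exp ?z - 1)" unfolding n by simp
  moreover have "3 * \<bar>u\<bar> \<le> pi * \<bar>u\<bar>" using pi_gt3 by (intro mult_right_mono) auto
  ultimately show ?thesis by simp
qed

private lemma L_nonneg: "L \<ge> 0" unfolding L_def using x r by (intro suminf_nonneg summable_L) auto

text \<open>The denominator degenerates only at the two ends of the period. There the Lipschitz
  bound for \<open>h\<close>, used at 1 together with \<open>h 1 = h 0\<close>, matches its linear
  decay; in between a continuous function without zeros has a positive minimum.\<close>

private lemma q_bounded: obtains B where "B \<ge> 0" "\<And>u. u \<in> {0..<1} \<Longrightarrow> norm (q u) \<le> B"
proof -
  have cont: "continuous_on {1/16..15/16} (\<lambda>u. norm (e (- 1) u - 1))"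
    unfolding e_def by (intro continuous_intros)
  obtain u0 where u0: "u0 \<in> {1/16..15/16}" "\<And>u. u \<in> {1/16..15/16} \<Longrightarrow> norm (e (- 1) u0 - 1) \<le> norm (e (- 1) u - 1)"
    using continuous_attains_inf[OF _ _ cont] by auto
  define m where "m = norm (e (- 1) u0 - 1)"
  have m: "m > 0" using u0(1) e_eq_1_iff[of u0 "- 1"] by (auto simp: m_def)
  have hn: "norm (complex_of_real (h u) - of_real (h 0)) \<le> L * u" "norm (complex_of_real (h u) - of_real (h 0)) \<le> L * (1 - u)" if "u \<in> {0..<1}" for u
    using h_lipschitz[of u 0] h_lipschitz[of u 1] that unfolding of_real_diff[symmetric] norm_of_real by (auto simp: h_1)
  show ?thesis
  proof (rule that[of "L + L / m"])
    show "L + L / m \<ge> 0" using L_nonneg m by simp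
    fix u :: real assume u: "u \<in> {0..<1}"
    consider "u = 0" | "u > 0" "u \<le> 1/16" | "u \<ge> 15/16" | "u \<in> {1/16..15/16}" using u by force
    thus "norm (q u) \<le> L + L / m"
    proof cases
      case 1
      thus ?thesis using L_nonneg m by (simp add: q_def)
    next
      case 2
      have "3 * u \<le> norm (e (- 1) u - 1)" using norm_e_minus_1_ge[of u] 2 by (simp add: e_def)
      hence "norm (q u) \<le> L * u / (3 * u)" using hn(1)[OF u] 2 L_nonneg unfolding q_def norm_divide by (intro frac_le) auto
      also have "\<dots> \<le> L" using 2 L_nonneg by simp
      finally show ?thesis using L_nonneg m by (smt (verit) divide_nonneg_pos)
    next
      case 3
      have "e (- 1) u = exp (2 * pi * \<i> * of_real (u - 1))" using exp_2pi_int[of 1] by (simp add: e_def exp_diff algebra_simps)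
      hence "3 * (1 - u) \<le> norm (e (- 1) u - 1)" using norm_e_minus_1_ge[of "u - 1"] 3 u by simp
      hence "norm (q u) \<le> L * (1 - u) / (3 * (1 - u))" using hn(2)[OF u] u L_nonneg unfolding q_def norm_divide by (intro frac_le) auto
      also have "\<dots> = L / 3" by (subst mult_divide_mult_cancel_right) (use u in auto)
      also have "\<dots> \<le> L" using L_nonneg by simp
      finally show ?thesis using L_nonneg m by (smt (verit) divide_nonneg_pos)
    next
      case 4
      have "L * u \<le> L * 1" using u L_nonneg by (intro mult_left_mono) auto
      hence "norm (q u) \<le> L / m" using hn(1)[OF u] u0(2)[OF 4] m L_nonneg unfolding q_def norm_divide m_def by (intro frac_le) auto
      thus ?thesis using L_nonneg by simp
    qed
  qed
qed

private definition b where "b k = (LINT u|lborel. I u *\<^sub>R (q u * e k u))"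
private definition c where "c k = (LINT u|lborel. I u *\<^sub>R (of_real (h u) * e k u))"

private lemma qe_integrable: "integrable lborel (\<lambda>u. I u *\<^sub>R (q u * e k u))"
proof -
  obtain B where B: "\<And>u. u \<in> {0..<1} \<Longrightarrow> norm (q u) \<le> B" using q_bounded by metis
  show ?thesis by (rule I_integrable[of _ B]) (use B in \<open>auto simp: norm_mult\<close>)
qed

private lemma he_integrable: "integrable lborel (\<lambda>u. I u *\<^sub>R (of_real (h u) * e k u))"
proof (rule I_integrable[of _ "\<bar>h 0\<bar> + L"])
  fix u :: real assume "u \<in> {0..<1}"
  hence "\<bar>h u - h 0\<bar> \<le> L * \<bar>u - 0\<bar>" "L * u \<le> L * 1" using L_nonneg by (intro h_lipschitz mult_left_mono; auto)+
  with \<open>u \<in> {0..<1}\<close> show "norm (complex_of_real (h u) * e k u) \<le> \<bar>h 0\<bar> + L" by (auto simp: norm_mult)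
qed measurable

private lemma e_integrable: "integrable lborel (\<lambda>u. I u *\<^sub>R (e k u))"
  by (rule I_integrable[of _ 1]) auto

private lemma integral_e: "(LINT u|lborel. I u *\<^sub>R (e k u)) = (if k = 0 then 1 else 0)"
proof (cases "k = 0")
  case False
  define F where "F u = e k u / (- 2 * pi * \<i> * of_int k)" for u
  have "(LINT u|lborel. I u *\<^sub>R (e k u)) = (LINT u|lborel. indicator {0..1} u *\<^sub>R (e k u))"
    using AE_lborel_singleton[of 1]
    by (intro integral_cong_AE) (auto simp: I_def indicator_def elim!: eventually_mono)
  also have "\<dots> = F 1 - F 0"
  proof (rule integral_FTC_Icc)
    fix u :: real
    have "((\<lambda>u. exp (- 2 * pi * \<i> * of_int k * u) / (- 2 * pi * \<i> * of_int k)) has_field_derivative exp (- 2 * pi * \<i> * of_int k * of_real u)) (at (of_real u))"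
      using False by (auto intro!: derivative_eq_intros simp: field_simps)
    thus "(F has_vector_derivative e k u) (at u within {0..1})"
      unfolding F_def e_def by (rule has_vector_derivative_real_field[THEN has_vector_derivative_at_within])
    show "continuous_on {0..1} (e k)" unfolding e_def by (intro continuous_intros)
  qed simp
  also have "F 1 - F 0 = 0" using exp_2pi_int[of k] by (simp add: F_def e_def)
  finally show ?thesis using False by simp
qed (simp add: e_def I_def)

text \<open>Since e (k - 1) - e k = (e (- 1) - 1) * e k, taking differences of the coefficients of
  \<open>q\<close> restores its numerator; the constant \<open>h 0\<close> is seen only by the
  coefficient k = 0.\<close>

private lemma b_diff: "b (k - 1) - b k = c k - (if k = 0 then of_real (h 0) else 0)"
proof -
  have "b (k - 1) - b k = (LINT u|lborel. I u *\<^sub>R (q u * e (k - 1) u) - I u *\<^sub>R (q u * e k u))"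
    unfolding b_def by (intro Bochner_Integration.integral_diff[symmetric] qe_integrable)
  also have "(\<lambda>u. I u *\<^sub>R (q u * e (k - 1) u) - I u *\<^sub>R (q u * e k u)) =
     (\<lambda>u. I u *\<^sub>R (of_real (h u) * e k u) - of_real (h 0) * (I u *\<^sub>R e k u))"
  proof
    fix u :: real
    show "I u *\<^sub>R (q u * e (k - 1) u) - I u *\<^sub>R (q u * e k u) = I u *\<^sub>R (of_real (h u) * e k u) - of_real (h 0) * (I u *\<^sub>R e k u)"
    proof (cases "u \<in> {0..<1}")
      case True
      have "e (k - 1) u = e (- 1) u * e k u" by (simp add: e_def exp_add[symmetric] algebra_simps)
      hence "q u * e (k - 1) u - q u * e k u = q u * (e (- 1) u - 1) * e k u" by (simp add: algebra_simps)
      also have "q u * (e (- 1) u - 1) = of_real (h u) - of_real (h 0)"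
        using e_eq_1_iff[OF True, of "- 1"] by (cases "u = 0") (auto simp: q_def)
      finally show ?thesis using True by (simp add: I_def algebra_simps)
    qed (simp add: I_def)
  qed
  also have "(LINT u|lborel. I u *\<^sub>R (of_real (h u) * e k u) - of_real (h 0) * (I u *\<^sub>R e k u)) = c k - of_real (h 0) * (LINT u|lborel. I u *\<^sub>R e k u)"
    unfolding c_def using he_integrable e_integrable by (subst Bochner_Integration.integral_diff) (auto simp del: mult_scaleR_right)
  finally show ?thesis unfolding integral_e by simp
qed

private lemma c_eq: "c k = of_real (exp (- pi * k^2 / x) / sqrt x)" unfolding c_def by (rule coefficient)

text \<open>Summing \<open>b_diff\<close> over |k| \<le> N telescopes to the two end terms, and the
  Gaussian coefficients are even.\<close>

private lemma b_sym_diff: "b (- int N - 1) - b (int N) = c 0 - of_real (h 0) + (\<Sum>n<N. 2 * c (int (Suc n)))"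
proof (induction N)
  case 0
  show ?case using b_diff[of 0] by simp
next
  case (Suc N)
  have "b (- int (Suc N) - 1) - b (int (Suc N)) = (b (- int N - 1) - b (int N)) + (b (- int N - 1 - 1) - b (- int N - 1)) + (b (int (Suc N) - 1) - b (int (Suc N)))"
    by simp
  also have "b (- int N - 1 - 1) - b (- int N - 1) = c (int (Suc N))" using b_diff[of "- int N - 1"]
    by (auto simp: c_eq power2_eq_square algebra_simps)
  also have "b (int (Suc N) - 1) - b (int (Suc N)) = c (int (Suc N))" using b_diff[of "int (Suc N)"] by (auto)
  finally show ?case unfolding Suc.IH by simp
qed

private lemma kernel_bound:
  assumes w: "norm w = 1" "w \<noteq> (1 :: complex)"
  shows "norm (\<Sum>k<N. w ^ k) \<le> 2 / norm (1 - w)"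
proof -
  have "(\<Sum>k<N. w ^ k) = (1 - w ^ N) / (1 - w)" using w(2) sum_gp_strict[of w N] by simp
  moreover have "norm (1 - w ^ N) \<le> 2" using norm_triangle_ineq4[of 1 "w ^ N"] w by (simp add: norm_power)
  ultimately show ?thesis by (simp add: norm_divide divide_right_mono)
qed

text \<open>The averaged kernel \<open>K N\<close> is bounded by 2, and for 0 < u < 1 its geometric
  sums stay bounded in N, so division by N sends it to 0 pointwise. Boundedness of \<open>q\<close>
  supplies the dominating function.\<close>

private lemma cesaro_b: "(\<lambda>N. (\<Sum>k<N. b (- int k - 1) - b (int k)) / of_nat N) \<longlonglongrightarrow> 0"
proof -
  obtain B where B: "B \<ge> 0" "\<And>u. u \<in> {0..<1} \<Longrightarrow> norm (q u) \<le> B" using q_bounded by metis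
  define K where "K N u = (\<Sum>k<N. e (- int k - 1) u - e (int k) u) / of_nat N" for N :: nat and u
  have K_meas [measurable]: "K N \<in> borel_measurable borel" for N unfolding K_def by measurable
  have K_bound: "norm (K N u) \<le> 2" for N u
  proof (cases "N = 0")
    case False
    have "norm (\<Sum>k<N. e (- int k - 1) u - e (int k) u) \<le> (\<Sum>k<N. 2)"
      by (intro sum_norm_le order_trans[OF norm_triangle_ineq4]) simp
    thus ?thesis using False by (simp add: K_def norm_divide divide_le_eq)
  qed (simp add: K_def)
  have eq: "(\<Sum>k<N. b (- int k - 1) - b (int k)) / of_nat N = (LINT u|lborel. I u *\<^sub>R (q u * K N u))" for N
  proof -
    have "(\<Sum>k<N. b (- int k - 1) - b (int k)) = (\<Sum>k<N. LINT u|lborel. I u *\<^sub>R (q u * e (- int k - 1) u) - I u *\<^sub>R (q u * e (int k) u))"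
      unfolding b_def by (intro sum.cong refl Bochner_Integration.integral_diff[symmetric] qe_integrable)
    also have "\<dots> = (LINT u|lborel. (\<Sum>k<N. I u *\<^sub>R (q u * e (- int k - 1) u) - I u *\<^sub>R (q u * e (int k) u)))"
      by (intro Bochner_Integration.integral_sum[symmetric] Bochner_Integration.integrable_diff qe_integrable)
    also have "\<dots> / of_nat N = (LINT u|lborel. (\<Sum>k<N. I u *\<^sub>R (q u * e (- int k - 1) u) - I u *\<^sub>R (q u * e (int k) u)) / of_nat N)"
      by simp
    also have "(\<lambda>u. (\<Sum>k<N. I u *\<^sub>R (q u * e (- int k - 1) u) - I u *\<^sub>R (q u * e (int k) u)) / of_nat N) = (\<lambda>u. I u *\<^sub>R (q u * K N u))"
      by (simp add: fun_eq_iff K_def sum_distrib_left scaleR_conv_of_real right_diff_distrib[symmetric] sum_divide_distrib)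
    finally show ?thesis .
  qed
  define F where "F N u = I u *\<^sub>R (q u * K N u)" for N u
  define W where "W u = I u * (B * 2)" for u
  have F_meas [measurable]: "F N \<in> borel_measurable borel" for N unfolding F_def I_def by measurable
  have "(\<lambda>N. integral\<^sup>L lborel (F N)) \<longlonglongrightarrow> integral\<^sup>L lborel (\<lambda>_::real. 0 :: complex)"
  proof (rule Bochner_Integration.integral_dominated_convergence[where w = W])
    show "integrable lborel W" unfolding W_def I_def by (intro integrable_mult_left integrable_real_indicator) auto
    show "AE u in lborel. norm (F N u) \<le> W u" for N
      unfolding F_def W_def
      using B K_bound[of N] by (intro AE_I2) (auto simp: I_def indicator_def norm_mult intro!: mult_mono)
    show "AE u in lborel. (\<lambda>N. F N u) \<longlonglongrightarrow> 0" unfolding F_def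
    proof (rule AE_I2)
      fix u :: real
      show "(\<lambda>N. I u *\<^sub>R (q u * K N u)) \<longlonglongrightarrow> 0"
      proof (cases "u \<in> {0<..<1}")
        case True
        have ne: "e 1 u \<noteq> 1" "e (- 1) u \<noteq> 1" using True e_eq_1_iff[of u 1] e_eq_1_iff[of u "- 1"] by auto
        have pw: "e (int k) u = e 1 u ^ k" "e (- int k - 1) u = e (- 1) u * e (- 1) u ^ k" for k
          by (simp_all add: e_def exp_of_nat_mult[symmetric] exp_add[symmetric] algebra_simps)
        define M where "M = 2 / norm (1 - e (- 1) u) + 2 / norm (1 - e 1 u)"
        have "norm (K N u) \<le> M / real N" for N
        proof -
          have "(\<Sum>k<N. e (- int k - 1) u - e (int k) u) = e (- 1) u * (\<Sum>k<N. e (- 1) u ^ k) - (\<Sum>k<N. e 1 u ^ k)"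
            unfolding pw sum_subtractf sum_distrib_left ..
          also have "norm \<dots> \<le> norm (\<Sum>k<N. e (- 1) u ^ k) + norm (\<Sum>k<N. e 1 u ^ k)"
            by (rule order_trans[OF norm_triangle_ineq4]) (simp add: norm_mult)
          also have "\<dots> \<le> M" unfolding M_def by (intro add_mono kernel_bound ne) auto
          finally show ?thesis by (simp add: K_def norm_divide divide_right_mono)
        qed
        moreover have "(\<lambda>N. M / real N) \<longlonglongrightarrow> 0" by real_asymp
        ultimately have "(\<lambda>N. K N u) \<longlonglongrightarrow> 0" by (intro Lim_null_comparison[of "\<lambda>N. K N u"] always_eventually allI)
        from tendsto_mult_right_zero[OF this, of "of_real (I u) * q u"] show ?thesis by (simp add: scaleR_conv_of_real mult_ac)
      next
        case False
        hence "I u = 0 \<or> q u = 0" by (auto simp: I_def q_def indicator_def)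
        thus ?thesis by auto
      qed
    qed
  qed measurable
  thus ?thesis unfolding eq F_def by simp
qed

text \<open>The Gaussian coefficients are summable, so the telescoped end terms have a limit; it
  equals the limit of their averages, which is 0 by \<open>cesaro_b\<close>.\<close>

private lemma poisson: "h 0 = 1 / sqrt x + (\<Sum>n. 2 * (exp (- pi * (real n + 1)^2 / x) / sqrt x))"
proof -
  let ?c = "\<lambda>n. exp (- pi * (real n + 1)^2 / x) / sqrt x"
  have c: "c (int (Suc n)) = of_real (?c n)" for n by (simp add: c_eq add_ac)
  have "summable ?c"
  proof (rule summable_comparison_test'[of "\<lambda>n. 1 / sqrt x * exp (- pi / x) ^ n" 0])
    fix n :: nat
    have "real n \<le> (real n + 1)^2" by (simp add: power2_eq_square algebra_simps)
    hence "pi * real n / x \<le> pi * (real n + 1)^2 / x" using x by (intro divide_right_mono mult_left_mono) auto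
    hence "exp (- pi * (real n + 1)^2 / x) \<le> exp (- pi / x) ^ n" by (simp add: exp_of_nat_mult[symmetric] mult_ac)
    thus "norm (?c n) \<le> 1 / sqrt x * exp (- pi / x) ^ n" using x by (simp add: divide_right_mono)
  qed (use x in \<open>auto intro!: summable_mult summable_geometric\<close>)
  hence "(\<lambda>n. 2 * ?c n) sums (\<Sum>n. 2 * ?c n)" by (intro summable_sums summable_mult)
  hence "(\<lambda>n. complex_of_real (2 * ?c n)) sums of_real (\<Sum>n. 2 * ?c n)" by (simp only: sums_of_real_iff)
  hence "(\<lambda>N. \<Sum>n<N. 2 * c (int (Suc n))) \<longlonglongrightarrow> of_real (\<Sum>n. 2 * ?c n)" by (simp only: sums_def c of_real_mult of_real_numeral)
  hence "(\<lambda>N. b (- int N - 1) - b (int N)) \<longlonglongrightarrow> c 0 - of_real (h 0) + of_real (\<Sum>n. 2 * ?c n)"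
    unfolding b_sym_diff by (intro tendsto_intros)
  from LIMSEQ_unique[OF cesaro_mean_tendsto[OF this] cesaro_b]
  have "complex_of_real (1 / sqrt x - h 0 + (\<Sum>n. 2 * ?c n)) = of_real 0" by (simp add: c_eq)
  hence "1 / sqrt x - h 0 + (\<Sum>n. 2 * ?c n) = 0" by (simp only: of_real_eq_iff)
  thus ?thesis by simp
qed

private lemma h_0: "h 0 = 1 + (\<Sum>n. 2 * exp (- pi * (real n + 1)^2 * x))"
proof -
  let ?s = "\<lambda>n. g (real n + 1)"
  have s0: "summable (\<lambda>n. g (real n))"
  proof (rule summable_comparison_test'[OF summable_r])
    fix n show "norm (g (real n)) \<le> 2 * r ^ n"
      using g_bound[of n "real n"] g_nonneg[of "real n"] zero_le_power[of r n] r by simp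
  qed
  have s1: "summable ?s" using summable_Suc_iff[THEN iffD2, OF s0] by (simp add: add_ac)
  have "h 0 = (\<Sum>n. g (real n) + ?s n)" by (simp add: h_def t_def)
  also have "\<dots> = (\<Sum>n. g (real n)) + suminf ?s" by (intro suminf_add[symmetric] s0 s1)
  also have "(\<Sum>n. g (real n)) = g 0 + suminf ?s" using suminf_split_head[OF s0] by (simp add: add_ac)
  also have "g 0 = 1" by (simp add: g_def)
  finally have "h 0 = 1 + 2 * suminf ?s" by simp
  also have "2 * suminf ?s = (\<Sum>n. 2 * ?s n)" by (rule suminf_mult[OF s1, symmetric])
  finally show ?thesis by (simp add: g_def mult_ac)
qed

lemma theta_inversion:
  "1 + (\<Sum>n. 2 * exp (- pi * (real n + 1)^2 * x)) = 1 / sqrt x + (\<Sum>n. 2 * (exp (- pi * (real n + 1)^2 / x) / sqrt x))"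
  using poisson h_0 by simp

end

section \<open>The completed zeta function\<close>

lemma integral_exp_decay:
  fixes l :: real assumes l: "l > 0"
  shows "integrable lborel (\<lambda>t. indicator {0..} t * exp (- l * t))" "(LINT t|lborel. indicator {0..} t * exp (- l * t)) = 1 / l"
    "integrable lborel (\<lambda>t. indicator {0..} t * (t * exp (- l * t)))" "(LINT t|lborel. indicator {0..} t * (t * exp (- l * t))) = 1 / l^2"
proof -
  \<comment> \<open>Both integrands are multiples of Erlang densities, of shape 0 and 1, whose total
    mass is 1.\<close>
  have nn: "(\<integral>\<^sup>+x. ennreal (erlang_density k l x) \<partial>lborel) = ennreal 1" for k
    using prob_space.emeasure_space_1[OF prob_space_erlang_density[OF l, of k]] by (simp add: emeasure_density)
  have e: "integrable lborel (erlang_density k l)" "integral\<^sup>L lborel (erlang_density k l) = 1" for k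
    using l by (auto intro!: integrableI_nn_integral_finite[OF _ _ nn] integral_eq_nn_integral[THEN trans] simp: nn erlang_density_nonneg)
  have eq0: "(\<lambda>t. indicator {0..} t * exp (- l * t)) = (\<lambda>t. (1 / l) * erlang_density 0 l t)"
    using l by (auto simp: fun_eq_iff erlang_density_def indicator_def)
  show "integrable lborel (\<lambda>t. indicator {0..} t * exp (- l * t))" "(LINT t|lborel. indicator {0..} t * exp (- l * t)) = 1 / l"
    unfolding eq0 using e[of 0] by simp_all
  have eq1: "(\<lambda>t. indicator {0..} t * (t * exp (- l * t))) = (\<lambda>t. (1 / l^2) * erlang_density 1 l t)"
    using l by (auto simp: fun_eq_iff erlang_density_def indicator_def power2_eq_square)
  show "integrable lborel (\<lambda>t. indicator {0..} t * (t * exp (- l * t)))" "(LINT t|lborel. indicator {0..} t * (t * exp (- l * t))) = 1 / l^2"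
    unfolding eq1 using e[of 1] by simp_all
qed

lemma has_bochner_integral_exp_decay:
  fixes c :: complex assumes c: "Re c > 0"
  shows "has_bochner_integral lborel (\<lambda>t. indicator {0..} t *\<^sub>R exp (- c * of_real t)) (1 / c)"
proof -
  let ?f = "\<lambda>t. indicator {0..} t *\<^sub>R exp (- c * of_real t)"
  let ?w = "\<lambda>t. indicator {0..} t * exp (- Re c * t)"
  have m: "?f \<in> borel_measurable borel"
    by (intro borel_measurable_scaleR borel_measurable_indicator borel_measurable_continuous_onI continuous_intros) auto
  have bd: "norm (?f t) \<le> ?w t" for t by (auto simp: indicator_def)
  have int: "integrable lborel ?f"
    by (rule Bochner_Integration.integrable_bound[OF integral_exp_decay(1)[OF c]]) (use m bd in \<open>auto intro!: AE_I2 order_trans[OF bd]\<close>)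
  have c0: "c \<noteq> 0" using c by auto
  have "(\<lambda>n. LINT t|lborel. indicator {0..real n} t *\<^sub>R exp (- c * of_real t)) \<longlonglongrightarrow> integral\<^sup>L lborel ?f"
  proof (rule Bochner_Integration.integral_dominated_convergence[where w = ?w])
    show "AE t in lborel. (\<lambda>n. indicator {0..real n} t *\<^sub>R exp (- c * of_real t)) \<longlonglongrightarrow> ?f t"
    proof (rule AE_I2)
      fix t :: real
      have "eventually (\<lambda>n. indicator {0..real n} t = (indicator {0..} t :: real)) sequentially"
        using eventually_ge_at_top[of "nat \<lceil>t\<rceil>"] by eventually_elim (auto simp: indicator_def nat_le_iff ceiling_le_iff)
      hence "eventually (\<lambda>n. indicator {0..real n} t *\<^sub>R exp (- c * of_real t) = ?f t) sequentially"
        by eventually_elim simp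
      thus "(\<lambda>n. indicator {0..real n} t *\<^sub>R exp (- c * of_real t)) \<longlonglongrightarrow> ?f t" by (rule tendsto_eventually)
    qed
    show "(\<lambda>t. indicator {0..real n} t *\<^sub>R exp (- c * of_real t)) \<in> borel_measurable lborel" for n
      unfolding measurable_lborel2 by (intro borel_measurable_scaleR borel_measurable_indicator borel_measurable_continuous_onI continuous_intros) auto
    show "AE t in lborel. norm (indicator {0..real n} t *\<^sub>R exp (- c * of_real t)) \<le> ?w t" for n
      by (intro AE_I2) (auto simp: indicator_def)
  qed (use m integral_exp_decay(1)[OF c] in auto)
  moreover have "(LINT t|lborel. indicator {0..real n} t *\<^sub>R exp (- c * of_real t)) = - exp (- c * of_real (real n)) / c - (- exp (- c * of_real 0) / c)" for n
  proof (rule integral_FTC_Icc)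
    fix t :: real
    have "((\<lambda>t. - exp (- c * t) / c) has_field_derivative exp (- c * of_real t)) (at (of_real t))"
      using c0 by (auto intro!: derivative_eq_intros simp: field_simps)
    thus "((\<lambda>t. - exp (- c * of_real t) / c) has_vector_derivative exp (- c * of_real t)) (at t within {0..real n})"
      by (rule has_vector_derivative_real_field[THEN has_vector_derivative_at_within])
  qed (auto intro!: continuous_intros)
  moreover have "(\<lambda>n. - exp (- c * of_real (real n)) / c - (- exp (- c * of_real 0) / c)) \<longlonglongrightarrow> - 0 / c - (- exp (- c * of_real 0) / c)"
  proof (intro tendsto_intros c0)
    have "(\<lambda>n. exp (- Re c * real n)) \<longlonglongrightarrow> 0" using c by real_asymp
    moreover have "(\<lambda>n. norm (exp (- c * of_real (real n)))) = (\<lambda>n. exp (- Re c * real n))" by simp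
    ultimately show "(\<lambda>n. exp (- c * of_real (real n))) \<longlonglongrightarrow> 0" by (simp only: tendsto_norm_zero_cancel)
  qed
  ultimately have "(\<lambda>n. - exp (- c * of_real (real n)) / c - (- exp (- c * of_real 0) / c)) \<longlonglongrightarrow> integral\<^sup>L lborel ?f"
    and "(\<lambda>n. - exp (- c * of_real (real n)) / c - (- exp (- c * of_real 0) / c)) \<longlonglongrightarrow> 1 / c" by simp_all
  hence "integral\<^sup>L lborel ?f = 1 / c" by (rule LIMSEQ_unique)
  with int show ?thesis by (simp add: has_bochner_integral_iff)
qed

text \<open>
  With \<open>\<theta>(x) = (\<Sum>n\<in>\<int>. exp (- pi * n\<^sup>2 * x))\<close>, \<open>log_theta u\<close> is \<open>(\<theta> (exp u) - 1) / 2\<close>; in the variable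
  \<open>u = ln x\<close> the Mellin transform over \<open>x \<ge> 1\<close> becomes \<open>Phi\<close> below.
\<close>

definition log_theta :: "real \<Rightarrow> real" where
  "log_theta u = (\<Sum>n. exp (- pi * (real n + 1)^2 * exp u))"

lemma log_theta_term_le: "exp (- pi * (real n + 1)^2 * exp u) \<le> exp (- pi * exp u) * exp (- pi * exp u) ^ n"
proof -
  have "real n + 1 \<le> (real n + 1)^2" by (simp add: power2_eq_square algebra_simps)
  hence "pi * exp u * (real n + 1) \<le> pi * exp u * (real n + 1)^2" by (intro mult_left_mono) auto
  thus ?thesis by (simp add: exp_of_nat_mult[symmetric] exp_add[symmetric] algebra_simps)
qed

lemma summable_log_theta: "summable (\<lambda>n. exp (- pi * (real n + 1)^2 * exp u))"
  by (rule summable_comparison_test'[OF summable_mult[OF summable_geometric[of "exp (- pi * exp u)"], of "exp (- pi * exp u)"], of 0])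
     (use log_theta_term_le[of _ u] in auto)

lemma log_theta_nonneg: "log_theta u \<ge> 0"
  unfolding log_theta_def by (intro suminf_nonneg summable_log_theta) auto

lemma log_theta_measurable [measurable]: "log_theta \<in> borel_measurable borel"
  unfolding log_theta_def by measurable

lemma continuous_log_theta: "continuous_on S log_theta"
proof -
  have "isCont log_theta u" for u
  proof -
    have ul: "uniform_limit {u - 1<..} (\<lambda>N v. \<Sum>n<N. exp (- pi * (real n + 1)^2 * exp v)) (\<lambda>v. \<Sum>n. exp (- pi * (real n + 1)^2 * exp v)) sequentially"
    proof (rule Weierstrass_m_test[OF _ summable_log_theta[of "u - 1"]])
      fix n v assume "v \<in> {u - 1<..}"
      hence "pi * (real n + 1)^2 * exp (u - 1) \<le> pi * (real n + 1)^2 * exp v" by (intro mult_left_mono) auto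
      thus "norm (exp (- pi * (real n + 1)^2 * exp v)) \<le> exp (- pi * (real n + 1)^2 * exp (u - 1))" by simp
    qed
    have "continuous_on {u - 1<..} (\<lambda>v. \<Sum>n. exp (- pi * (real n + 1)^2 * exp v))"
      by (rule uniform_limit_theorem[OF _ ul]) (auto intro!: always_eventually continuous_intros)
    hence "continuous_on {u - 1<..} log_theta" by (simp add: log_theta_def[abs_def])
    thus ?thesis by (simp add: continuous_on_eq_continuous_at)
  qed
  thus ?thesis by (simp add: continuous_at_imp_continuous_on)
qed

text \<open>This is \<open>theta_inversion\<close> at x = exp (- u). Its elementary term is the
  source of the two polar terms in \<open>completed_zeta\<close>.\<close>

lemma log_theta_reflect: "log_theta (- u) = exp (u / 2) * log_theta u + (exp (u / 2) - 1) / 2"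
proof -
  have sq: "sqrt (exp (- u)) = exp (- u / 2)" by (simp add: exp_half_le2 real_sqrt_unique power2_eq_square exp_add[symmetric])
  have s2: "2 * log_theta v = (\<Sum>n. 2 * exp (- pi * (real n + 1)^2 * exp v))" for v
    unfolding log_theta_def by (rule suminf_mult[OF summable_log_theta, symmetric])
  have "(\<Sum>n. 2 * (exp (- pi * (real n + 1)^2 / exp (- u)) / sqrt (exp (- u)))) = (\<Sum>n. (2 / sqrt (exp (- u))) * exp (- pi * (real n + 1)^2 * exp u))"
    by (intro suminf_cong) (simp add: exp_minus field_simps)
  also have "\<dots> = 2 / sqrt (exp (- u)) * log_theta u" unfolding log_theta_def by (rule suminf_mult[OF summable_log_theta])
  finally have "1 + 2 * log_theta (- u) = 1 / sqrt (exp (- u)) + 2 / sqrt (exp (- u)) * log_theta u"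
    using theta_inversion[of "exp (- u)"] s2[of "- u"] by simp
  also have "1 / sqrt (exp (- u)) = exp (u / 2)" unfolding sq by (simp add: exp_minus field_simps)
  finally show ?thesis unfolding sq by (simp add: exp_minus field_simps)
qed

lemma exp_pi_ge_4: "exp (- pi) \<le> 1/4"
proof -
  have "4 \<le> 1 + pi" using pi_gt3 by simp
  also have "\<dots> \<le> exp pi" by (rule exp_ge_add_one_self)
  finally show ?thesis by (simp add: exp_minus field_simps)
qed

text \<open>Geometric majorant with ratio r \<le> exp (- pi) \<le> 1/4, hence the factor 1 / (1 -
  1/4).\<close>

lemma log_theta_le: assumes "u \<ge> 0" shows "log_theta u \<le> 4/3 * exp (- pi * exp u)"
proof -
  define r where "r = exp (- pi * exp u)"
  have "pi * 1 \<le> pi * exp u" using assms by (intro mult_left_mono) auto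
  hence "- pi * exp u \<le> - pi" by linarith
  hence "r \<le> exp (- pi)" unfolding r_def by (rule exp_le_cancel_iff[THEN iffD2])
  hence r: "r \<le> 1/4" "r > 0" using exp_pi_ge_4 by (linarith, simp add: r_def)
  have sg: "summable (\<lambda>n. r * r ^ n)" using r by (intro summable_mult summable_geometric) auto
  have "log_theta u \<le> (\<Sum>n. r * r ^ n)" unfolding log_theta_def
    by (intro suminf_le summable_log_theta sg) (use log_theta_term_le in \<open>auto simp: r_def\<close>)
  also have "\<dots> = r * (1 / (1 - r))" using r by (subst suminf_mult) (auto simp: suminf_geometric)
  also have "1 / (1 - r) \<le> 1 / (3/4)" using r by (intro divide_left_mono) auto
  finally show ?thesis using r by (simp add: r_def)
qed

text \<open>A purely exponential bound with an explicit constant, made for the numerical estimate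
  that excludes a zero at 1/2.\<close>

lemma log_theta_le': assumes "u \<ge> 0" shows "log_theta u \<le> 4/9 * exp (- u)"
proof -
  have "3 * exp u \<le> pi * exp u" using pi_gt3 by (intro mult_right_mono) auto
  also have "\<dots> \<le> exp (pi * exp u)" using exp_ge_add_one_self[of "pi * exp u"] by linarith
  finally have "exp (- pi * exp u) \<le> 1/3 * exp (- u)" by (simp add: exp_minus field_simps)
  thus ?thesis using log_theta_le[OF assms] by simp
qed

section \<open>The Mellin transform of the theta series over x \<ge> 1\<close>

lemma norm_integral_le:
  fixes f :: "'a \<Rightarrow> 'b :: {banach, second_countable_topology}"
  assumes "integrable M f" "integrable M g" "\<And>x. norm (f x) \<le> g x"
  shows "norm (integral\<^sup>L M f) \<le> integral\<^sup>L M g"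
  by (rule order_trans[OF integral_norm_bound integral_mono]) (use assms in auto)

text \<open>With v = exp u, the inequality ln y \<le> y - 1 at y = v / (a + 1) gives v^(a+1) * exp
  (- v) \<le> (a + 1)^(a+1). One power of v more than needed is spent on the integrable factor exp
  (- u). The power (a + 1)^(a+1) is what later has to fit under the exponent 3/2.\<close>

lemma log_theta_exp_bound:
  fixes s :: complex
  assumes "u \<ge> 0" "a \<ge> 0" "norm s \<le> a"
  shows "norm (log_theta u *\<^sub>R exp (of_real u * s)) \<le> 4/3 * (a + 1) powr (a + 1) * exp (- u)"
proof -
  define v where "v = exp u"
  have v: "v > 0" "ln v = u" by (auto simp: v_def)
  have "ln (v / (a + 1)) \<le> v / (a + 1) - 1" using v assms by (intro ln_le_minus_one) auto
  hence "(a + 1) * ln (v / (a + 1)) \<le> (a + 1) * (v / (a + 1) - 1)" using assms by (intro mult_left_mono) auto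
  also have "(a + 1) * (v / (a + 1) - 1) = v - (a + 1)" using assms by (simp add: field_simps)
  finally have "(a + 1) * u \<le> (a + 1) * ln (a + 1) + v" using v assms by (simp add: ln_div algebra_simps)
  hence 1: "a * u - v \<le> (a + 1) * ln (a + 1) - u" by (simp add: algebra_simps)
  have "u * Re s \<le> a * u" using assms complex_Re_le_cmod[of s] mult_left_mono[of "Re s" a u] by (simp add: mult.commute)
  hence 2: "norm (exp (of_real u * s)) \<le> exp (a * u)" by simp
  have "v \<le> pi * v" using pi_gt3 v by simp
  hence "exp (- pi * exp u) \<le> exp (- v)" by (simp add: v_def)
  hence "log_theta u \<le> 4/3 * exp (- v)" using log_theta_le[OF assms(1)] by linarith
  hence "norm (log_theta u *\<^sub>R exp (of_real u * s)) \<le> 4/3 * exp (- v) * exp (a * u)"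
    using 2 log_theta_nonneg[of u] unfolding norm_scaleR by (intro mult_mono) auto
  also have "\<dots> = 4/3 * exp (a * u - v)" by (simp add: exp_diff exp_minus field_simps)
  also have "\<dots> \<le> 4/3 * exp ((a + 1) * ln (a + 1) - u)" using 1 by simp
  also have "\<dots> = 4/3 * (a + 1) powr (a + 1) * exp (- u)" using assms by (simp add: powr_def exp_diff exp_minus field_simps)
  finally show ?thesis .
qed

definition Phi :: "complex \<Rightarrow> complex" where
  "Phi s = (LINT u|lborel. indicator {0..} u *\<^sub>R (log_theta u *\<^sub>R exp (of_real u * s)))"

lemma exp_measurable: "(\<lambda>u. exp (of_real u * s :: complex)) \<in> borel_measurable borel"
  by (intro borel_measurable_continuous_onI continuous_intros)

lemma Phi_integrable:
  fixes s :: complex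
  assumes that: "A \<in> sets borel" "A \<subseteq> {0..}"
  shows "integrable lborel (\<lambda>u. indicator A u *\<^sub>R (log_theta u *\<^sub>R exp (of_real u * s)))" (is "integrable _ ?f")
proof (rule Bochner_Integration.integrable_bound)
  let ?w = "\<lambda>u. 4/3 * (norm s + 1) powr (norm s + 1) * (indicator {0..} u * exp (- 1 * u))"
  show "integrable lborel ?w" by (intro Bochner_Integration.integrable_mult_right integral_exp_decay) auto
  show "AE u in lborel. norm (?f u) \<le> norm (?w u)"
    using log_theta_exp_bound[of _ "norm s" s] that(2) by (intro AE_I2) (auto simp: indicator_def abs_mult)
  show "?f \<in> borel_measurable lborel" using that exp_measurable[of s] by (simp)
qed

lemma Phi_bound:
  assumes "norm s \<le> a" shows "norm (Phi s) \<le> 4/3 * (a + 1) powr (a + 1)"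
proof -
  have a: "a \<ge> 0" using assms norm_ge_zero order_trans by blast
  let ?w = "\<lambda>u. 4/3 * (a + 1) powr (a + 1) * (indicator {0..} u * exp (- 1 * u))"
  have "norm (Phi s) \<le> (LINT u|lborel. ?w u)" unfolding Phi_def
  proof (rule norm_integral_le)
    show "norm (indicator {0..} u *\<^sub>R (log_theta u *\<^sub>R exp (of_real u * s))) \<le> ?w u" for u
      using log_theta_exp_bound[of u a s] assms a by (auto simp: indicator_def)
    show "integrable lborel ?w" by (intro Bochner_Integration.integrable_mult_right integral_exp_decay) auto
  qed (rule Phi_integrable; simp)
  also have "\<dots> = 4/3 * (a + 1) powr (a + 1)" using integral_exp_decay(2)[of 1] by simp
  finally show ?thesis .
qed

text \<open>Truncations to [0, n] are holomorphic by differentiation under the integral, and the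
  tails are O(exp (- n / 2)) uniformly on discs.\<close>

lemma Phi_holomorphic: "Phi holomorphic_on UNIV"
proof (rule holomorphic_uniform_sequence[OF open_UNIV])
  define P where "P n s = integral (cbox 0 (real n)) (\<lambda>u. log_theta u *\<^sub>R exp (of_real u * s))" for n :: nat and s :: complex
  show "P n holomorphic_on UNIV" for n unfolding P_def
  proof (rule leibniz_rule_holomorphic[where fx = "\<lambda>s u. log_theta u *\<^sub>R (of_real u * exp (of_real u * s))"])
    show "((\<lambda>s. log_theta u *\<^sub>R exp (of_real u * s)) has_field_derivative log_theta u *\<^sub>R (of_real u * exp (of_real u * s))) (at s within UNIV)" for s :: complex and u
      by (auto intro!: derivative_eq_intros simp: scaleR_conv_of_real)
    show "(\<lambda>u. log_theta u *\<^sub>R exp (of_real u * s)) integrable_on cbox 0 (real n)" for s :: complex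
      by (intro integrable_continuous continuous_intros continuous_log_theta continuous_on_of_real)
    show "continuous_on (UNIV \<times> cbox 0 (real n)) (\<lambda>(s, u). log_theta u *\<^sub>R (of_real u * exp (of_real u * s :: complex)))"
      unfolding case_prod_beta by (intro continuous_intros continuous_on_compose2[OF continuous_log_theta[of UNIV]]) auto
  qed auto
  have P_eq: "P n s = (LINT u|lborel. indicator {0..real n} u *\<^sub>R (log_theta u *\<^sub>R exp (of_real u * s)))" for n s
    using set_borel_integral_eq_integral(2)[of "{0..real n}" "\<lambda>u. log_theta u *\<^sub>R exp (of_real u * s)"] Phi_integrable[of "{0..real n}" s]
    by (simp add: P_def set_integrable_def set_lebesgue_integral_def)
  fix s0 :: complex
  define a where "a = norm s0 + 1"
  define K where "K = 4/3 * (a + 1) powr (a + 1)"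
  have bound: "norm (Phi s - P n s) \<le> K * exp (- (1/2) * real n) * 2" if "norm s \<le> a" for s n
  proof -
    have a: "a \<ge> 0" by (simp add: a_def)
    let ?f = "\<lambda>u. indicator {real n<..} u *\<^sub>R (log_theta u *\<^sub>R exp (of_real u * s))"
    let ?w = "\<lambda>u. K * exp (- (1/2) * real n) * (indicator {0..} u * exp (- (1/2) * u))"
    have "Phi s - P n s = (LINT u|lborel. indicator {0..} u *\<^sub>R (log_theta u *\<^sub>R exp (of_real u * s)) - indicator {0..real n} u *\<^sub>R (log_theta u *\<^sub>R exp (of_real u * s)))"
      unfolding Phi_def P_eq by (rule Bochner_Integration.integral_diff[symmetric]) (rule Phi_integrable; auto)+
    also have "\<dots> = (LINT u|lborel. ?f u)" by (intro Bochner_Integration.integral_cong) (auto simp: indicator_def)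
    also have "norm \<dots> \<le> (LINT u|lborel. ?w u)"
    proof (rule norm_integral_le)
      show "norm (?f u) \<le> ?w u" for u
      proof (cases "u > real n")
        case True
        have "norm (log_theta u *\<^sub>R exp (of_real u * s)) \<le> K * exp (- u)"
          unfolding K_def using log_theta_exp_bound[of u a s] True that a by simp
        \<comment> \<open>One half of the decay gives the rate in n, the other keeps the tail
          integrable.\<close>
        also have "exp (- u) = exp (- (1/2) * u) * exp (- (1/2) * u)" by (simp add: exp_add[symmetric])
        also have "K * (exp (- (1/2) * u) * exp (- (1/2) * u)) \<le> K * (exp (- (1/2) * real n) * exp (- (1/2) * u))"
          using True a by (intro mult_left_mono mult_right_mono) (auto simp: K_def)
        finally show ?thesis using True by (simp add: mult_ac)
      qed (use a in \<open>auto simp: K_def indicator_def\<close>)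
      show "integrable lborel ?f" by (rule Phi_integrable) auto
      show "integrable lborel ?w" by (intro Bochner_Integration.integrable_mult_right integral_exp_decay) auto
    qed
    also have "\<dots> = K * exp (- (1/2) * real n) * 2" using integral_exp_decay(2)[of "1/2"] by simp
    finally show ?thesis .
  qed
  have lim: "(\<lambda>n. K * exp (- (1/2) * real n) * 2) \<longlonglongrightarrow> 0" by real_asymp
  have "uniform_limit (cball s0 1) P Phi sequentially"
  proof (rule uniform_limitI)
    fix e :: real assume "e > 0"
    from order_tendstoD(2)[OF lim this] show "eventually (\<lambda>n. \<forall>s\<in>cball s0 1. dist (P n s) (Phi s) < e) sequentially"
    proof eventually_elim
      case (elim n)
      show ?case
      proof
        fix s assume "s \<in> cball s0 1"
        hence "norm s \<le> a" using norm_triangle_ineq[of s0 "s - s0"] by (simp add: a_def dist_norm norm_minus_commute)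
        from bound[OF this, of n] elim show "dist (P n s) (Phi s) < e" by (simp add: dist_norm norm_minus_commute)
      qed
    qed
  qed
  thus "\<exists>d>0. cball s0 d \<subseteq> UNIV \<and> uniform_limit (cball s0 d) P Phi sequentially" by (intro exI[of _ 1]) auto
qed

text \<open>
  \<open>xi s\<close> is \<open>s (s - 1) pi powr (-s/2) \<Gamma>(s/2) \<zeta>(s)\<close>, twice Riemann's \<open>\<xi>\<close>, and \<open>zeta_entire s\<close>
  is \<open>(s - 1) \<zeta>(s)\<close>.
\<close>

definition xi :: "complex \<Rightarrow> complex" where
  "xi s = 1 + s * (s - 1) * (Phi (s / 2) + Phi ((1 - s) / 2))"

definition zeta_entire :: "complex \<Rightarrow> complex" where
  "zeta_entire s = of_real pi powr (s / 2) * rGamma (s / 2 + 1) * xi s / 2"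

lemma xi_reflect: "xi (1 - s) = xi s" by (simp add: xi_def algebra_simps)

lemma xi_holomorphic: "xi holomorphic_on A"
proof -
  have "xi holomorphic_on UNIV" unfolding xi_def
    by (intro holomorphic_intros holomorphic_on_compose_gen[OF _ Phi_holomorphic, unfolded o_def]) auto
  thus ?thesis by (rule holomorphic_on_subset) simp
qed

lemma zeta_entire_holomorphic: "zeta_entire holomorphic_on A"
  unfolding zeta_entire_def by (intro holomorphic_intros xi_holomorphic) auto

lemma zeta_entire_1: "zeta_entire 1 = 1"
proof -
  have "complex_of_real pi powr (1/2) = of_real (sqrt pi)" by (simp add: csqrt_conv_powr[symmetric] csqrt_of_real_nonneg)
  moreover have "rGamma (1/2 + 1) = 2 / complex_of_real (sqrt pi)"
  proof -
    have "rGamma (3/2) = 2 * rGamma (1/2 :: complex)" using rGamma_plus1[of "1/2 :: complex"] by simp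
    also have "rGamma (1/2 :: complex) = 1 / of_real (sqrt pi)" by (simp add: rGamma_inverse_Gamma Gamma_one_half_complex field_simps)
    finally show ?thesis by simp
  qed
  ultimately show ?thesis by (simp add: zeta_entire_def xi_def)
qed

section \<open>Comparison with the Dirichlet series for Re s > 1\<close>

lemma gamma_term:
  fixes s :: complex and n :: nat
  assumes s: "Re s > 0"
  shows "has_bochner_integral lborel (\<lambda>u. of_real (exp (- pi * (real n + 1)^2 * exp u)) * exp (of_real u * (s / 2)))
     (of_real pi powr (- (s / 2)) * Gamma (s / 2) * (1 / of_nat (Suc n) powr s))"
proof -
  \<comment> \<open>Shifting u by \<open>t\<close> multiplies exp u by pi * (n + 1)^2.\<close>
  define t where "t = ln (pi * (real n + 1)^2)"
  have et: "exp t = pi * (real n + 1)^2" unfolding t_def by (subst exp_ln) (auto intro!: mult_pos_pos)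
  have Gm: "has_bochner_integral lborel (\<lambda>u. exp (- of_real (exp u)) * exp (of_real u * (s / 2))) (Gamma (s / 2))" (is "has_bochner_integral _ ?g _")
    by (rule Gamma_integral_exp_substitution) (use s in auto)
  have eq: "?g (t + 1 * u) = exp (of_real t * (s / 2)) * (of_real (exp (- pi * (real n + 1)^2 * exp u)) * exp (of_real u * (s / 2)))" for u
  proof -
    have "exp (- of_real (exp (t + 1 * u))) = complex_of_real (exp (- pi * (real n + 1)^2 * exp u))"
      by (simp add: exp_add et exp_of_real[symmetric])
    moreover have "complex_of_real (t + 1 * u) * (s / 2) = of_real t * (s / 2) + of_real u * (s / 2)" by (simp add: field_simps)
    hence "exp (complex_of_real (t + 1 * u) * (s / 2)) = exp (of_real t * (s / 2)) * exp (of_real u * (s / 2))"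
      by (simp only: exp_add)
    ultimately show ?thesis by (simp only: mult_ac)
  qed
  have "integrable lborel (\<lambda>u. ?g (t + 1 * u))" using Gm by (intro lborel_integrable_real_affine) (auto simp: has_bochner_integral_iff)
  moreover have "Gamma (s / 2) = \<bar>1\<bar> *\<^sub>R (LINT u|lborel. ?g (t + 1 * u))"
    using lborel_integral_real_affine[of 1 ?g t] Gm by (simp add: has_bochner_integral_iff)
  ultimately have "has_bochner_integral lborel (\<lambda>u. ?g (t + 1 * u)) (Gamma (s / 2))" by (simp add: has_bochner_integral_iff)
  hence "has_bochner_integral lborel (\<lambda>u. exp (- of_real t * (s / 2)) * ?g (t + 1 * u)) (exp (- of_real t * (s / 2)) * Gamma (s / 2))"
    by (intro has_bochner_integral_mult_right)
  also have "(\<lambda>u. exp (- of_real t * (s / 2)) * ?g (t + 1 * u)) = (\<lambda>u. of_real (exp (- pi * (real n + 1)^2 * exp u)) * exp (of_real u * (s / 2)))"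
    unfolding eq by (simp add: mult.assoc[symmetric] exp_add[symmetric])
  also have "exp (- of_real t * (s / 2)) = of_real pi powr (- (s / 2)) * (1 / of_nat (Suc n) powr s)"
  proof -
    have "t = ln pi + 2 * ln (real (Suc n))" unfolding t_def by (simp add: ln_mult ln_realpow add_ac)
    hence "- of_real t * (s / 2) = (- (s/2)) * of_real (ln pi) + (- s) * of_real (ln (real (Suc n)))" by (simp add: algebra_simps)
    hence "exp (- of_real t * (s / 2)) = exp ((- (s/2)) * of_real (ln pi)) * exp ((- s) * of_real (ln (real (Suc n))))"
      by (simp only: exp_add)
    also have "exp ((- (s/2)) * of_real (ln pi)) = of_real pi powr (- (s / 2))" by (simp add: powr_def Ln_of_real)
    also have "exp ((- s) * of_real (ln (real (Suc n)))) = 1 / of_nat (Suc n) powr s"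
      by (simp add: powr_def Ln_of_nat exp_minus inverse_eq_divide del: of_nat_Suc)
    finally show ?thesis .
  qed
  finally show ?thesis by (simp add: mult_ac)
qed

lemma summable_dirichlet:
  assumes "Re s > 1" shows "summable (\<lambda>n. norm (1 / complex_of_nat (Suc n) powr s))"
proof -
  have "summable (\<lambda>n. of_nat n powr (- Re s) :: real)" using assms by (simp add: summable_real_powr_iff)
  hence "summable (\<lambda>n. of_nat (Suc n) powr (- Re s) :: real)" by (subst summable_Suc_iff)
  also have "(\<lambda>n. of_nat (Suc n) powr (- Re s) :: real) = (\<lambda>n. norm (1 / complex_of_nat (Suc n) powr s))"
  proof
    fix n
    have "norm (complex_of_nat (Suc n) powr s) = of_nat (Suc n) powr Re s"
      using norm_powr_real_powr[of "complex_of_nat (Suc n)" s] by (simp del: of_nat_Suc)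
    thus "of_nat (Suc n) powr (- Re s) = norm (1 / complex_of_nat (Suc n) powr s)"
      by (simp add: norm_divide powr_minus inverse_eq_divide del: of_nat_Suc)
  qed
  finally show ?thesis .
qed

lemma mellin_theta:
  fixes s :: complex
  assumes s: "Re s > 1"
  shows "has_bochner_integral lborel (\<lambda>u. log_theta u *\<^sub>R exp (of_real u * (s / 2)))
     (of_real pi powr (- (s / 2)) * Gamma (s / 2) * (\<Sum>n. 1 / of_nat (Suc n) powr s))"
proof -
  let ?c = "\<lambda>s. complex_of_real pi powr (- (s / 2)) * Gamma (s / 2)"
  let ?f = "\<lambda>n u. complex_of_real (exp (- pi * (real n + 1)^2 * exp u)) * exp (of_real u * (s / 2))"
  have hb: "has_bochner_integral lborel (?f n) (?c s * (1 / of_nat (Suc n) powr s))" for n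
    by (rule gamma_term) (use s in auto)
  have int: "integrable lborel (?f n)" for n using hb[of n] by (simp add: has_bochner_integral_iff)
  \<comment> \<open>The modulus of the integrand is the same integrand with s replaced by its real
    part, so \<open>gamma_term\<close> itself evaluates the absolute integrals and the Dirichlet
    series at Re s sums them.\<close>
  have nint: "(LINT u|lborel. norm (?f n u)) = norm (?c (of_real (Re s)) * (1 / of_nat (Suc n) powr of_real (Re s)))" for n
  proof -
    have "complex_of_real (LINT u|lborel. norm (?f n u)) = (LINT u|lborel. of_real (norm (?f n u)))" by simp
    also have "(\<lambda>u. complex_of_real (norm (?f n u))) = (\<lambda>u. of_real (exp (- pi * (real n + 1)^2 * exp u)) * exp (of_real u * (of_real (Re s) / 2)))"
      by (simp add: fun_eq_iff norm_mult exp_of_real[symmetric])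
    also have "integral\<^sup>L lborel \<dots> = ?c (of_real (Re s)) * (1 / of_nat (Suc n) powr of_real (Re s))"
      using gamma_term[of "of_real (Re s)" n] s by (simp add: has_bochner_integral_iff)
    finally have "norm (complex_of_real (LINT u|lborel. norm (?f n u))) = norm (?c (of_real (Re s)) * (1 / of_nat (Suc n) powr of_real (Re s)))" by simp
    thus ?thesis by simp
  qed
  have sm: "summable (\<lambda>n. LINT u|lborel. norm (?f n u))"
    unfolding nint norm_mult[of "?c _"] by (intro summable_mult summable_dirichlet) (use s in auto)
  have lt: "(\<lambda>n. norm (?f n u)) = (\<lambda>n. exp (- pi * (real n + 1)^2 * exp u) * norm (exp (of_real u * (s / 2))))" for u
    by (simp add: norm_mult)
  have sm2: "AE u in lborel. summable (\<lambda>n. norm (?f n u))"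
    unfolding lt by (intro AE_I2 summable_mult2 summable_log_theta)
  have sf: "(\<Sum>n. ?f n u) = log_theta u *\<^sub>R exp (of_real u * (s / 2))" for u
  proof -
    have "(\<lambda>n. complex_of_real (exp (- pi * (real n + 1)^2 * exp u))) sums of_real (log_theta u)"
      unfolding log_theta_def by (subst sums_of_real_iff) (rule summable_sums[OF summable_log_theta])
    from sums_mult2[OF this, of "exp (of_real u * (s / 2))"] show ?thesis by (simp add: sums_iff scaleR_conv_of_real)
  qed
  have "(\<lambda>n. integral\<^sup>L lborel (?f n)) sums (LINT u|lborel. (\<Sum>n. ?f n u))" "integrable lborel (\<lambda>u. \<Sum>n. ?f n u)"
    using sums_integral[OF int sm2 sm] integrable_suminf[OF int sm2 sm] by auto
  hence "(\<lambda>n. ?c s * (1 / of_nat (Suc n) powr s)) sums (LINT u|lborel. log_theta u *\<^sub>R exp (of_real u * (s / 2)))"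
    and I: "integrable lborel (\<lambda>u. log_theta u *\<^sub>R exp (of_real u * (s / 2)))"
    using hb unfolding sf by (simp_all add: has_bochner_integral_iff)
  moreover have "(\<lambda>n. ?c s * (1 / of_nat (Suc n) powr s)) sums (?c s * (\<Sum>n. 1 / of_nat (Suc n) powr s))"
    by (rule sums_mult[OF summable_sums[OF summable_norm_cancel[OF summable_dirichlet[OF s]]]])
  ultimately have "(LINT u|lborel. log_theta u *\<^sub>R exp (of_real u * (s / 2))) = ?c s * (\<Sum>n. 1 / of_nat (Suc n) powr s)"
    using sums_unique2 by blast
  with I show ?thesis by (simp add: has_bochner_integral_iff)
qed

text \<open>Riemann's argument: the Mellin integral is split at u = 0 and the negative half is
  folded back by \<open>log_theta_reflect\<close>. Its theta part becomes \<open>Phi\<close> at the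
  reflected point, its elementary part the two polar terms.\<close>

lemma completed_zeta:
  fixes s :: complex
  assumes s: "Re s > 1"
  shows "of_real pi powr (- (s / 2)) * Gamma (s / 2) * (\<Sum>n. 1 / of_nat (Suc n) powr s) = Phi (s / 2) + Phi ((1 - s) / 2) + 1 / (s - 1) - 1 / s"
proof -
  let ?f = "\<lambda>u. log_theta u *\<^sub>R exp (of_real u * (s / 2))"
  note M = mellin_theta[OF s, unfolded has_bochner_integral_iff]
  have i1: "integrable lborel (\<lambda>u. indicator {0..} u *\<^sub>R ?f u)" and i2: "integrable lborel (\<lambda>u. indicator {..<0} u *\<^sub>R ?f u)"
    by (rule integrable_mult_indicator[OF _ conjunct1[OF M]]; simp)+
  have "of_real pi powr (- (s / 2)) * Gamma (s / 2) * (\<Sum>n. 1 / of_nat (Suc n) powr s) = (LINT u|lborel. indicator {0..} u *\<^sub>R ?f u + indicator {..<0} u *\<^sub>R ?f u)"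
  proof -
    have "(\<lambda>u. indicator {0..} u *\<^sub>R ?f u + indicator {..<0} u *\<^sub>R ?f u) = ?f" by (auto simp: fun_eq_iff indicator_def)
    thus ?thesis using M by (simp only:)
  qed
  also have "\<dots> = Phi (s / 2) + (LINT u|lborel. indicator {..<0} u *\<^sub>R ?f u)"
    unfolding Phi_def using i1 i2 by (rule Bochner_Integration.integral_add)
  also have "(LINT u|lborel. indicator {..<0} u *\<^sub>R ?f u) = (LINT u|lborel. indicator {..<0} (0 + (- 1) * u) *\<^sub>R ?f (0 + (- 1) * u))"
    using lborel_integral_real_affine[of "- 1" "\<lambda>u. indicator {..<0} u *\<^sub>R ?f u" 0] by simp
  also have "\<dots> = (LINT u|lborel. indicator {0..} u *\<^sub>R (log_theta u *\<^sub>R exp (of_real u * ((1 - s) / 2))) + (1/2) * (indicator {0..} u *\<^sub>R exp (- ((s - 1) / 2) * of_real u)) - (1/2) * (indicator {0..} u *\<^sub>R exp (- (s / 2) * of_real u)))"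
  \<comment> \<open>The point u = 0 belongs to the closed half-line on the right but not to the
    reflected open one on the left, so the integrands agree only almost everywhere.\<close>
  proof (rule integral_cong_AE)
    show "AE u in lborel. indicator {..<0} (0 + (- 1) * u) *\<^sub>R ?f (0 + (- 1) * u) = indicator {0..} u *\<^sub>R (log_theta u *\<^sub>R exp (of_real u * ((1 - s) / 2))) + (1/2) * (indicator {0..} u *\<^sub>R exp (- ((s - 1) / 2) * of_real u)) - (1/2) * (indicator {0..} u *\<^sub>R exp (- (s / 2) * of_real u))"
      using AE_lborel_singleton[of 0]
    proof eventually_elim
      fix u :: real assume "u \<noteq> 0"
      consider "u > 0" | "u < 0" using \<open>u \<noteq> 0\<close> by linarith
      thus "indicator {..<0} (0 + (- 1) * u) *\<^sub>R ?f (0 + (- 1) * u) = indicator {0..} u *\<^sub>R (log_theta u *\<^sub>R exp (of_real u * ((1 - s) / 2))) + (1/2) * (indicator {0..} u *\<^sub>R exp (- ((s - 1) / 2) * of_real u)) - (1/2) * (indicator {0..} u *\<^sub>R exp (- (s / 2) * of_real u))"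
      proof cases
        case 1
        have "exp (of_real u * ((1 - s) / 2)) = of_real (exp (u / 2)) * exp (- (s / 2) * of_real u)"
             "exp (- ((s - 1) / 2) * of_real u) = of_real (exp (u / 2)) * exp (- (s / 2) * of_real u)"
          unfolding exp_of_real[symmetric] exp_add[symmetric]
          by (rule arg_cong[of _ _ exp], simp add: field_simps)+
        moreover have "exp (of_real (0 + (- 1) * u) * (s / 2)) = exp (- (s / 2) * of_real u)"
          by (rule arg_cong[of _ _ exp]) simp
        moreover have "complex_of_real (log_theta (0 + (- 1) * u)) = of_real (exp (u / 2)) * of_real (log_theta u) + (of_real (exp (u / 2)) - 1) / 2"
          by (simp add: log_theta_reflect)
        moreover have "indicator {..<0} (0 + (- 1) * u) = (1 :: real)" "indicator {0..} u = (1 :: real)" using 1 by auto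
        ultimately show ?thesis unfolding scaleR_conv_of_real by (simp only:) (simp add: field_simps del: of_real_exp exp_of_real)
      qed auto
    qed
  qed (auto intro!: borel_measurable_scaleR borel_measurable_add borel_measurable_diff borel_measurable_times exp_measurable
       borel_measurable_continuous_onI continuous_intros continuous_log_theta continuous_on_compose2[OF continuous_log_theta[of UNIV]])
  also have "\<dots> = Phi ((1 - s) / 2) + (1/2) * (1 / ((s - 1) / 2)) - (1/2) * (1 / (s / 2))"
  proof -
    have e1: "has_bochner_integral lborel (\<lambda>u. indicator {0..} u *\<^sub>R exp (- ((s - 1) / 2) * of_real u)) (1 / ((s - 1) / 2))"
      by (rule has_bochner_integral_exp_decay) (use s in auto)
    have e2: "has_bochner_integral lborel (\<lambda>u. indicator {0..} u *\<^sub>R exp (- (s / 2) * of_real u)) (1 / (s / 2))"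
      by (rule has_bochner_integral_exp_decay) (use s in auto)
    have e3: "has_bochner_integral lborel (\<lambda>u. indicator {0..} u *\<^sub>R (log_theta u *\<^sub>R exp (of_real u * ((1 - s) / 2)))) (Phi ((1 - s) / 2))"
      unfolding Phi_def by (rule has_bochner_integral_integrable, rule Phi_integrable) auto
    from has_bochner_integral_diff[OF has_bochner_integral_add[OF e3 has_bochner_integral_mult_right[OF e1, of "1/2"]] has_bochner_integral_mult_right[OF e2, of "1/2"]]
    show ?thesis by (simp only: has_bochner_integral_iff)
  qed
  also have "(1/2) * (1 / ((s - 1) / 2)) = 1 / (s - 1)" by simp
  also have "(1/2) * (1 / (s / 2)) = 1 / s" by simp
  finally show ?thesis by (simp add: algebra_simps)
qed

lemma zeta_entire_eq_dirichlet:
  assumes s: "Re s > 1"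
  shows "zeta_entire s = (s - 1) * (\<Sum>n. 1 / of_nat (Suc n) powr s)"
proof -
  define D where "D = (\<Sum>n. 1 / complex_of_nat (Suc n) powr s)"
  have s0: "s \<noteq> 0" "s \<noteq> 1" using s by auto
  have "s / 2 \<notin> \<int>\<^sub>\<le>\<^sub>0" using s by (auto elim!: nonpos_Ints_cases simp: complex_eq_iff)
  hence rG: "rGamma (s / 2) * Gamma (s / 2) = 1" by (simp add: rGamma_inverse_Gamma Gamma_eq_zero_iff)
  have pp: "complex_of_real pi powr (s / 2) * of_real pi powr (- (s / 2)) = 1" by (simp add: powr_minus)
  have "xi s = s * (s - 1) * (Phi (s / 2) + Phi ((1 - s) / 2) + 1 / (s - 1) - 1 / s)"
    unfolding xi_def using s0 by (simp add: field_simps)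
  also have "\<dots> = s * (s - 1) * (of_real pi powr (- (s / 2)) * Gamma (s / 2) * D)"
    using completed_zeta[OF s] by (simp add: D_def)
  finally have "zeta_entire s = (complex_of_real pi powr (s / 2) * of_real pi powr (- (s / 2))) * ((s / 2) * rGamma (s / 2 + 1) * Gamma (s / 2)) * ((s - 1) * D)"
    by (simp add: zeta_entire_def mult_ac)
  \<comment> \<open>The shifted argument in \<open>zeta_entire\<close> absorbs the factor s of
    \<open>xi\<close>, which keeps its definition free of a division by s.\<close>
  also have "(s / 2) * rGamma (s / 2 + 1) = rGamma (s / 2)" by (rule rGamma_plus1)
  finally show ?thesis by (simp add: pp rG D_def)
qed

section \<open>Growth and behaviour at 1/2\<close>

lemma nonpos_Ints_Re: "z \<notin> \<int>\<^sub>\<le>\<^sub>0" if "Re z > 0" for z :: complex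
  using that by (auto elim!: nonpos_Ints_cases)

text \<open>The factorization is centred at 1/2, so this must be excluded as a zero. By symmetry
  \<open>xi (1/2)\<close> is 1 minus half of \<open>Phi (1/4)\<close>, and the crude bound 4/9 * 4/3
  = 16/27 for the latter is far below the value 2 that a zero would require.\<close>

lemma zeta_entire_nonzero_half: "zeta_entire (1/2) \<noteq> 0"
proof -
  have "norm (Phi (1/4)) \<le> (LINT u|lborel. 4/9 * (indicator {0..} u * exp (- (3/4) * u)))" unfolding Phi_def
  proof (rule norm_integral_le)
    show "norm (indicator {0..} u *\<^sub>R (log_theta u *\<^sub>R exp (of_real u * (1/4 :: complex)))) \<le> 4/9 * (indicator {0..} u * exp (- (3/4) * u))" for u
    proof (cases "u \<ge> 0")
      case True
      have "norm (log_theta u *\<^sub>R exp (of_real u * (1/4 :: complex))) = log_theta u * exp (u / 4)" using log_theta_nonneg[of u] by simp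
      also have "\<dots> \<le> 4/9 * exp (- u) * exp (u / 4)" by (intro mult_right_mono log_theta_le' True) auto
      also have "\<dots> = 4/9 * exp (- (3/4) * u)" unfolding mult.assoc exp_add[symmetric] by simp
      finally show ?thesis using True by simp
    qed auto
    show "integrable lborel (\<lambda>u. 4/9 * (indicator {0..} u * exp (- (3/4) * u :: real)))"
      by (intro Bochner_Integration.integrable_mult_right integral_exp_decay) auto
  qed (rule Phi_integrable; simp)
  also have "\<dots> = 16/27" using integral_exp_decay(2)[of "3/4"] by simp
  finally have P: "norm (Phi (1/4)) \<le> 16/27" .
  have xi_eq: "xi (1/2) = 1 - Phi (1/4) / 2" by (simp add: xi_def field_simps)
  have "xi (1/2) \<noteq> 0"
  proof
    assume "xi (1/2) = 0"
    hence "Phi (1/4) = 2" using xi_eq by (simp add: field_simps)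
    with P show False by simp
  qed
  moreover have "rGamma (1/2/2 + 1 :: complex) \<noteq> 0" by (subst rGamma_eq_zero_iff) (rule nonpos_Ints_Re, simp)
  ultimately show "zeta_entire (1/2) \<noteq> 0" by (auto simp: zeta_entire_def)
qed

lemma weierstrass_factor_one_bound: "norm ((1 - w) * exp w) \<le> exp (3 * norm w powr (3/2))" for w :: complex
proof (cases "w = 0")
  case False
  hence n0: "norm w > 0" by simp
  show ?thesis
  proof (cases "norm w \<le> 1/2")
    case True
    have "norm (weierstrass_factor 1 w - 1) \<le> 3 * norm w ^ Suc 1" by (rule weierstrass_factor_bound[OF True])
    hence "norm ((1 - w) * exp w) \<le> 1 + 3 * norm w ^ 2"
      using norm_triangle_ineq[of "weierstrass_factor 1 w - 1" 1] unfolding weierstrass_factor_one by (simp add: numeral_2_eq_2)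
    also have "\<dots> \<le> exp (3 * norm w ^ 2)" by (rule exp_ge_add_one_self)
    also have "norm w ^ 2 \<le> norm w powr (3/2)"
    proof -
      have "norm w powr 2 \<le> norm w powr (3/2)" using True n0 by (intro powr_mono') auto
      thus ?thesis using n0 by simp
    qed
    finally show ?thesis by simp
  next
    \<comment> \<open>Away from 0 the factor is at most exp (2 * |w|), and |w| > 1/2 makes sqrt |w|
      exceed 2/3, which raises the linear exponent to 3 * |w|^(3/2).\<close>
    case False
    have "norm ((1 - w) * exp w) \<le> (1 + norm w) * exp (norm w)"
      unfolding norm_mult using norm_triangle_ineq4[of 1 w] by (intro mult_mono norm_exp) auto
    also have "\<dots> \<le> exp (norm w) * exp (norm w)" by (intro mult_right_mono exp_ge_add_one_self) auto
    also have "\<dots> = exp (2 * norm w)" by (simp add: exp_add[symmetric])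
    also have "2 * norm w \<le> 3 * norm w powr (3/2)"
    proof -
      have "2/3 \<le> sqrt (1/2)" by (rule real_le_rsqrt) (simp add: power2_eq_square)
      also have "\<dots> \<le> sqrt (norm w)" using False by simp
      finally have "norm w * 2 \<le> norm w * (3 * sqrt (norm w))" by (intro mult_left_mono) auto
      also have "norm w * (3 * sqrt (norm w)) = 3 * norm w powr (3/2)" using n0 powr_add[of "norm w" 1 "1/2"] by (simp add: powr_half_sqrt)
      finally show ?thesis by (simp add: mult_ac)
    qed
    finally show ?thesis by simp
  qed
qed auto

text \<open>The factors of the Weierstrass product are \<open>E_1 (- z / k)\<close>, each at most
  exp (3 * |z / k|^(3/2)). The exponent 3/2 exceeds 1, so the bounds sum over k; the prefactors z
  and exp (euler_mascheroni * z) account for the linear term.\<close>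

lemma rGamma_growth: obtains K where "K \<ge> 0" "\<And>z :: complex. norm (rGamma z) \<le> exp (K * norm z + K * norm z powr (3/2))"
proof -
  define S where "S = (\<Sum>k. real k powr (- 3/2))"
  have sS: "summable (\<lambda>k. real k powr (- 3/2))" by (simp add: summable_real_powr_iff)
  define g where "g = \<bar>euler_mascheroni :: real\<bar>"
  have S0: "S \<ge> 0" unfolding S_def by (intro suminf_nonneg sS) auto
  have "norm (rGamma z) \<le> exp ((g + 1) * norm z + 3 * S * norm z powr (3/2))" for z :: complex
  proof (rule LIMSEQ_le_const2[OF tendsto_norm[OF rGamma_Weierstrass_complex]], intro exI allI impI)
    fix n
    have "norm (\<Prod>k=1..n. (1 + z / of_nat k) * exp (- z / of_nat k)) \<le> (\<Prod>k=1..n. exp (3 * (norm z powr (3/2) * real k powr (- 3/2))))"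
      unfolding prod_norm[symmetric]
    proof (intro prod_mono conjI norm_ge_zero)
      fix k assume "k \<in> {1..n}"
      hence "norm (- z / of_nat k) powr (3/2) = norm z powr (3/2) * real k powr (- 3/2)"
        by (simp add: norm_divide powr_divide powr_minus field_simps)
      thus "norm ((1 + z / of_nat k) * exp (- z / of_nat k)) \<le> exp (3 * (norm z powr (3/2) * real k powr (- 3/2)))"
        using weierstrass_factor_one_bound[of "- z / of_nat k"] by simp
    qed
    also have "\<dots> = exp (3 * norm z powr (3/2) * (\<Sum>k=1..n. real k powr (- 3/2)))"
      by (simp add: exp_sum[symmetric] sum_distrib_left mult_ac)
    also have "\<dots> \<le> exp (3 * norm z powr (3/2) * S)" unfolding S_def
      by (simp only: exp_le_cancel_iff) (intro mult_left_mono sum_le_suminf sS; simp)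
    finally have 1: "norm (\<Prod>k=1..n. (1 + z / of_nat k) * exp (- z / of_nat k)) \<le> exp (3 * norm z powr (3/2) * S)" .
    have "norm (exp (euler_mascheroni * z)) \<le> exp (norm (euler_mascheroni * z))" by (rule norm_exp)
    also have "norm (euler_mascheroni * z) = g * norm z"
    proof -
      have "norm (of_real (euler_mascheroni :: real) * z) = g * norm z" by (simp only: norm_mult norm_of_real g_def)
      thus ?thesis by simp
    qed
    finally have 2: "norm (exp (euler_mascheroni * z)) \<le> exp (g * norm z)" .
    have 3: "norm z \<le> exp (norm z)" by (rule order_trans[OF _ exp_ge_add_one_self]) simp
    have "norm (rGamma_series_Weierstrass z n) \<le> exp (g * norm z) * exp (norm z) * exp (3 * norm z powr (3/2) * S)"
      unfolding rGamma_series_Weierstrass_def norm_mult using 1 2 3 by (intro mult_mono) auto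
    also have "\<dots> = exp ((g + 1) * norm z + 3 * S * norm z powr (3/2))" by (simp add: exp_add[symmetric] algebra_simps)
    finally show "norm (rGamma_series_Weierstrass z n) \<le> exp ((g + 1) * norm z + 3 * S * norm z powr (3/2))" .
  qed
  moreover have "exp ((g + 1) * x + 3 * S * x powr (3/2)) \<le> exp ((g + 1 + 3 * S) * x + (g + 1 + 3 * S) * x powr (3/2))" if "x \<ge> 0" for x :: real
    unfolding exp_le_cancel_iff using S0 that by (intro add_mono[OF mult_right_mono mult_right_mono]) (auto simp: g_def)
  ultimately have "norm (rGamma z) \<le> exp ((g + 1 + 3 * S) * norm z + (g + 1 + 3 * S) * norm z powr (3/2))" for z :: complex
    using order_trans norm_ge_zero by blast
  thus ?thesis using S0 by (intro that[of "g + 1 + 3 * S"]) (auto simp: g_def)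
qed

text \<open>\<open>Phi_bound\<close> yields b powr b with b = r / 2 + 1, and ln b \<le> 2 * sqrt b
  turns it into exp (2 * b powr (3/2)). Then b \<le> 2 * r and 2 powr (3/2) \<le> 3 produce the 6,
  and the quadratic factor is absorbed into exp (6 * r).\<close>

lemma xi_growth: "norm (xi s) \<le> exp (6 * r + 6 * r powr (3/2))" if r: "r \<ge> 1" "norm s \<le> r" "norm (1 - s) \<le> r"
proof -
  define X where "X = exp (6 * r powr (3/2))"
  have X1: "X \<ge> 1" by (simp add: X_def)
  have Ph: "norm (Phi (t / 2)) \<le> 4/3 * X" if "norm t \<le> r" for t
  proof -
    define b where "b = r / 2 + 1"
    have b: "b > 0" "b \<le> 2 * r" using r by (auto simp: b_def)
    have "norm (Phi (t / 2)) \<le> 4/3 * (r / 2 + 1) powr (r / 2 + 1)" by (rule Phi_bound) (use that in simp)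
    also have "(r / 2 + 1) powr (r / 2 + 1) = exp (b * ln b)" using b by (simp add: powr_def b_def)
    also have "\<dots> \<le> X" unfolding X_def exp_le_cancel_iff
    proof -
      have "ln (sqrt b) \<le> sqrt b" using b ln_bound[of "sqrt b"] by simp
      hence "ln b \<le> 2 * sqrt b" using b by (simp add: ln_sqrt)
      hence "b * ln b \<le> b * (2 * sqrt b)" using b by (intro mult_left_mono) auto
      also have "\<dots> = 2 * b powr (3/2)" using b powr_add[of b 1 "1/2"] by (simp add: powr_half_sqrt)
      also have "\<dots> \<le> 2 * (2 * r) powr (3/2)" using b by (intro mult_left_mono powr_mono2) auto
      also have "(2 * r) powr (3/2) = 2 powr (3/2) * r powr (3/2)" using r by (simp add: powr_mult)
      also have "2 powr (3/2) \<le> (3 :: real)"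
      proof -
        have "2 powr (3/2) = 2 * sqrt (2::real)" using powr_add[of "2::real" 1 "1/2"] by (simp add: powr_half_sqrt)
        also have "sqrt 2 \<le> (3/2 :: real)" by (rule real_le_lsqrt) (auto simp: power2_eq_square)
        finally show ?thesis by simp
      qed
      finally show "b * ln b \<le> 6 * r powr (3/2)" using r by (simp add: mult_right_mono)
    qed
    finally show ?thesis by simp
  qed
  have "norm (Phi (s / 2) + Phi ((1 - s) / 2)) \<le> 4/3 * X + 4/3 * X"
    by (rule norm_triangle_le[OF add_mono[OF Ph Ph]]) (use r in auto)
  moreover have "norm (s * (s - 1)) \<le> r * r" unfolding norm_mult using r by (intro mult_mono) (auto simp: norm_minus_commute)
  ultimately have "norm (s * (s - 1) * (Phi (s / 2) + Phi ((1 - s) / 2))) \<le> (r * r) * (4/3 * X + 4/3 * X)"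
    unfolding norm_mult[of "s * (s - 1)"] using r by (intro mult_mono) auto
  hence "norm (xi s) \<le> 1 + (r * r) * (4/3 * X + 4/3 * X)"
    unfolding xi_def using norm_triangle_ineq[of 1 "s * (s - 1) * (Phi (s / 2) + Phi ((1 - s) / 2))"] by simp
  also have "\<dots> \<le> X * 1 + X * (3 * r^2)"
  proof -
    define y where "y = X * (r * r)"
    have "0 \<le> y" using X1 by (simp add: y_def)
    moreover have "(r * r) * (4/3 * X + 4/3 * X) = 8/3 * y" "X * (3 * r^2) = 3 * y"
      by (simp_all add: y_def power2_eq_square)
    ultimately show ?thesis using X1 by linarith
  qed
  also have "\<dots> = X * (1 + 3 * r^2)" by (simp add: algebra_simps)
  also have "1 + 3 * r^2 \<le> exp (6 * r)" using exp_lower_Taylor_quadratic[of "6 * r"] r by (simp add: power2_eq_square) (smt (verit) mult_nonneg_nonneg)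
  finally show ?thesis using X1 by (simp add: X_def exp_add[symmetric] add_ac)
qed

lemma zeta_entire_growth:
  obtains C where "C > 0" "\<And>s. norm (zeta_entire s) \<le> norm (zeta_entire (1/2)) * exp (C * (1 + norm (s - 1/2)) powr (3/2))"
proof -
  obtain K where K: "K \<ge> 0" "\<And>z :: complex. norm (rGamma z) \<le> exp (K * norm z + K * norm z powr (3/2))" using rGamma_growth by metis
  \<comment> \<open>The summand ln pi comes from the power of pi, 5 * K = 2 * K + 3 * K from
    \<open>rGamma\<close> at an argument of modulus at most 2 * r, and 12 = 6 + 6 from
    \<open>xi_growth\<close>, all measured against r powr (3/2).\<close>
  define A where "A = 1 + ln pi + 5 * K + 12"
  \<comment> \<open>Pays for stating the growth relative to the value at the centre.\<close>
  define B where "B = \<bar>ln (norm (zeta_entire (1/2)))\<bar>"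
  have lpi: "ln pi \<ge> 0" using pi_gt3 by simp
  have main: "norm (zeta_entire s) \<le> exp (A * (1 + norm (s - 1/2)) powr (3/2))" for s
  proof -
    define r where "r = 1 + norm (s - 1/2)"
    define q where "q = r powr (3/2)"
    have r: "r \<ge> 1" by (simp add: r_def)
    have rq: "r \<le> q" using powr_mono[of 1 "3/2" r] r by (simp add: q_def)
    have s1: "norm s \<le> r" using norm_triangle_ineq[of "s - 1/2" "1/2"] by (simp add: r_def)
    have s2: "norm (1 - s) \<le> r" using norm_triangle_ineq4[of "1/2" "s - 1/2"] by (simp add: r_def)
    have z: "norm (s / 2 + 1) \<le> 2 * r" using norm_triangle_ineq[of "s/2" 1] s1 r by simp
    have "norm (rGamma (s / 2 + 1)) \<le> exp (K * (2 * r) + K * (2 * r) powr (3/2))"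
      using K(1) z by (intro order_trans[OF K(2)]) (simp only: exp_le_cancel_iff, intro add_mono mult_left_mono powr_mono2; simp)
    also have "\<dots> \<le> exp (5 * K * q)" unfolding exp_le_cancel_iff
    proof -
      have "(2 * r) powr (3/2) = 2 powr (3/2) * q" using r by (simp add: powr_mult q_def)
      also have "2 powr (3/2) = 2 * sqrt (2::real)" using powr_add[of "2::real" 1 "1/2"] by (simp add: powr_half_sqrt)
      also have "2 * sqrt 2 \<le> (3 :: real)" using real_le_lsqrt[of "3/2" "2"] by (simp add: power2_eq_square)
      finally have "(2 * r) powr (3/2) \<le> 3 * q" using r by (simp add: mult_right_mono q_def)
      from mult_left_mono[OF this K(1)] show "K * (2 * r) + K * (2 * r) powr (3/2) \<le> 5 * K * q"
        using mult_left_mono[OF rq K(1)] by simp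
    qed
    finally have 1: "norm (rGamma (s / 2 + 1)) \<le> exp (5 * K * q)" .
    have "norm (xi s) \<le> exp (6 * r + 6 * q)" unfolding q_def by (rule xi_growth[OF r s1 s2])
    also have "\<dots> \<le> exp (12 * q)" using rq by simp
    finally have 2: "norm (xi s) \<le> exp (12 * q)" .
    have "norm (complex_of_real pi powr (s / 2)) = exp (Re s / 2 * ln pi)"
      by (simp add: powr_def Ln_of_real)
    also have "Re s / 2 * ln pi \<le> r * ln pi" using lpi complex_Re_le_cmod[of s] s1 r by (intro mult_right_mono) auto
    also have "\<dots> \<le> q * ln pi" using rq lpi by (intro mult_right_mono) auto
    finally have 3: "norm (complex_of_real pi powr (s / 2)) \<le> exp (q * ln pi)" by simp
    have "norm (zeta_entire s) \<le> norm (complex_of_real pi powr (s / 2)) * norm (rGamma (s / 2 + 1)) * norm (xi s)"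
      unfolding zeta_entire_def norm_divide norm_mult by (simp add: mult_nonneg_nonneg)
    also have "\<dots> \<le> exp (q * ln pi) * exp (5 * K * q) * exp (12 * q)" using 1 2 3 by (intro mult_mono) auto
    also have "\<dots> = exp ((ln pi + 5 * K + 12) * q)" by (simp add: exp_add[symmetric] algebra_simps)
    also have "\<dots> \<le> exp (A * q)" using r by (simp add: A_def q_def mult_right_mono)
    finally show ?thesis by (simp add: q_def r_def)
  qed
  show ?thesis
  proof (rule that[of "A + B"])
    show "A + B > 0" using K(1) lpi by (simp add: A_def B_def add_pos_nonneg)
    fix s :: complex
    define q where "q = (1 + norm (s - 1/2)) powr (3/2)"
    have q: "q \<ge> 1" unfolding q_def by (intro ge_one_powr_ge_zero) auto
    have n0: "norm (zeta_entire (1/2)) > 0" using zeta_entire_nonzero_half by simp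
    have "exp (A * q) = exp (ln (norm (zeta_entire (1/2)))) * exp (A * q - ln (norm (zeta_entire (1/2))))"
      unfolding exp_add[symmetric] by simp
    also have "exp (A * q - ln (norm (zeta_entire (1/2)))) \<le> exp ((A + B) * q)"
    proof -
      have "- ln (norm (zeta_entire (1/2))) \<le> B * 1" by (simp add: B_def)
      also have "B * 1 \<le> B * q" using q by (intro mult_left_mono) (auto simp: B_def)
      finally show ?thesis by (simp add: algebra_simps)
    qed
    finally have "exp (A * q) \<le> norm (zeta_entire (1/2)) * exp ((A + B) * q)" using n0 by (simp)
    with main[of s] show "norm (zeta_entire s) \<le> norm (zeta_entire (1/2)) * exp ((A + B) * (1 + norm (s - 1/2)) powr (3/2))"
      by (simp add: q_def)
  qed
qed

section \<open>The logarithmic derivative at the centre\<close>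

lemma xi_deriv_half: "deriv xi (1/2) = 0"
proof -
  have d: "(xi has_field_derivative deriv xi (1/2)) (at (1/2))"
    using holomorphic_derivI[OF xi_holomorphic[of UNIV]] by auto
  hence "((\<lambda>s. xi (1 - s)) has_field_derivative deriv xi (1/2) * (- 1)) (at (1/2))"
    by (intro DERIV_chain2[of xi]) (auto intro!: derivative_eq_intros)
  hence "(xi has_field_derivative - deriv xi (1/2)) (at (1/2))" by (simp add: xi_reflect)
  from DERIV_unique[OF d this] show ?thesis by simp
qed

text \<open>Differentiating the duplication formula at 1/4 gives the sum of the values at 1/4 and
  3/4; differentiating the reflection formula gives their difference, which is pi because cos and
  sin agree at pi/4.\<close>

lemma Digamma_one_quarter: "Digamma (1/4 :: complex) = - euler_mascheroni - of_real (pi / 2) - of_real (3 * ln 2)"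
proof -
  have nn: "1/4 \<notin> (\<int>\<^sub>\<le>\<^sub>0 :: complex set)" "3/4 \<notin> (\<int>\<^sub>\<le>\<^sub>0 :: complex set)" "1/2 \<notin> (\<int>\<^sub>\<le>\<^sub>0 :: complex set)"
    by (rule nonpos_Ints_Re; simp)+
  have nz: "Gamma (1/4 :: complex) \<noteq> 0" "Gamma (3/4 :: complex) \<noteq> 0" "rGamma (1/4 :: complex) \<noteq> 0" "rGamma (3/4 :: complex) \<noteq> 0"
    using nn by (auto simp: Gamma_eq_zero_iff rGamma_eq_zero_iff)
  let ?L = "\<lambda>z :: complex. Gamma z * Gamma (z + 1/2)"
  let ?R = "\<lambda>z :: complex. exp ((1 - 2*z) * of_real (ln 2)) * of_real (sqrt pi) * Gamma (2*z)"
  have dL: "(?L has_field_derivative ?L (1/4) * (Digamma (1/4) + Digamma (3/4))) (at (1/4))"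
    using nn by (auto intro!: derivative_eq_intros simp: algebra_simps)
  have dR: "(?R has_field_derivative ?R (1/4) * (- 2 * of_real (ln 2) + 2 * Digamma (1/2))) (at (1/4))"
    using nn by (auto intro!: derivative_eq_intros simp: algebra_simps)
  have "eventually (\<lambda>z :: complex. Re z > 0) (nhds (1/4))"
    using eventually_nhds_in_open[OF open_halfspace_Re_gt[of 0], of "1/4"] by simp
  hence "eventually (\<lambda>z. ?L z = ?R z) (nhds (1/4))"
    by eventually_elim (intro Gamma_legendre_duplication nonpos_Ints_Re; simp)
  hence "(?L has_field_derivative ?R (1/4) * (- 2 * of_real (ln 2) + 2 * Digamma (1/2))) (at (1/4))"
    by (intro DERIV_cong_ev[OF refl _ refl, THEN iffD2, OF _ dR])
  from DERIV_unique[OF dL this] have "?L (1/4) * (Digamma (1/4) + Digamma (3/4)) = ?R (1/4) * (- 2 * of_real (ln 2) + 2 * Digamma (1/2))" .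
  also have "?R (1/4) = ?L (1/4)" by (rule Gamma_legendre_duplication[symmetric]) (use nn in auto)
  finally have 1: "Digamma (1/4 :: complex) + Digamma (3/4) = - 2 * of_real (ln 2) + 2 * Digamma (1/2)" using nz by simp
  let ?S = "\<lambda>z :: complex. rGamma z * rGamma (1 - z)"
  have "(?S has_field_derivative ?S (1/4) * (- Digamma (1/4) + Digamma (3/4))) (at (1/4))"
    using nn by (auto intro!: derivative_eq_intros simp: algebra_simps)
  moreover have "(?S has_field_derivative cos (of_real pi * (1/4))) (at (1/4))"
    unfolding rGamma_reflection_complex by (auto intro!: derivative_eq_intros)
  ultimately have "?S (1/4) * (- Digamma (1/4) + Digamma (3/4)) = cos (of_real pi * (1/4))" by (rule DERIV_unique)
  also have "?S (1/4) = sin (of_real pi * (1/4)) / of_real pi" by (rule rGamma_reflection_complex)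
  also have "cos (of_real pi * (1/4) :: complex) = of_real (cos (pi / 4))" by (simp flip: cos_of_real)
  also have "sin (of_real pi * (1/4) :: complex) = of_real (sin (pi / 4))" by (simp flip: sin_of_real)
  also have "cos (pi / 4) = sin (pi / 4)" by (simp add: sin_45 cos_45)
  finally have "of_real (sin (pi / 4)) / of_real pi * (- Digamma (1/4 :: complex) + Digamma (3/4)) = of_real (sin (pi / 4))" .
  moreover have "complex_of_real (sin (pi / 4)) \<noteq> 0" by (simp add: sin_45)
  moreover have "D = of_real pi" if "S / of_real pi * D = S" "S \<noteq> 0" for S D :: complex using that by (auto simp: field_simps)
  ultimately have 2: "- Digamma (1/4 :: complex) + Digamma (3/4) = of_real pi" by blast
  have "2 * Digamma (1/4 :: complex) = - 2 * of_real (ln 2) + 2 * Digamma (1/2) - of_real pi" using 1 2 by (simp add: algebra_simps)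
  thus ?thesis by (simp add: Digamma_one_half field_simps)
qed

text \<open>\<open>xi\<close> contributes nothing by \<open>xi_deriv_half\<close>. The summand - 2
  is half of the jump by 4 from Digamma at 1/4 to Digamma at 5/4; it is cancelled later by the pole
  at 1.\<close>

lemma zeta_entire_log_deriv_half:
  "deriv zeta_entire (1/2) / zeta_entire (1/2) = of_real (ln pi / 2 + pi / 4 + euler_mascheroni / 2 + 3/2 * ln 2) - 2"
proof -
  have nn: "5/4 \<notin> (\<int>\<^sub>\<le>\<^sub>0 :: complex set)" by (rule nonpos_Ints_Re) simp
  have d: "(xi has_field_derivative 0) (at (1/2))"
    using holomorphic_derivI[OF xi_holomorphic[of UNIV], of "1/2" UNIV] xi_deriv_half by auto
  have dp: "((\<lambda>s. complex_of_real pi powr (s / 2)) has_field_derivative of_real pi powr (1/2/2) * (of_real (ln pi) / 2)) (at (1/2))"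
  proof -
    have eq: "complex_of_real pi powr (s / 2) = exp (s / 2 * of_real (ln pi))" for s by (simp add: powr_def Ln_of_real)
    show ?thesis unfolding eq by (auto intro!: derivative_eq_intros)
  qed
  have dr: "((\<lambda>s. rGamma (s / 2 + 1)) has_field_derivative rGamma (1/2/2 + 1) * (- Digamma (5/4) / 2)) (at (1/2 :: complex))"
    using nn by (auto intro!: derivative_eq_intros)
  have "(zeta_entire has_field_derivative zeta_entire (1/2) * (of_real (ln pi) / 2 - Digamma (5/4) / 2)) (at (1/2))"
    unfolding zeta_entire_def
    by (rule DERIV_cong[OF DERIV_cdivide[OF DERIV_mult[OF DERIV_mult[OF dp dr] d]]]) (simp add: field_simps)
  hence "deriv zeta_entire (1/2) / zeta_entire (1/2) = of_real (ln pi) / 2 - Digamma (5/4) / 2"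
    using zeta_entire_nonzero_half by (simp add: DERIV_imp_deriv)
  also have "Digamma (5/4 :: complex) = Digamma (1/4) + 4" using Digamma_plus1[of "1/4 :: complex"] by simp
  finally show ?thesis unfolding Digamma_one_quarter by (simp add: field_simps)
qed

section \<open>The Dirichlet series\<close>

lemma isCont_zeta_entire: "isCont zeta_entire z"
  by (rule field_differentiable_imp_continuous_at, rule holomorphic_on_imp_differentiable_at[OF zeta_entire_holomorphic[of UNIV] open_UNIV UNIV_I])

text \<open>Uniqueness is the identity theorem for meromorphic functions: the difference of two
  candidates vanishes near 2, hence on a punctured neighbourhood of every point. The values at the
  points themselves are then forced, being the limit or, at a pole, 0.\<close>

lemma riemann_zeta_eq: "riemann_zeta = (\<lambda>s. zeta_entire s / (s - 1))"
proof -
  let ?g = "\<lambda>s. zeta_entire s / (s - 1)"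
  let ?Q = "\<lambda>f. f nicely_meromorphic_on UNIV \<and> (\<forall>s. Re s > 1 \<longrightarrow> f s = (\<Sum>n. 1 / of_nat (Suc n) powr s))"
  have an: "zeta_entire analytic_on A" for A
    using zeta_entire_holomorphic[of UNIV] by (meson analytic_on_holomorphic open_UNIV subset_UNIV)
  note cont = isCont_zeta_entire
  have mero: "?g meromorphic_on UNIV"
    by (intro meromorphic_on_divide meromorphic_on_diff meromorphic_on_id' meromorphic_on_const analytic_on_imp_meromorphic_on an meromorphic_on_id)
  have nice: "?g nicely_meromorphic_on UNIV"
    unfolding nicely_meromorphic_on_def
  proof (intro conjI mero ballI)
    fix z :: complex
    show "(is_pole ?g z \<and> ?g z = 0) \<or> ?g \<midarrow>z\<rightarrow> ?g z"
    proof (cases "z = 1")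
      case True
      have "filterlim (\<lambda>s :: complex. s - 1) (at 0) (at 1)"
        by (rule filterlim_atI) (auto intro!: tendsto_eq_intros simp: eventually_at_filter)
      hence "is_pole ?g 1" by (intro is_pole_divide cont) (auto simp: zeta_entire_1)
      thus ?thesis using True by simp
    next
      case False
      have "isCont ?g z" using False by (intro continuous_intros cont) auto
      thus ?thesis by (simp add: isCont_def)
    qed
  qed
  have Qg: "?Q ?g" using nice zeta_entire_eq_dirichlet by auto
  have uniq: "f = ?g" if "?Q f" for f
  proof
    fix z
    define h where "h w = f w - ?g w" for w
    have "h meromorphic_on UNIV" unfolding h_def using that mero by (intro meromorphic_on_diff) (auto simp: nicely_meromorphic_on_def)
    from meromorphic_imp_constant_or_avoid[OF this open_UNIV connected_UNIV, of 0]
    have ev: "eventually (\<lambda>w. h w = 0) (at z)"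
    proof
      assume "eventually (\<lambda>z. h z = 0) (cosparse UNIV)"
      thus ?thesis by (simp add: eventually_cosparse_open_eq)
    next
      assume "eventually (\<lambda>z. h z \<noteq> 0) (cosparse UNIV)"
      hence 1: "eventually (\<lambda>z. h z \<noteq> 0) (at 2)" by (simp add: eventually_cosparse_open_eq)
      have "eventually (\<lambda>w :: complex. Re w > 1) (at 2)"
        using eventually_nhds_in_open[OF open_halfspace_Re_gt[of 1], of 2] by (simp add: eventually_at_filter eventually_mono)
      hence "eventually (\<lambda>w. h w = 0) (at 2)"
        by eventually_elim (use that Qg in \<open>auto simp: h_def\<close>)
      with 1 have "eventually (\<lambda>_. False) (at (2 :: complex))" by eventually_elim simp
      thus ?thesis by simp
    qed
    hence ev': "eventually (\<lambda>w. f w = ?g w) (at z)" by eventually_elim (simp add: h_def)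
    hence pole: "is_pole f z \<longleftrightarrow> is_pole ?g z" by (intro is_pole_cong) auto
    have lim: "f \<midarrow>z\<rightarrow> c \<longleftrightarrow> ?g \<midarrow>z\<rightarrow> c" for c using ev' by (rule tendsto_cong)
    have "(is_pole f z \<and> f z = 0) \<or> f \<midarrow>z\<rightarrow> f z" "(is_pole ?g z \<and> ?g z = 0) \<or> ?g \<midarrow>z\<rightarrow> ?g z"
      using that nice unfolding nicely_meromorphic_on_def by blast+
    moreover have "\<not> (is_pole ?g z \<and> ?g \<midarrow>z\<rightarrow> c)" for c
      unfolding is_pole_def using not_tendsto_and_filterlim_at_infinity[of "at z" ?g c] by auto
    ultimately have cases: "is_pole ?g z \<and> f z = 0 \<and> ?g z = 0 \<or> ?g \<midarrow>z\<rightarrow> f z \<and> ?g \<midarrow>z\<rightarrow> ?g z"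
      unfolding pole lim by blast
    show "f z = ?g z"
    proof (cases "is_pole ?g z \<and> f z = 0 \<and> ?g z = 0")
      case False
      with cases have "?g \<midarrow>z\<rightarrow> f z" "?g \<midarrow>z\<rightarrow> ?g z" by blast+
      thus ?thesis by (rule tendsto_unique[OF at_neq_bot])
    qed simp
  qed
  show ?thesis unfolding riemann_zeta_def by (rule the_equality[of ?Q, OF Qg uniq])
qed

text \<open>The default value 1 / 0 = 0 makes the term of index 0 vanish, so Dirichlet series can
  run over all naturals.\<close>

definition npow :: "complex \<Rightarrow> nat \<Rightarrow> complex" where "npow s n = 1 / of_nat n powr s"

lemma npow_0 [simp]: "npow s 0 = 0" by (simp add: npow_def)

lemma npow_eq_exp: "n > 0 \<Longrightarrow> npow s n = exp (- s * of_real (ln (real n)))"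
  by (simp add: npow_def powr_def Ln_of_nat exp_minus inverse_eq_divide)

lemma npow_of_real: "n > 0 \<Longrightarrow> npow (of_real r) n = of_real (exp (- r * ln (real n)))"
  by (simp add: npow_eq_exp exp_of_real[symmetric])

lemma npow_mult: "npow s (m * n) = npow s m * npow s n"
  by (cases "m = 0 \<or> n = 0") (auto simp: npow_eq_exp ln_mult exp_add[symmetric] algebra_simps)

lemma norm_npow_mono: "Re s \<le> Re t \<Longrightarrow> norm (npow t n) \<le> norm (npow s n)"
  by (cases "n = 0") (auto simp: npow_eq_exp intro!: mult_right_mono)

lemma summable_norm_npow: "Re s > 1 \<Longrightarrow> summable (\<lambda>n. norm (npow s n))"
  using summable_dirichlet[of s] summable_Suc_iff[of "\<lambda>n. norm (npow s n)"] by (simp add: npow_def)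

text \<open>On a small disc around s the terms are dominated by those at a real point 1 + d left of
  the disc, so the partial sums converge uniformly. Convergence of the differentiated series is part
  of the conclusion.\<close>

lemma dirichlet_series_derivative:
  fixes c :: "nat \<Rightarrow> complex"
  assumes c: "\<And>s. Re s > 1 \<Longrightarrow> summable (\<lambda>n. norm (c n * npow s n))"
  shows "\<exists>F'. \<forall>s. Re s > 1 \<longrightarrow> ((\<lambda>s. \<Sum>n. c n * npow s n) has_field_derivative F' s) (at s) \<and> (\<lambda>n. - (c n * npow s n * of_real (ln (real n)))) sums F' s"
proof -
  let ?S = "{s :: complex. Re s > 1}"
  have "\<exists>g'. \<forall>s\<in>?S. ((\<lambda>s. \<Sum>n. c n * npow s n) has_field_derivative g' s) (at s) \<and> ((\<lambda>N. \<Sum>n<N. - (c n * npow s n * of_real (ln (real n)))) \<longlonglongrightarrow> g' s)"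
  proof (rule has_complex_derivative_uniform_sequence[OF open_halfspace_Re_gt, where f = "\<lambda>N s. \<Sum>n<N. c n * npow s n"])
    fix N s
    have d: "((\<lambda>s. npow s n) has_field_derivative - (npow s n * of_real (ln (real n)))) (at s)" for n
    proof (cases "n = 0")
      case False
      hence "(\<lambda>s. npow s n) = (\<lambda>s. exp (- s * of_real (ln (real n))))" by (simp add: npow_eq_exp fun_eq_iff)
      thus ?thesis using False by (auto intro!: derivative_eq_intros simp: npow_eq_exp)
    qed simp
    show "((\<lambda>s. \<Sum>n<N. c n * npow s n) has_field_derivative (\<Sum>n<N. - (c n * npow s n * of_real (ln (real n))))) (at s)"
    proof (rule DERIV_sum)
      fix n show "((\<lambda>s. c n * npow s n) has_field_derivative - (c n * npow s n * of_real (ln (real n)))) (at s)"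
        using DERIV_cmult[OF d[of n], of "c n"] by (simp add: mult_ac)
    qed
  next
    fix s :: complex assume "s \<in> ?S"
    hence s: "Re s > 1" by simp
    define d where "d = (Re s - 1) / 2"
    have d: "d > 0" using s by (simp add: d_def)
    have re: "Re z \<ge> 1 + d" if "z \<in> cball s d" for z
    proof -
      have "\<bar>Re (s - z)\<bar> \<le> d" using that abs_Re_le_cmod[of "s - z"] by (simp add: dist_norm)
      hence "Re s - Re z \<le> d" using abs_ge_self[of "Re (s - z)"] by simp
      thus ?thesis by (simp add: d_def field_simps)
    qed
    have "uniform_limit (cball s d) (\<lambda>N s. \<Sum>n<N. c n * npow s n) (\<lambda>s. \<Sum>n. c n * npow s n) sequentially"
    proof (rule Weierstrass_m_test)
      show "summable (\<lambda>n. norm (c n * npow (of_real (1 + d)) n))" by (rule c) (use d in auto)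
      fix n z assume "z \<in> cball s d"
      from norm_npow_mono[of "of_real (1 + d)" z n] re[OF this]
      show "norm (c n * npow z n) \<le> norm (c n * npow (of_real (1 + d)) n)" by (simp add: norm_mult mult_left_mono)
    qed
    moreover have "cball s d \<subseteq> ?S" using re d by force
    ultimately show "\<exists>d>0. cball s d \<subseteq> ?S \<and> uniform_limit (cball s d) (\<lambda>N s. \<Sum>n<N. c n * npow s n) (\<lambda>s. \<Sum>n. c n * npow s n) sequentially"
      using d by blast
  qed
  thus ?thesis by (simp add: sums_def)
qed

section \<open>The logarithmic derivative of the Dirichlet series\<close>

definition zeta_D :: "complex \<Rightarrow> complex" where "zeta_D s = (\<Sum>n. npow s n)"
definition mangoldt_L :: "complex \<Rightarrow> complex" where "mangoldt_L s = (\<Sum>n. mangoldt n * npow s n)"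

lemma zeta_D_eq: "Re s > 1 \<Longrightarrow> zeta_D s = (\<Sum>n. 1 / of_nat (Suc n) powr s)"
  using suminf_split_head[OF summable_norm_cancel[OF summable_norm_npow[of s]]] unfolding zeta_D_def npow_def[abs_def] by simp

text \<open>Convergence at the real exponent Re s is a by-product of termwise differentiation, and
  there the terms are nonnegative and equal to the moduli.\<close>

lemma summable_ln_npow: assumes "Re s > 1" shows "summable (\<lambda>n. norm (npow s n) * ln (real n))"
proof -
  obtain F' where F': "\<And>s. Re s > 1 \<Longrightarrow> (\<lambda>n. - (1 * npow s n * of_real (ln (real n)))) sums F' s"
    using dirichlet_series_derivative[of "\<lambda>_. 1"] summable_norm_npow by auto
  have "summable (\<lambda>n. - (- (1 * npow (of_real (Re s)) n * of_real (ln (real n)))))"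
    using sums_summable[OF sums_minus[OF F'[of "of_real (Re s)"]]] assms by simp
  from summable_Re[OF this] have "summable (\<lambda>n. Re (- (- (1 * npow (of_real (Re s)) n * of_real (ln (real n))))))" .
  moreover have "Re (- (- (1 * npow (of_real (Re s)) n * of_real (ln (real n))))) = norm (npow s n) * ln (real n)" for n
    by (cases "n = 0") (auto simp: npow_of_real, simp add: npow_eq_exp)
  ultimately show ?thesis by (simp only:)
qed

lemma summable_mangoldt_npow: assumes "Re s > 1" shows "summable (\<lambda>n. norm (mangoldt n * npow s n))"
proof (rule summable_comparison_test'[OF summable_ln_npow[OF assms]])
  fix n :: nat
  show "norm (norm (mangoldt n * npow s n)) \<le> norm (npow s n) * ln (real n)"
    using mangoldt_le[of n] by (cases "n = 0") (auto simp: norm_mult abs_mult mult.commute[of "mangoldt n"] intro!: mult_left_mono)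
qed

text \<open>Dirichlet convolution: the absolutely convergent double series over (m, d) is regrouped
  by n = m * d, and the sum of the von Mangoldt function over the divisors of n is ln n.\<close>

lemma zeta_D_mangoldt_L:
  assumes s: "Re s > 1" shows "(\<lambda>n. npow s n * of_real (ln (real n))) sums (zeta_D s * mangoldt_L s)"
proof -
  let ?A = "{0<..} :: nat set"
  have hs: "(f has_sum suminf f) ?A" if "summable (\<lambda>n. norm (f n))" "f 0 = 0" for f :: "nat \<Rightarrow> complex"
  proof -
    have "(f has_sum suminf f) UNIV" by (rule norm_summable_imp_has_sum[OF that(1) summable_sums[OF summable_norm_cancel[OF that(1)]]])
    thus ?thesis by (rule has_sum_cong_neutral[THEN iffD1, rotated -1]) (use that in auto)
  qed
  have a: "(npow s has_sum zeta_D s) ?A" unfolding zeta_D_def by (rule hs[OF summable_norm_npow[OF s]]) simp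
  have b: "((\<lambda>n. mangoldt n * npow s n) has_sum mangoldt_L s) ?A" unfolding mangoldt_L_def by (rule hs[OF summable_mangoldt_npow[OF s]]) simp
  have na: "(\<lambda>n. norm (npow s n)) summable_on ?A"
    using norm_summable_imp_summable_on[of "\<lambda>n. norm (npow s n)"] summable_norm_npow[OF s] summable_on_subset_banach by fastforce
  have nb: "(\<lambda>n. norm (mangoldt n * npow s n)) summable_on ?A"
    using norm_summable_imp_summable_on[of "\<lambda>n. norm (mangoldt n * npow s n)"] summable_mangoldt_npow[OF s] summable_on_subset_banach by fastforce
  let ?f = "\<lambda>(m, d). npow s m * (mangoldt d * npow s d)"
  have "(\<lambda>x. norm (?f x)) summable_on ?A \<times> ?A"
    unfolding Infinite_Sum.abs_summable_on_Sigma_iff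
  proof (intro conjI ballI)
    fix m show "(\<lambda>d. norm (?f (m, d))) summable_on ?A" using summable_on_cmult_right[OF nb, of "norm (npow s m)"] by (simp add: norm_mult)
  next
    have "(\<lambda>m. norm (npow s m) * infsum (\<lambda>d. norm (mangoldt d * npow s d)) ?A) summable_on ?A" by (intro summable_on_cmult_left na)
    also have "(\<lambda>m. norm (npow s m) * infsum (\<lambda>d. norm (mangoldt d * npow s d)) ?A) = (\<lambda>m. norm (infsum (\<lambda>d. norm (?f (m, d))) ?A))"
    proof
      fix m
      have "infsum (\<lambda>d. norm (?f (m, d))) ?A = norm (npow s m) * infsum (\<lambda>d. norm (mangoldt d * npow s d)) ?A"
        unfolding case_prod_conv norm_mult[of "npow s m"] by (intro infsum_cmult_right nb)
      moreover have "infsum (\<lambda>d. norm (mangoldt d * npow s d)) ?A \<ge> 0" by (intro infsum_nonneg) auto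
      ultimately show "norm (npow s m) * infsum (\<lambda>d. norm (mangoldt d * npow s d)) ?A = norm (infsum (\<lambda>d. norm (?f (m, d))) ?A)" by simp
    qed
    finally show "(\<lambda>m. norm (infsum (\<lambda>d. norm (?f (m, d))) ?A)) summable_on ?A" .
  qed
  hence sf: "?f summable_on ?A \<times> ?A" by (rule abs_summable_summable)
  have "(?f has_sum zeta_D s * mangoldt_L s) (?A \<times> ?A)"
  proof (rule has_sum_SigmaI[OF _ _ sf])
    show "((\<lambda>d. ?f (m, d)) has_sum npow s m * mangoldt_L s) ?A" for m unfolding case_prod_conv by (intro has_sum_cmult_right b)
    show "((\<lambda>m. npow s m * mangoldt_L s) has_sum zeta_D s * mangoldt_L s) ?A" by (intro has_sum_cmult_left a)
  qed
  moreover have "bij_betw (\<lambda>(n, d). (n div d, d)) (Sigma ?A (\<lambda>n. {d. d dvd n})) (?A \<times> ?A)"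
    by (rule bij_betwI[where g = "\<lambda>(m, d). (m * d, d)"]) (auto elim!: dvdE)
  ultimately have "((\<lambda>x. ?f ((\<lambda>(n, d). (n div d, d)) x)) has_sum zeta_D s * mangoldt_L s) (Sigma ?A (\<lambda>n. {d. d dvd n}))"
    by (subst has_sum_reindex_bij_betw)
  also have "?this \<longleftrightarrow> ((\<lambda>(n, d). npow s n * mangoldt d) has_sum zeta_D s * mangoldt_L s) (Sigma ?A (\<lambda>n. {d. d dvd n}))"
  proof (rule has_sum_cong)
    fix x assume "x \<in> Sigma ?A (\<lambda>n. {d. d dvd n})"
    then obtain n d where x: "x = (n, d)" "n > 0" "d dvd n" by auto
    hence "npow s (n div d) * npow s d = npow s n" by (simp flip: npow_mult)
    thus "?f ((\<lambda>(n, d). (n div d, d)) x) = (case x of (n, d) \<Rightarrow> npow s n * mangoldt d)"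
      using x by (simp add: mult_ac)
  qed
  finally have "((\<lambda>n. npow s n * of_real (ln (real n))) has_sum zeta_D s * mangoldt_L s) ?A"
  proof (rule has_sum_SigmaD)
    fix n assume n: "n \<in> ?A"
    hence fin: "finite {d. d dvd n}" by auto
    have "(\<Sum>d | d dvd n. npow s n * mangoldt d) = npow s n * of_real (ln (real n))"
      using n mangoldt_sum[of n, where 'a = complex] by (simp add: sum_distrib_left[symmetric])
    thus "((\<lambda>d. case (n, d) of (n, d) \<Rightarrow> npow s n * mangoldt d) has_sum npow s n * of_real (ln (real n))) {d. d dvd n}"
      using has_sum_finite[OF fin, of "\<lambda>d. npow s n * mangoldt d"] by simp
  qed
  hence "((\<lambda>n. npow s n * of_real (ln (real n))) has_sum zeta_D s * mangoldt_L s) UNIV"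
    by (rule has_sum_cong_neutral[THEN iffD1, rotated -1]) auto
  thus ?thesis by (rule has_sum_imp_sums)
qed

lemma zeta_D_derivative: assumes "Re s > 1" shows "(zeta_D has_field_derivative - (zeta_D s * mangoldt_L s)) (at s)"
proof -
  obtain F' where F': "\<And>s. Re s > 1 \<Longrightarrow> ((\<lambda>s. \<Sum>n. 1 * npow s n) has_field_derivative F' s) (at s) \<and> (\<lambda>n. - (1 * npow s n * of_real (ln (real n)))) sums F' s"
    using dirichlet_series_derivative[of "\<lambda>_. 1"] summable_norm_npow by auto
  have "F' s = - (zeta_D s * mangoldt_L s)"
    using F'[OF assms] sums_minus[OF zeta_D_mangoldt_L[OF assms]] sums_unique2 by auto
  thus ?thesis using F'[OF assms] by (simp add: zeta_D_def[abs_def])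
qed

text \<open>By \<open>zeta_D_derivative\<close>, multiplying \<open>zeta_D\<close> by the
  exponential of a primitive of \<open>mangoldt_L\<close> gives a constant on the half-plane. A
  single zero would force \<open>zeta_D\<close> to vanish identically, contradicting
  \<open>zeta_entire 1 = 1\<close> by continuity.\<close>

lemma zeta_D_nonzero: assumes "Re s > 1" shows "zeta_D s \<noteq> 0"
proof
  assume z: "zeta_D s = 0"
  let ?S = "{s :: complex. Re s > 1}"
  obtain F' where F': "\<And>s. Re s > 1 \<Longrightarrow> (mangoldt_L has_field_derivative F' s) (at s)"
    using dirichlet_series_derivative[OF summable_mangoldt_npow] unfolding mangoldt_L_def[abs_def] by blast
  have "mangoldt_L holomorphic_on ?S" unfolding holomorphic_on_open[OF open_halfspace_Re_gt] using F' by blast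
  then obtain P where P: "\<And>x. x \<in> ?S \<Longrightarrow> (P has_field_derivative mangoldt_L x) (at x within ?S)"
    using holomorphic_convex_primitive'[OF convex_halfspace_Re_gt open_halfspace_Re_gt] by blast
  have "((\<lambda>x. zeta_D x * exp (P x)) has_field_derivative 0) (at x within ?S)" if "x \<in> ?S" for x
  proof -
    have "Re x > 1" using that by simp
    from DERIV_mult[OF has_field_derivative_at_within[OF zeta_D_derivative[OF this]] DERIV_chain2[OF DERIV_exp P[OF that]]]
    show ?thesis by (simp add: algebra_simps)
  qed
  hence "\<exists>c. \<forall>x\<in>?S. zeta_D x * exp (P x) = c"
    by (intro has_field_derivative_zero_constant convex_halfspace_Re_gt)
  then obtain c where c: "\<And>x. Re x > 1 \<Longrightarrow> zeta_D x * exp (P x) = c" by blast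
  from c[OF assms] z have "c = 0" by simp
  with c have zero: "zeta_D x = 0" if "Re x > 1" for x using that by fastforce
  note isCont_zeta_entire[of 1]
  moreover have "zeta_entire 1 \<noteq> 0" by (simp add: zeta_entire_1)
  ultimately obtain e where e: "e > 0" "\<And>y. dist 1 y < e \<Longrightarrow> zeta_entire y \<noteq> 0" using continuous_at_avoid[of 1 zeta_entire 0] by auto
  have "zeta_entire (1 + of_real (e / 2)) = 0"
    using zero[of "1 + of_real (e / 2)"] zeta_D_eq[of "1 + of_real (e / 2)"] zeta_entire_eq_dirichlet[of "1 + of_real (e / 2)"] e(1) by simp
  moreover have "dist (1 :: complex) (1 + of_real (e / 2)) < e" using e(1) by (simp add: dist_norm norm_mult norm_divide)
  ultimately show False using e(2) by blast
qed

lemma zeta_entire_eq_zeta_D: "Re s > 1 \<Longrightarrow> zeta_entire s = (s - 1) * zeta_D s"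
  using zeta_entire_eq_dirichlet zeta_D_eq by simp

lemma zeta_entire_nonzero: "Re s > 1 \<Longrightarrow> zeta_entire s \<noteq> 0"
  using zeta_D_nonzero[of s] by (auto simp: zeta_entire_eq_zeta_D)

lemma zeta_entire_log_deriv: assumes s: "Re s > 1"
  shows "deriv zeta_entire s / zeta_entire s = 1 / (s - 1) - mangoldt_L s"
proof -
  have der: "((\<lambda>s. (s - 1) * zeta_D s) has_field_derivative (1 * zeta_D s + - (zeta_D s * mangoldt_L s) * (s - 1))) (at s)"
    by (rule DERIV_mult[OF _ zeta_D_derivative[OF s]]) (auto intro!: derivative_eq_intros)
  have ev: "eventually (\<lambda>s. zeta_entire s = (s - 1) * zeta_D s) (nhds s)"
    using eventually_nhds_in_open[OF open_halfspace_Re_gt[of 1], of s] s by (auto elim!: eventually_mono simp: zeta_entire_eq_zeta_D)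
  note DERIV_cong_ev[OF refl ev refl, THEN iffD2, OF der]
  hence "deriv zeta_entire s = zeta_D s - zeta_D s * mangoldt_L s * (s - 1)" by (simp add: DERIV_imp_deriv)
  moreover have s1: "s \<noteq> 1" using s by auto
  hence "zeta_D s - zeta_D s * mangoldt_L s * (s - 1) = ((s - 1) * zeta_D s) * (1 / (s - 1) - mangoldt_L s)"
    by (simp add: field_simps)
  ultimately show ?thesis using zeta_D_nonzero[OF s] s1 by (simp add: zeta_entire_eq_zeta_D[OF s])
qed

section \<open>Exponential sums and the Laplace transform\<close>

text \<open>The two conditions dominate the terms by a summable family uniformly in t \<ge> 0;
  everything below rests on this one domination.\<close>

locale exponential_sum =
  fixes D :: "complex set" and c a :: "complex \<Rightarrow> complex"
  assumes c: "(\<lambda>\<rho>. norm (c \<rho>)) summable_on D" and a: "\<And>\<rho>. \<rho> \<in> D \<Longrightarrow> Re (a \<rho>) \<le> 0"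
begin

definition B :: "real \<Rightarrow> complex" where "B t = (\<Sum>\<^sub>\<infinity>\<rho>\<in>D. c \<rho> * exp (a \<rho> * of_real t))"
definition S where "S = infsum (\<lambda>\<rho>. norm (c \<rho>)) D"

lemma term_le: "norm (c \<rho> * exp (a \<rho> * of_real t)) \<le> norm (c \<rho>)" if "t \<ge> 0" "\<rho> \<in> D"
proof -
  have "Re (a \<rho>) * t \<le> 0" using a[OF that(2)] that(1) by (simp add: mult_nonpos_nonneg)
  thus ?thesis by (simp add: norm_mult mult_left_le)
qed

lemma abs_summable: "(\<lambda>\<rho>. norm (c \<rho> * exp (a \<rho> * of_real t))) summable_on A" if "t \<ge> 0" "A \<subseteq> D"
proof (rule summable_on_comparison_test)
  show "(\<lambda>\<rho>. norm (c \<rho>)) summable_on A" by (rule summable_on_subset_banach[OF c that(2)])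
  show "norm (c \<rho> * exp (a \<rho> * of_real t)) \<le> norm (c \<rho>)" if "\<rho> \<in> A" for \<rho> using term_le that \<open>t \<ge> 0\<close> \<open>A \<subseteq> D\<close> by blast
qed auto

lemma norm_infsum_le: "norm (\<Sum>\<^sub>\<infinity>\<rho>\<in>A. c \<rho> * exp (a \<rho> * of_real t)) \<le> infsum (\<lambda>\<rho>. norm (c \<rho>)) A" if "t \<ge> 0" "A \<subseteq> D"
proof -
  have "norm (\<Sum>\<^sub>\<infinity>\<rho>\<in>A. c \<rho> * exp (a \<rho> * of_real t)) \<le> (\<Sum>\<^sub>\<infinity>\<rho>\<in>A. norm (c \<rho> * exp (a \<rho> * of_real t)))"
    by (rule norm_infsum_bound[OF abs_summable[OF that]])
  also have "\<dots> \<le> infsum (\<lambda>\<rho>. norm (c \<rho>)) A"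
    by (rule infsum_mono[OF abs_summable[OF that] summable_on_subset_banach[OF c that(2)]]) (use term_le that in auto)
  finally show ?thesis .
qed

text \<open>The tail of the coefficients bounds the error independently of t, which yields both the
  continuity of \<open>B\<close> and the exchange of sum and integral.\<close>

lemma partial_sum_error:
  assumes "t \<ge> 0" "finite F" "F \<subseteq> D"
  shows "norm (B t - (\<Sum>\<rho>\<in>F. c \<rho> * exp (a \<rho> * of_real t))) \<le> S - (\<Sum>\<rho>\<in>F. norm (c \<rho>))"
proof -
  have s: "(\<lambda>\<rho>. c \<rho> * exp (a \<rho> * of_real t)) summable_on D" by (rule abs_summable_summable[OF abs_summable]) (use assms in auto)
  have "B t - (\<Sum>\<rho>\<in>F. c \<rho> * exp (a \<rho> * of_real t)) = (\<Sum>\<^sub>\<infinity>\<rho>\<in>D - F. c \<rho> * exp (a \<rho> * of_real t))"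
    unfolding B_def using infsum_Diff[OF s summable_on_finite[OF assms(2)] assms(3)] assms(2) by simp
  also have "norm \<dots> \<le> infsum (\<lambda>\<rho>. norm (c \<rho>)) (D - F)" by (rule norm_infsum_le) (use assms in auto)
  also have "\<dots> = S - (\<Sum>\<rho>\<in>F. norm (c \<rho>))"
    unfolding S_def using infsum_Diff[OF c summable_on_finite[OF assms(2)] assms(3)] assms(2) by simp
  finally show ?thesis .
qed

lemma error_tendsto_0: "((\<lambda>F. S - (\<Sum>\<rho>\<in>F. norm (c \<rho>))) \<longlongrightarrow> 0) (finite_subsets_at_top D)"
proof -
  have "((\<lambda>F. \<Sum>\<rho>\<in>F. norm (c \<rho>)) \<longlongrightarrow> S) (finite_subsets_at_top D)"
    using has_sum_infsum[OF c] by (simp add: has_sum_def S_def)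
  from tendsto_diff[OF tendsto_const[of S] this] show ?thesis by simp
qed

lemma norm_B_le: "t \<ge> 0 \<Longrightarrow> norm (B t) \<le> S"
  unfolding B_def S_def by (rule norm_infsum_le) auto

lemma continuous_B: "continuous_on {0..} B"
proof -
  have ul: "uniform_limit {0..} (\<lambda>F t. \<Sum>\<rho>\<in>F. c \<rho> * exp (a \<rho> * of_real t)) B (finite_subsets_at_top D)"
  proof (rule uniform_limitI)
    fix e :: real assume "e > 0"
    from order_tendstoD(2)[OF error_tendsto_0 this]
    have "eventually (\<lambda>F. S - (\<Sum>\<rho>\<in>F. norm (c \<rho>)) < e) (finite_subsets_at_top D)" .
    moreover have "eventually (\<lambda>F. finite F \<and> F \<subseteq> D) (finite_subsets_at_top D)"
      by (rule eventually_finite_subsets_at_top_weakI) auto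
    ultimately show "eventually (\<lambda>F. \<forall>t\<in>{0..}. dist (\<Sum>\<rho>\<in>F. c \<rho> * exp (a \<rho> * of_real t)) (B t) < e) (finite_subsets_at_top D)"
    proof eventually_elim
      case (elim F)
      thus ?case using partial_sum_error[of _ F] by (force simp: dist_norm norm_minus_commute)
    qed
  qed
  show ?thesis by (rule uniform_limit_theorem[OF _ ul]) (auto intro!: always_eventually continuous_intros)
qed

lemma B_measurable: "(\<lambda>t. indicator {0..} t *\<^sub>R B t) \<in> borel_measurable borel"
  by (rule borel_measurable_continuous_on_indicator[OF _ continuous_B]) auto

lemma term_integrable:
  assumes "integrable lborel (\<lambda>t. indicator {0..} t *\<^sub>R \<psi> t)" "\<rho> \<in> D"
  shows "integrable lborel (\<lambda>t. indicator {0..} t *\<^sub>R (exp (a \<rho> * of_real t) * \<psi> t))"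
proof (rule Bochner_Integration.integrable_bound[OF assms(1)])
  have "(\<lambda>t. exp (a \<rho> * of_real t) * (indicator {0..} t *\<^sub>R \<psi> t)) \<in> borel_measurable lborel"
    using assms(1) by (intro borel_measurable_times) (auto intro!: borel_measurable_continuous_onI continuous_intros)
  thus "(\<lambda>t. indicator {0..} t *\<^sub>R (exp (a \<rho> * of_real t) * \<psi> t)) \<in> borel_measurable lborel" by (simp add: mult_ac)
  show "AE t in lborel. norm (indicator {0..} t *\<^sub>R (exp (a \<rho> * of_real t) * \<psi> t)) \<le> norm (indicator {0..} t *\<^sub>R \<psi> t)"
    using a[OF assms(2)] by (intro AE_I2) (auto simp: indicator_def norm_mult intro!: mult_left_le_one_le mult_nonpos_nonneg)
qed

lemma B_integrable:
  assumes "integrable lborel (\<lambda>t. indicator {0..} t *\<^sub>R \<psi> t)"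
  shows "integrable lborel (\<lambda>t. indicator {0..} t *\<^sub>R (B t * \<psi> t))"
proof (rule Bochner_Integration.integrable_bound)
  show "integrable lborel (\<lambda>t. of_real S * (indicator {0..} t *\<^sub>R \<psi> t))" by (intro Bochner_Integration.integrable_mult_right assms)
  have "(\<lambda>t. (indicator {0..} t *\<^sub>R B t) * (indicator {0..} t *\<^sub>R \<psi> t)) \<in> borel_measurable lborel"
    using assms B_measurable by (intro borel_measurable_times) auto
  also have "(\<lambda>t. (indicator {0..} t *\<^sub>R B t) * (indicator {0..} t *\<^sub>R \<psi> t)) = (\<lambda>t. indicator {0..} t *\<^sub>R (B t * \<psi> t))"
    by (auto simp: fun_eq_iff indicator_def)
  finally show "(\<lambda>t. indicator {0..} t *\<^sub>R (B t * \<psi> t)) \<in> borel_measurable lborel" .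
  have "norm (B t) \<le> \<bar>S\<bar>" if "t \<ge> 0" for t using norm_B_le[OF that] by simp
  thus "AE t in lborel. norm (indicator {0..} t *\<^sub>R (B t * \<psi> t)) \<le> norm (of_real S * (indicator {0..} t *\<^sub>R \<psi> t))"
    by (intro AE_I2) (auto simp: indicator_def norm_mult intro!: mult_right_mono)
qed

text \<open>The index set carries no order, so the exchange is made on finite subsets: the uniform
  error times the L1 norm of \<psi> tends to 0 along their filter.\<close>

lemma integral_has_sum:
  assumes \<psi>: "integrable lborel (\<lambda>t. indicator {0..} t *\<^sub>R \<psi> t)"
  shows "((\<lambda>\<rho>. c \<rho> * (LINT t|lborel. indicator {0..} t *\<^sub>R (exp (a \<rho> * of_real t) * \<psi> t))) has_sum
    (LINT t|lborel. indicator {0..} t *\<^sub>R (B t * \<psi> t))) D"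
  unfolding has_sum_def
proof (rule Lim_transform2)
  define I where "I = (LINT t|lborel. norm (indicator {0..} t *\<^sub>R \<psi> t))"
  let ?J = "LINT t|lborel. indicator {0..} t *\<^sub>R (B t * \<psi> t)"
  let ?s = "\<lambda>F. \<Sum>\<rho>\<in>F. c \<rho> * (LINT t|lborel. indicator {0..} t *\<^sub>R (exp (a \<rho> * of_real t) * \<psi> t))"
  show "((\<lambda>_. ?J) \<longlongrightarrow> ?J) (finite_subsets_at_top D)" by simp
  show "((\<lambda>F. ?J - ?s F) \<longlongrightarrow> 0) (finite_subsets_at_top D)"
  proof (rule Lim_null_comparison)
    show "((\<lambda>F. (S - (\<Sum>\<rho>\<in>F. norm (c \<rho>))) * I) \<longlongrightarrow> 0) (finite_subsets_at_top D)"
      using tendsto_mult_left_zero[OF error_tendsto_0] .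
    show "eventually (\<lambda>F. norm (?J - ?s F) \<le> (S - (\<Sum>\<rho>\<in>F. norm (c \<rho>))) * I) (finite_subsets_at_top D)"
    proof (rule eventually_finite_subsets_at_top_weakI)
      fix F assume F: "finite F" "F \<subseteq> D"
      have "?s F = (\<Sum>\<rho>\<in>F. LINT t|lborel. c \<rho> * (indicator {0..} t *\<^sub>R (exp (a \<rho> * of_real t) * \<psi> t)))"
        by (intro sum.cong refl) (rule integral_mult_right_zero[symmetric])
      also have "\<dots> = (LINT t|lborel. (\<Sum>\<rho>\<in>F. c \<rho> * (indicator {0..} t *\<^sub>R (exp (a \<rho> * of_real t) * \<psi> t))))"
        by (intro Bochner_Integration.integral_sum[symmetric] Bochner_Integration.integrable_mult_right term_integrable \<psi>) (use F in auto)
      finally have "?J - ?s F = (LINT t|lborel. indicator {0..} t *\<^sub>R (B t * \<psi> t) - (\<Sum>\<rho>\<in>F. c \<rho> * (indicator {0..} t *\<^sub>R (exp (a \<rho> * of_real t) * \<psi> t))))"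
        using B_integrable[OF \<psi>] term_integrable[OF \<psi>] F
        by (subst Bochner_Integration.integral_diff) (auto intro!: Bochner_Integration.integrable_sum Bochner_Integration.integrable_mult_right simp del: mult_scaleR_right)
      also have "norm \<dots> \<le> (LINT t|lborel. (S - (\<Sum>\<rho>\<in>F. norm (c \<rho>))) * norm (indicator {0..} t *\<^sub>R \<psi> t))"
      proof (rule norm_integral_le)
        show "integrable lborel (\<lambda>t. indicator {0..} t *\<^sub>R (B t * \<psi> t) - (\<Sum>\<rho>\<in>F. c \<rho> * (indicator {0..} t *\<^sub>R (exp (a \<rho> * of_real t) * \<psi> t))))"
          using B_integrable[OF \<psi>] term_integrable[OF \<psi>] F
          by (auto intro!: Bochner_Integration.integrable_diff Bochner_Integration.integrable_sum Bochner_Integration.integrable_mult_right simp del: mult_scaleR_right)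
        show "integrable lborel (\<lambda>t. (S - (\<Sum>\<rho>\<in>F. norm (c \<rho>))) * norm (indicator {0..} t *\<^sub>R \<psi> t))"
          by (intro Bochner_Integration.integrable_mult_right integrable_norm \<psi>)
        fix t :: real
        show "norm (indicator {0..} t *\<^sub>R (B t * \<psi> t) - (\<Sum>\<rho>\<in>F. c \<rho> * (indicator {0..} t *\<^sub>R (exp (a \<rho> * of_real t) * \<psi> t)))) \<le> (S - (\<Sum>\<rho>\<in>F. norm (c \<rho>))) * norm (indicator {0..} t *\<^sub>R \<psi> t)"
        proof (cases "t \<ge> 0")
          case True
          have "indicator {0..} t *\<^sub>R (B t * \<psi> t) - (\<Sum>\<rho>\<in>F. c \<rho> * (indicator {0..} t *\<^sub>R (exp (a \<rho> * of_real t) * \<psi> t))) = (B t - (\<Sum>\<rho>\<in>F. c \<rho> * exp (a \<rho> * of_real t))) * \<psi> t"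
          proof -
            have "(\<Sum>\<rho>\<in>F. c \<rho> * (exp (a \<rho> * of_real t) * \<psi> t)) = (\<Sum>\<rho>\<in>F. c \<rho> * exp (a \<rho> * of_real t)) * \<psi> t"
              by (simp add: sum_distrib_right mult.assoc)
            thus ?thesis using True by (simp add: left_diff_distrib)
          qed
          also have "norm \<dots> \<le> (S - (\<Sum>\<rho>\<in>F. norm (c \<rho>))) * norm (\<psi> t)"
            unfolding norm_mult by (intro mult_right_mono partial_sum_error F True) auto
          finally show ?thesis using True by simp
        qed simp
      qed
      also have "\<dots> = (S - (\<Sum>\<rho>\<in>F. norm (c \<rho>))) * I" unfolding I_def by simp
      finally show "norm (?J - ?s F) \<le> (S - (\<Sum>\<rho>\<in>F. norm (c \<rho>))) * I" .
    qed
  qed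
qed

end

text \<open>
  Substituting \<open>x = exp (-t)\<close> turns \<open>g t * exp (- m * t)\<close> into a continuous function on \<open>{0..1}\<close> all of
  whose moments vanish.
\<close>

lemma lerch_real:
  fixes g :: "real \<Rightarrow> real"
  assumes cont: "continuous_on {0..} g" and lim: "((\<lambda>t. g t * exp (- real m * t)) \<longlongrightarrow> 0) at_top"
    and int: "\<And>n. n > m \<Longrightarrow> integrable lborel (\<lambda>t. indicator {0..} t * (g t * exp (- real n * t)))"
    and zero: "\<And>n. n > m \<Longrightarrow> (LINT t|lborel. indicator {0..} t * (g t * exp (- real n * t))) = 0"
    and t: "t \<ge> 0"
  shows "g t = 0"
proof -
  define G where "G t = g t * exp (- real m * t)" for t
  \<comment> \<open>The point x = 0 stands for t at infinity; the value 0 there is continuous by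
    \<open>lim\<close>.\<close>
  define h where "h x = (if x = 0 then 0 else G (- ln x))" for x
  have contG: "continuous_on {0..} G" unfolding G_def by (intro continuous_intros cont)
  have hG: "h (exp (- t)) = G t" for t by (simp add: h_def)
  have h_cont: "continuous_on {0..1} h"
  proof -
    have "continuous (at x within {0..1}) h" if x: "x \<in> {0..1}" for x
    proof (cases "x = 0")
      case True
      have "((\<lambda>x. G (- ln x)) \<longlongrightarrow> 0) (at_right 0)"
      proof -
        have "filterlim (\<lambda>x :: real. - ln x) at_top (at_right 0)" by real_asymp
        from filterlim_compose[OF lim this] show ?thesis by (simp add: G_def)
      qed
      hence "(h \<longlongrightarrow> 0) (at_right 0)"
        by (rule Lim_transform_eventually) (auto simp: h_def eventually_at_filter)
      moreover have "at 0 within {0..1} = at_right (0::real)" by (simp add: at_within_Icc_at_right)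
      ultimately show ?thesis using True by (simp add: continuous_within h_def)
    next
      case False
      have "continuous_on {0<..1} (\<lambda>x. G (- ln x))"
        by (rule continuous_on_compose2[OF contG]) (auto intro!: continuous_intros simp: ln_le_zero_iff)
      hence "continuous_on {0<..1} h" by (rule continuous_on_cong[THEN iffD1, rotated -1]) (auto simp: h_def)
      hence "continuous (at x within {0<..1}) h" using x False by (simp add: continuous_on_eq_continuous_within)
      moreover have "at x within {0<..1} = at x within {0..1}"
        using x False by (intro at_within_nhd[of x "{0<..}"]) auto
      ultimately show ?thesis by (simp add: continuous_within)
    qed
    thus ?thesis by (simp add: continuous_on_eq_continuous_within)
  qed
  define I where "I = (LINT t|lborel. \<bar>indicator {0..} t * (g t * exp (- real (Suc m) * t))\<bar>)"
  let ?q = "\<lambda>t. indicator {0..} t * ((G t)^2 * exp (- t))"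
  \<comment> \<open>One factor exp (- t) is set aside as the Jacobian of x = exp (- t), so the
    moment of order i belongs to the exponent m + 1 + i.\<close>
  have gn: "g t * exp (- real (Suc (m + i)) * t) = G t * exp (- t) * exp (- t) ^ i" for t i
    unfolding G_def mult.assoc exp_of_nat_mult[symmetric] exp_add[symmetric] by (rule arg_cong[of _ _ "\<lambda>x. g t * exp x"]) (simp add: algebra_simps)
  have i1: "integrable lborel (\<lambda>t. indicator {0..} t * (G t * exp (- t) * exp (- t) ^ i))"
    and i2: "(LINT t|lborel. indicator {0..} t * (G t * exp (- t) * exp (- t) ^ i)) = 0" for i
    using int[of "Suc (m + i)"] zero[of "Suc (m + i)"] unfolding gn by auto
  obtain M where M: "\<And>t. t \<ge> 0 \<Longrightarrow> \<bar>G t\<bar> \<le> M"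
  proof -
    have "bounded (h ` {0..1})" by (intro compact_imp_bounded compact_continuous_image h_cont) auto
    then obtain M where "\<forall>x\<in>{0..1}. \<bar>h x\<bar> \<le> M" by (auto simp: bounded_iff)
    hence M: "\<And>x. x \<in> {0..1} \<Longrightarrow> \<bar>h x\<bar> \<le> M" by blast
    have "\<bar>G t\<bar> \<le> M" if "t \<ge> 0" for t using M[of "exp (- t)"] that by (simp add: hG)
    thus ?thesis using that by blast
  qed
  have i0: "integrable lborel (\<lambda>t. indicator {0..} t * (G t * exp (- t)))" using i1[of 0] by simp
  have Gm: "(\<lambda>t. indicator {0..} t * G t) \<in> borel_measurable borel"
    using borel_measurable_continuous_on_indicator[OF _ contG] by simp
  have qi: "integrable lborel ?q"
  proof (rule Bochner_Integration.integrable_bound)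
    show "integrable lborel (\<lambda>t. M * (indicator {0..} t * (G t * exp (- t))))" by (intro Bochner_Integration.integrable_mult_right i0)
    have "(\<lambda>t. (indicator {0..} t * G t) * (indicator {0..} t * (G t * exp (- t)))) \<in> borel_measurable lborel"
      using borel_measurable_integrable[OF i0] unfolding measurable_lborel2 by (rule borel_measurable_times[OF Gm])
    also have "(\<lambda>t. (indicator {0..} t * G t) * (indicator {0..} t * (G t * exp (- t)))) = ?q"
      by (auto simp: fun_eq_iff indicator_def power2_eq_square)
    finally show "?q \<in> borel_measurable lborel" unfolding measurable_lborel2 .
    have "G t ^ 2 \<le> \<bar>M * G t\<bar>" if "t \<ge> 0" for t
    proof -
      have "\<bar>G t\<bar> * \<bar>G t\<bar> \<le> M * \<bar>G t\<bar>" by (intro mult_right_mono M that) auto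
      also have "\<dots> \<le> \<bar>M * G t\<bar>" by (simp add: abs_mult mult_right_mono)
      finally show ?thesis by (simp add: power2_eq_square)
    qed
    hence "G t ^ 2 * exp (- t) \<le> \<bar>M * G t\<bar> * exp (- t)" if "t \<ge> 0" for t using that by (intro mult_right_mono) auto
    thus "AE t in lborel. norm (?q t) \<le> norm (M * (indicator {0..} t * (G t * exp (- t))))"
      by (intro AE_I2) (auto simp: indicator_def abs_mult)
  qed
  \<comment> \<open>Any polynomial in exp (- t) integrates to 0 against
    \<open>G t * exp (- t)\<close>, so one factor \<open>G t\<close> of the square may be replaced
    by its distance from a Weierstrass approximation.\<close>
  have q_le: "integral\<^sup>L lborel ?q \<le> e * I" if e: "e > 0" for e
  proof -
    obtain p where p: "real_polynomial_function p" "\<And>x. x \<in> {0..1} \<Longrightarrow> \<bar>h x - p x\<bar> < e"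
      using Stone_Weierstrass_real_polynomial_function[OF compact_Icc h_cont e] by blast
    from real_polynomial_function_imp_sum[OF p(1)] obtain b N where pb: "p = (\<lambda>x. \<Sum>i\<le>N. b i * x ^ i)" by blast
    let ?r = "\<lambda>t. indicator {0..} t * (G t * exp (- t) * p (exp (- t)))"
    have r_eq: "?r = (\<lambda>t. \<Sum>i\<le>N. b i * (indicator {0..} t * (G t * exp (- t) * exp (- t) ^ i)))"
      by (simp add: pb fun_eq_iff sum_distrib_left mult_ac)
    have ri: "integrable lborel ?r" unfolding r_eq by (intro Bochner_Integration.integrable_sum Bochner_Integration.integrable_mult_right i1)
    have r0: "integral\<^sup>L lborel ?r = 0" unfolding r_eq
      by (subst Bochner_Integration.integral_sum) (auto intro!: Bochner_Integration.integrable_mult_right i1 simp: i2 simp del: power_Suc)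
    have "integral\<^sup>L lborel ?q = (LINT t|lborel. ?q t - ?r t)" using qi ri r0 by simp
    also have "\<dots> \<le> (LINT t|lborel. e * \<bar>indicator {0..} t * (g t * exp (- real (Suc m) * t))\<bar>)"
    proof (rule integral_mono)
      show "integrable lborel (\<lambda>t. ?q t - ?r t)" using qi ri by (rule Bochner_Integration.integrable_diff)
      show "integrable lborel (\<lambda>t. e * \<bar>indicator {0..} t * (g t * exp (- real (Suc m) * t))\<bar>)"
        by (intro Bochner_Integration.integrable_mult_right integrable_abs int) simp
      fix t :: real
      show "?q t - ?r t \<le> e * \<bar>indicator {0..} t * (g t * exp (- real (Suc m) * t))\<bar>"
      proof (cases "t \<ge> 0")
        case True
        have "?q t - ?r t = (G t * exp (- t)) * (h (exp (- t)) - p (exp (- t)))"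
          using True by (simp add: hG power2_eq_square algebra_simps)
        also have "\<dots> \<le> \<bar>G t * exp (- t)\<bar> * \<bar>h (exp (- t)) - p (exp (- t))\<bar>"
          unfolding abs_mult[symmetric] by (rule abs_ge_self)
        also have "\<dots> \<le> \<bar>G t * exp (- t)\<bar> * e"
          by (rule mult_left_mono[OF less_imp_le[OF p(2)]]) (use True in auto)
        also have "\<dots> = e * \<bar>indicator {0..} t * (g t * exp (- real (Suc m) * t))\<bar>"
          using gn[of t 0] True by (simp add: mult_ac)
        finally show ?thesis .
      qed simp
    qed
    finally show ?thesis unfolding I_def by simp
  qed
  have I0: "I \<ge> 0" unfolding I_def by (intro Bochner_Integration.integral_nonneg) auto
  have "integral\<^sup>L lborel ?q \<le> 0"
  proof (rule field_le_epsilon)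
    fix e :: real assume e: "e > 0"
    have "integral\<^sup>L lborel ?q \<le> e / (I + 1) * I" using I0 e by (intro q_le) auto
    also have "\<dots> \<le> e" using I0 e by (simp add: field_simps)
    finally show "integral\<^sup>L lborel ?q \<le> 0 + e" by simp
  qed
  \<comment> \<open>Restriction to a compact interval, where a nonnegative continuous function with
    integral 0 vanishes; \<open>t + 1\<close> keeps the interval nondegenerate for t = 0.\<close>
  let ?q1 = "\<lambda>s. indicator {0..t + 1} s *\<^sub>R ((G s)^2 * exp (- s))"
  have cq: "continuous_on {0..t+1} (\<lambda>s. (G s)^2 * exp (- s))"
    by (intro continuous_intros continuous_on_subset[OF contG]) auto
  have q1i: "integrable lborel ?q1" using borel_integrable_atLeastAtMost'[OF cq] by (simp add: set_integrable_def)
  have "integral\<^sup>L lborel ?q1 \<le> integral\<^sup>L lborel ?q"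
    by (rule integral_mono[OF q1i qi]) (auto simp: indicator_def)
  moreover have "integral\<^sup>L lborel ?q1 \<ge> 0" by (intro Bochner_Integration.integral_nonneg) auto
  ultimately have "integral\<^sup>L lborel ?q1 = 0" using \<open>integral\<^sup>L lborel ?q \<le> 0\<close> by linarith
  moreover have "integral\<^sup>L lborel ?q1 = integral {0..t+1} (\<lambda>s. (G s)^2 * exp (- s))"
    using set_borel_integral_eq_integral(2)[of "{0..t+1}" "\<lambda>s. (G s)^2 * exp (- s)"] q1i by (simp add: set_integrable_def set_lebesgue_integral_def)
  ultimately have "integral (cbox 0 (t+1)) (\<lambda>s. (G s)^2 * exp (- s)) = 0" by simp
  hence "\<forall>s\<in>cbox 0 (t+1). (G s)^2 * exp (- s) = 0"
    using t cq by (subst (asm) integral_cbox_eq_0_iff) auto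
  hence "G t = 0" using t by auto
  thus ?thesis by (simp add: G_def)
qed

lemma lerch:
  fixes g :: "real \<Rightarrow> complex"
  assumes cont: "continuous_on {0..} g" and lim: "((\<lambda>t. g t * of_real (exp (- real m * t))) \<longlongrightarrow> 0) at_top"
    and hb: "\<And>n. n > m \<Longrightarrow> has_bochner_integral lborel (\<lambda>t. indicator {0..} t *\<^sub>R (g t * of_real (exp (- real n * t)))) 0"
    and t: "t \<ge> 0"
  shows "g t = 0"
proof -
  have "Re (g t) = 0"
  proof (rule lerch_real[of "\<lambda>t. Re (g t)" m])
    show "((\<lambda>t. Re (g t) * exp (- real m * t)) \<longlongrightarrow> 0) at_top" using tendsto_Re[OF lim] by simp
    fix n assume "n > m"
    from has_bochner_integral_bounded_linear[OF bounded_linear_Re hb[OF this]]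
    show "integrable lborel (\<lambda>t. indicator {0..} t * (Re (g t) * exp (- real n * t)))" "(LINT t|lborel. indicator {0..} t * (Re (g t) * exp (- real n * t))) = 0"
      by (simp_all add: has_bochner_integral_iff)
  qed (use cont t in \<open>auto intro!: continuous_intros\<close>)
  moreover have "Im (g t) = 0"
  proof (rule lerch_real[of "\<lambda>t. Im (g t)" m])
    show "((\<lambda>t. Im (g t) * exp (- real m * t)) \<longlongrightarrow> 0) at_top" using tendsto_Im[OF lim] by simp
    fix n assume "n > m"
    from has_bochner_integral_bounded_linear[OF bounded_linear_Im hb[OF this]]
    show "integrable lborel (\<lambda>t. indicator {0..} t * (Im (g t) * exp (- real n * t)))" "(LINT t|lborel. indicator {0..} t * (Im (g t) * exp (- real n * t))) = 0"
      by (simp_all add: has_bochner_integral_iff)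
  qed (use cont t in \<open>auto intro!: continuous_intros\<close>)
  ultimately show ?thesis by (simp add: complex_eq_iff)
qed

section \<open>The Hadamard factorization of the zeta function\<close>

abbreviation "zeta_zeros \<equiv> {\<rho>. zeta_entire \<rho> = 0}"
abbreviation "zero_mult \<rho> \<equiv> nat (zorder zeta_entire \<rho>)"
abbreviation "zeta_support \<equiv> divisor_support riemann_zeta"

lemma zeta_entire_eventually_nonzero: "eventually (\<lambda>s. zeta_entire s \<noteq> 0) (at \<rho>)"
  using non_zero_neighbour_alt[OF zeta_entire_holomorphic[of UNIV] open_UNIV connected_UNIV UNIV_I UNIV_I, of 1 \<rho>] by (simp add: zeta_entire_1)

lemma zeta_entire_analytic: "zeta_entire analytic_on A"
  using zeta_entire_holomorphic[of UNIV] by (meson analytic_on_holomorphic open_UNIV subset_UNIV)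

lemma zorder_zeta_entire: "zorder zeta_entire \<rho> \<ge> 0" "zorder zeta_entire \<rho> = 0 \<longleftrightarrow> zeta_entire \<rho> \<noteq> 0"
proof -
  have fr: "frequently (\<lambda>s. zeta_entire s \<noteq> 0) (at \<rho>)"
    by (rule eventually_frequently[OF at_neq_bot zeta_entire_eventually_nonzero])
  show "zorder zeta_entire \<rho> \<ge> 0" by (rule zorder_ge_0[OF zeta_entire_analytic fr])
  show "zorder zeta_entire \<rho> = 0 \<longleftrightarrow> zeta_entire \<rho> \<noteq> 0" by (rule zorder_eq_0_iff[OF zeta_entire_analytic fr])
qed

lemma zorder_riemann_zeta_1: "zorder riemann_zeta 1 = - 1"
  by (rule zorder_eqI[OF open_UNIV UNIV_I zeta_entire_holomorphic]) (auto simp: zeta_entire_1 riemann_zeta_eq power_int_minus divide_inverse)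

lemma zorder_riemann_zeta: assumes "\<rho> \<noteq> 1" shows "zorder riemann_zeta \<rho> = zorder zeta_entire \<rho>"
proof -
  have an: "(\<lambda>s. 1 / (s - 1)) analytic_on {\<rho>}" using assms by (auto intro!: analytic_intros)
  have "eventually (\<lambda>s :: complex. s \<noteq> 1) (at \<rho>)"
    by (rule eventually_neq_at_within)
  hence "eventually (\<lambda>s. zeta_entire s * (1 / (s - 1)) \<noteq> 0) (at \<rho>)"
    using zeta_entire_eventually_nonzero[of \<rho>] by eventually_elim auto
  from zorder_times_analytic[OF zeta_entire_analytic an this]
  have "zorder (\<lambda>s. zeta_entire s * (1 / (s - 1))) \<rho> = zorder zeta_entire \<rho> + zorder (\<lambda>s. 1 / (s - 1)) \<rho>" .
  also have "zorder (\<lambda>s. 1 / (s - 1)) \<rho> = 0" by (rule zorder_eq_0I[OF an]) (use assms in auto)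
  finally show ?thesis by (simp add: riemann_zeta_eq)
qed

lemma zeta_support_eq: "zeta_support = insert 1 zeta_zeros" and one_notin_zeros: "1 \<notin> zeta_zeros"
proof -
  have "zorder riemann_zeta \<rho> \<noteq> 0 \<longleftrightarrow> \<rho> = 1 \<or> zeta_entire \<rho> = 0" for \<rho>
    using zorder_zeta_entire(2)[of \<rho>] zorder_riemann_zeta[of \<rho>] zorder_riemann_zeta_1 by (cases "\<rho> = 1") auto
  thus "zeta_support = insert 1 zeta_zeros" by (auto simp: divisor_support_def)
qed (simp add: zeta_entire_1)

lemma half_notin_support: "1/2 \<notin> zeta_support"
  using zeta_entire_nonzero_half by (simp add: zeta_support_eq)

lemma zorder_riemann_zeta_half: "zorder riemann_zeta (1/2) = 0"
  using half_notin_support by (simp add: divisor_support_def)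

lemma support_Re_le_1: "\<rho> \<in> zeta_support \<Longrightarrow> Re \<rho> \<le> 1"
  using zeta_entire_nonzero[of \<rho>] by (auto simp: zeta_support_eq not_le[symmetric])

lemma of_int_zorder: "\<rho> \<in> zeta_zeros \<Longrightarrow> of_int (zorder riemann_zeta \<rho>) = (of_nat (zero_mult \<rho>) :: complex)"
  using zorder_riemann_zeta[of \<rho>] zorder_zeta_entire(1)[of \<rho>] one_notin_zeros by (cases "\<rho> = 1") auto

lemma zeta_hadamard:
  shows zeros_summable: "(\<lambda>\<rho>. real (zero_mult \<rho>) / norm (\<rho> - 1/2) ^ 2) summable_on zeta_zeros"
    and zeros_log_derivative: "\<And>s. zeta_entire s \<noteq> 0 \<Longrightarrow> ((\<lambda>\<rho>. of_nat (zero_mult \<rho>) * (1 / (s - \<rho>) + 1 / (\<rho> - 1/2))) has_sum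
      (deriv zeta_entire s / zeta_entire s - deriv zeta_entire (1/2) / zeta_entire (1/2))) zeta_zeros"
    and zeros_product: "\<And>s. ((\<lambda>F. \<Prod>\<rho>\<in>F. weierstrass_factor 1 ((s - 1/2) / (\<rho> - 1/2)) ^ zero_mult \<rho>) \<longlongrightarrow>
      zeta_entire s / zeta_entire (1/2) * exp (- (s - 1/2) * (deriv zeta_entire (1/2) / zeta_entire (1/2)))) (finite_subsets_at_top zeta_zeros)"
proof -
  obtain C where C: "C > 0" "\<And>s. norm (zeta_entire s) \<le> norm (zeta_entire (1/2)) * exp (C * (1 + norm (s - 1/2)) powr (3/2))"
    using zeta_entire_growth by blast
  interpret entire_order_less_two zeta_entire "1/2" C
    using C zeta_entire_holomorphic zeta_entire_nonzero_half by unfold_locales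
  show "(\<lambda>\<rho>. real (zero_mult \<rho>) / norm (\<rho> - 1/2) ^ 2) summable_on zeta_zeros"
    using summable_inverse_square by (simp add: Z_def m_def)
  show "((\<lambda>\<rho>. of_nat (zero_mult \<rho>) * (1 / (s - \<rho>) + 1 / (\<rho> - 1/2))) has_sum
      (deriv zeta_entire s / zeta_entire s - deriv zeta_entire (1/2) / zeta_entire (1/2))) zeta_zeros" if "zeta_entire s \<noteq> 0" for s
    using hadamard_log_derivative[OF that] by (simp add: Z_def m_def)
  show "((\<lambda>F. \<Prod>\<rho>\<in>F. weierstrass_factor 1 ((s - 1/2) / (\<rho> - 1/2)) ^ zero_mult \<rho>) \<longlongrightarrow>
      zeta_entire s / zeta_entire (1/2) * exp (- (s - 1/2) * (deriv zeta_entire (1/2) / zeta_entire (1/2)))) (finite_subsets_at_top zeta_zeros)" for s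
    using hadamard_product[of s] unfolding Z_def m_def .
qed

section \<open>The constant and the factorization centred at 1/2\<close>

definition c0_value :: complex where
  "c0_value = of_real (- (ln pi / 2) - pi / 4 - euler_mascheroni / 2 - 3 / 2 * ln 2)"

lemma log_deriv_half_eq: "deriv zeta_entire (1/2) / zeta_entire (1/2) = - c0_value - 2"
  unfolding zeta_entire_log_deriv_half c0_value_def by simp

text \<open>The pole enters with multiplicity -1 and contributes - 1 / (s - 1) - 2. The first part
  cancels the polar term of the logarithmic derivative of \<open>zeta_entire\<close>, the second the
  summand - 2 at the centre.\<close>

lemma support_log_derivative:
  assumes s: "Re s > 1"
  shows "((\<lambda>\<rho>. of_int (zorder riemann_zeta \<rho>) * (1 / (s - \<rho>) + 1 / (\<rho> - 1/2))) has_sum (c0_value - mangoldt_L s)) zeta_support"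
proof -
  have "((\<lambda>\<rho>. of_nat (zero_mult \<rho>) * (1 / (s - \<rho>) + 1 / (\<rho> - 1/2))) has_sum (1 / (s - 1) - mangoldt_L s - (- c0_value - 2))) zeta_zeros"
    using zeros_log_derivative[OF zeta_entire_nonzero[OF s]] unfolding zeta_entire_log_deriv[OF s] log_deriv_half_eq .
  hence "((\<lambda>\<rho>. of_int (zorder riemann_zeta \<rho>) * (1 / (s - \<rho>) + 1 / (\<rho> - 1/2))) has_sum (1 / (s - 1) - mangoldt_L s - (- c0_value - 2))) zeta_zeros"
    by (rule has_sum_cong[THEN iffD1, rotated]) (simp add: of_int_zorder)
  from has_sum_insert[OF one_notin_zeros this]
  show ?thesis unfolding zeta_support_eq zorder_riemann_zeta_1 by (simp add: algebra_simps)
qed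

text \<open>Transfers the unordered product over the zeros to the index set enlarged by the
  pole.\<close>

lemma filterlim_remove_point:
  assumes "x \<notin> A"
  shows "filterlim (\<lambda>F. F - {x}) (finite_subsets_at_top A) (finite_subsets_at_top (insert x A))"
  unfolding filterlim_def le_filter_def eventually_filtermap
proof (intro allI impI)
  fix P assume "eventually P (finite_subsets_at_top A)"
  then obtain X where X: "finite X" "X \<subseteq> A" "\<And>Y. finite Y \<and> X \<subseteq> Y \<and> Y \<subseteq> A \<Longrightarrow> P Y"
    unfolding eventually_finite_subsets_at_top by metis
  show "eventually (\<lambda>F. P (F - {x})) (finite_subsets_at_top (insert x A))"
    unfolding eventually_finite_subsets_at_top
  proof (intro exI[of _ X] conjI allI impI)
    fix Y assume "finite Y \<and> X \<subseteq> Y \<and> Y \<subseteq> insert x A"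
    thus "P (Y - {x})" using X(2) assms by (intro X(3)) auto
  qed (use X in auto)
qed

text \<open>The factor of the pole is the inverse of \<open>E_1\<close> at 2 * w, that is of - 2 *
  (s - 1) * exp (2 * w). Its linear part turns \<open>zeta_entire\<close> into zeta up to a
  constant, and its exponential removes the 2 from the exponent, leaving \<open>c0_value\<close>
  alone.\<close>

lemma support_product:
  assumes s: "s \<noteq> 1"
  shows "((\<lambda>F. \<Prod>\<rho>\<in>F. weierstrass_factor 1 ((s - 1/2) / (\<rho> - 1/2)) powi zorder riemann_zeta \<rho>) \<longlongrightarrow>
     riemann_zeta s / (- 2 * zeta_entire (1/2)) * exp (c0_value * (s - 1/2))) (finite_subsets_at_top (zeta_support - {1/2}))"
proof -
  define w where "w = s - 1/2"
  let ?E = "\<lambda>\<rho>. weierstrass_factor 1 (w / (\<rho> - 1/2))"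
  define PZ where "PZ = zeta_entire s / zeta_entire (1/2) * exp (- w * (- c0_value - 2))"
  have Z: "((\<lambda>F. \<Prod>\<rho>\<in>F. ?E \<rho> ^ zero_mult \<rho>) \<longlongrightarrow> PZ) (finite_subsets_at_top zeta_zeros)"
    using zeros_product[of s] unfolding log_deriv_half_eq w_def PZ_def .
  have "((\<lambda>F. \<Prod>\<rho>\<in>F - {1}. ?E \<rho> ^ zero_mult \<rho>) \<longlongrightarrow> PZ) (finite_subsets_at_top zeta_support)"
    unfolding zeta_support_eq by (rule filterlim_compose[OF Z filterlim_remove_point[OF one_notin_zeros]])
  hence lim: "((\<lambda>F. ?E 1 powi (- 1) * (\<Prod>\<rho>\<in>F - {1}. ?E \<rho> ^ zero_mult \<rho>)) \<longlongrightarrow> ?E 1 powi (- 1) * PZ) (finite_subsets_at_top zeta_support)"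
    by (intro tendsto_intros)
  have ev: "eventually (\<lambda>F. ?E 1 powi (- 1) * (\<Prod>\<rho>\<in>F - {1}. ?E \<rho> ^ zero_mult \<rho>) = (\<Prod>\<rho>\<in>F. ?E \<rho> powi zorder riemann_zeta \<rho>)) (finite_subsets_at_top zeta_support)"
    unfolding eventually_finite_subsets_at_top
  proof (intro exI[of _ "{1}"] conjI allI impI)
    fix F assume F: "finite F \<and> {1} \<subseteq> F \<and> F \<subseteq> zeta_support"
    have "(\<Prod>\<rho>\<in>F. ?E \<rho> powi zorder riemann_zeta \<rho>) = ?E 1 powi zorder riemann_zeta 1 * (\<Prod>\<rho>\<in>F - {1}. ?E \<rho> powi zorder riemann_zeta \<rho>)"
      using F by (intro prod.remove) auto
    also have "(\<Prod>\<rho>\<in>F - {1}. ?E \<rho> powi zorder riemann_zeta \<rho>) = (\<Prod>\<rho>\<in>F - {1}. ?E \<rho> ^ zero_mult \<rho>)"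
    proof (rule prod.cong[OF refl])
      fix \<rho> assume "\<rho> \<in> F - {1}"
      hence "\<rho> \<noteq> 1" by auto
      have "zorder riemann_zeta \<rho> = int (zero_mult \<rho>)" using zorder_zeta_entire(1)[of \<rho>] zorder_riemann_zeta[OF \<open>\<rho> \<noteq> 1\<close>] by simp
      thus "?E \<rho> powi zorder riemann_zeta \<rho> = ?E \<rho> ^ zero_mult \<rho>" by (simp only: power_int_of_nat)
    qed
    finally show "?E 1 powi (- 1) * (\<Prod>\<rho>\<in>F - {1}. ?E \<rho> ^ zero_mult \<rho>) = (\<Prod>\<rho>\<in>F. ?E \<rho> powi zorder riemann_zeta \<rho>)"
      by (simp add: zorder_riemann_zeta_1)
  qed (auto simp: zeta_support_eq)
  have "?E 1 = (1 - 2 * w) * exp (2 * w)" unfolding weierstrass_factor_one by (simp add: mult.commute)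
  also have "1 - 2 * w = - 2 * (s - 1)" by (simp add: w_def)
  finally have E1: "?E 1 = - 2 * (s - 1) * exp (2 * w)" .
  have ex: "exp (- w * (- c0_value - 2)) = exp (c0_value * w) * exp (2 * w)" unfolding exp_add[symmetric]
    by (rule arg_cong[of _ _ exp]) (simp add: algebra_simps)
  have inv: "inverse (- 2 * (s - 1) * e) * (u / v * (x * e)) = u / (s - 1) / (- 2 * v) * x" if "e \<noteq> 0" for e u v x :: complex
  proof -
    have "inverse (- 2 * (s - 1) * e) * (u / v * (x * e)) = (u * x * e) / ((v * (- 2 * (s - 1))) * e)"
      by (simp only: divide_inverse inverse_mult_distrib mult_ac)
    also have "\<dots> = u * x / (v * (- 2 * (s - 1)))" by (rule nonzero_mult_divide_mult_cancel_right[OF that])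
    also have "\<dots> = u / (s - 1) / (- 2 * v) * x" by (simp only: divide_inverse inverse_mult_distrib mult_ac)
    finally show ?thesis .
  qed
  have p1: "?E 1 powi (- 1) = inverse (- 2 * (s - 1) * exp (2 * w))" unfolding E1 by (rule power_int_minus1_right)
  have rz: "riemann_zeta s = zeta_entire s / (s - 1)" by (simp add: riemann_zeta_eq)
  have "?E 1 powi (- 1) * PZ = inverse (- 2 * (s - 1) * exp (2 * w)) * (zeta_entire s / zeta_entire (1/2) * (exp (c0_value * w) * exp (2 * w)))"
    unfolding p1 PZ_def ex ..
  also have "\<dots> = riemann_zeta s / (- 2 * zeta_entire (1/2)) * exp (c0_value * w)"
    unfolding rz by (rule inv) (rule exp_not_eq_zero)
  finally have "?E 1 powi (- 1) * PZ = riemann_zeta s / (- 2 * zeta_entire (1/2)) * exp (c0_value * w)" .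
  moreover have "zeta_support - {1/2} = zeta_support" using half_notin_support by auto
  ultimately show ?thesis using lim tendsto_cong[OF ev] unfolding w_def by simp
qed

text \<open>The definite description needs uniqueness as well as existence. On Re s > 1 the product
  does not vanish, so any two admissible polynomials have equal exponentials there; comparing
  derivatives, since the polynomials themselves are fixed only up to multiples of 2 * pi * \<i>,
  determines the linear coefficient.\<close>

lemma c0_riemann_zeta: "c0 riemann_zeta (1/2) = c0_value"
proof -
  \<comment> \<open>The constant term is chosen so that \<open>exp (poly Q (1/2))\<close> is
    \<open>- 2 * zeta_entire (1/2)\<close>, the value of zeta at 1/2.\<close>
  define Q where "Q = [:Ln (- 2 * zeta_entire (1/2)) + c0_value / 2, - c0_value:]"
  have fh: "- 2 * zeta_entire (1/2) \<noteq> 0" using zeta_entire_nonzero_half by simp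
  let ?PD = "\<lambda>s. riemann_zeta s / (- 2 * zeta_entire (1/2)) * exp (c0_value * (s - 1/2))"
  have expQ: "exp (poly Q s) = - 2 * zeta_entire (1/2) * exp (- (c0_value * (s - 1/2)))" for s
  proof -
    have "poly Q s = Ln (- 2 * zeta_entire (1/2)) + - (c0_value * (s - 1/2))" by (simp add: Q_def algebra_simps)
    thus ?thesis using exp_Ln[OF fh] by (simp only: exp_add)
  qed
  have eqQ: "riemann_zeta s = exp (poly Q s) * ?PD s" for s
  proof -
    have "exp (- (c0_value * (s - 1/2))) * exp (c0_value * (s - 1/2)) = 1" by (simp flip: exp_add)
    thus ?thesis unfolding expQ using fh by (simp add: field_simps)
  qed
  have HQ: "hadamard_factorization riemann_zeta (1/2) Q"
    unfolding hadamard_factorization_def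
  proof (intro conjI allI impI)
    show "degree Q \<le> 1" by (simp add: Q_def)
    fix s assume "zorder riemann_zeta s \<ge> 0"
    hence s: "s \<noteq> 1" using zorder_riemann_zeta_1 by auto
    show "\<exists>P. ((\<lambda>F. \<Prod>\<rho>\<in>F. weierstrass_factor 1 ((s - 1/2) / (\<rho> - 1/2)) powi zorder riemann_zeta \<rho>) \<longlongrightarrow> P) (finite_subsets_at_top (zeta_support - {1/2})) \<and>
      riemann_zeta s = (s - 1/2) powi zorder riemann_zeta (1/2) * exp (poly Q s) * P"
      using support_product[OF s] eqQ[of s] zorder_riemann_zeta_half by (intro exI[of _ "?PD s"]) simp
  qed
  have uniq: "c = c0_value" if "hadamard_factorization riemann_zeta (1/2) R" "- pderiv R = [:c:]" for R c
  proof -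
    have R: "degree R \<le> 1" using that(1) by (simp add: hadamard_factorization_def)
    have eqR: "exp (poly R s) = exp (poly Q s)" if s: "Re s > 1" for s
    proof -
      have s1: "s \<noteq> 1" using s by auto
      hence "zorder riemann_zeta s \<ge> 0" using zorder_riemann_zeta zorder_zeta_entire by simp
      then obtain P where P: "((\<lambda>F. \<Prod>\<rho>\<in>F. weierstrass_factor 1 ((s - 1/2) / (\<rho> - 1/2)) powi zorder riemann_zeta \<rho>) \<longlongrightarrow> P) (finite_subsets_at_top (zeta_support - {1/2}))"
        "riemann_zeta s = exp (poly R s) * P"
        using \<open>hadamard_factorization riemann_zeta (1/2) R\<close> zorder_riemann_zeta_half unfolding hadamard_factorization_def by auto
      have "P = ?PD s" by (rule tendsto_unique[OF finite_subsets_at_top_neq_bot P(1) support_product[OF s1]])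
      hence "exp (poly R s) * ?PD s = exp (poly Q s) * ?PD s" using P(2) eqQ[of s] by simp
      moreover have "riemann_zeta s \<noteq> 0" using zeta_entire_nonzero[OF s] s1 by (simp add: riemann_zeta_eq)
      hence "?PD s \<noteq> 0" using fh by simp
      ultimately show ?thesis by simp
    qed
    have d: "((\<lambda>s. exp (poly S s)) has_field_derivative exp (poly S s) * poly (pderiv S) s) (at s)" for S :: "complex poly" and s
      by (rule DERIV_chain2[OF DERIV_exp poly_DERIV])
    have "eventually (\<lambda>s :: complex. Re s > 1) (nhds 2)"
      using eventually_nhds_in_open[OF open_halfspace_Re_gt[of 1], of 2] by simp
    hence ev: "eventually (\<lambda>s. exp (poly R s) = exp (poly Q s)) (nhds 2)" by eventually_elim (rule eqR)
    have "exp (poly R 2) * poly (pderiv R) 2 = exp (poly Q 2) * poly (pderiv Q) 2"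
      by (rule DERIV_unique[OF DERIV_cong_ev[OF refl ev refl, THEN iffD1, OF d] d])
    moreover have "exp (poly R 2) = exp (poly Q 2)" by (rule eqR) simp
    ultimately have "poly (pderiv R) 2 = poly (pderiv Q) 2" by simp
    hence "poly (- pderiv R) 2 = c0_value" by (simp add: Q_def pderiv_pCons)
    thus ?thesis unfolding that(2) by simp
  qed
  show ?thesis unfolding c0_def
  proof (rule the_equality)
    have "- pderiv Q = [:c0_value:]" by (simp add: Q_def pderiv_pCons)
    with HQ show "\<exists>Q. hadamard_factorization riemann_zeta (1/2) Q \<and> - pderiv Q = [:c0_value:]" by blast
  qed (use uniq in blast)
qed

section \<open>The primitive of the zero sum\<close>

definition prime_weight :: "nat \<Rightarrow> real" where "prime_weight n = mangoldt n * real n powr (- 1/2)"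

text \<open>The second primitive, zero for t \<le> 0, of the sum of Dirac masses of weight
  \<open>prime_weight n\<close> at ln n.\<close>

definition prime_sum :: "real \<Rightarrow> real" where "prime_sum t = (\<Sum>n. prime_weight n * max 0 (t - ln (real n)))"

lemma prime_weight_nonneg: "prime_weight n \<ge> 0"
  by (simp add: prime_weight_def mangoldt_nonneg)

lemma prime_weight_0: "prime_weight 0 = 0" by (simp add: prime_weight_def)

lemma prime_weight_le: assumes "n > 0" shows "prime_weight n \<le> ln (real n)"
proof -
  have "real n powr (- 1/2) \<le> real n powr 0" by (rule powr_mono) (use assms in auto)
  hence "prime_weight n \<le> mangoldt n * 1" unfolding prime_weight_def using assms by (intro mult_left_mono mangoldt_nonneg) auto
  also have "\<dots> \<le> ln (real n)" using mangoldt_le[OF assms] by simp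
  finally show ?thesis .
qed

text \<open>The cutoff depends only on \<open>T\<close>, so one finite sum represents
  \<open>prime_sum\<close> for all t \<le> T; continuity and the integrals against test functions
  supported in {-T..T} rely on this.\<close>

lemma prime_sum_finite:
  assumes "t \<le> T" "exp T \<le> real M"
  shows "prime_sum t = (\<Sum>n<M. prime_weight n * max 0 (t - ln (real n)))"
  unfolding prime_sum_def
proof (rule suminf_finite)
  fix n assume "n \<notin> {..<M}"
  hence "real M \<le> real n" by simp
  hence "exp T \<le> real n" using assms by linarith
  hence "T \<le> ln (real n)" by (metis exp_gt_zero exp_le_cancel_iff exp_ln order_less_le_trans)
  thus "prime_weight n * max 0 (t - ln (real n)) = 0" using assms by simp
qed simp

lemma exp_le_ceiling: "exp T \<le> real (nat \<lceil>exp T\<rceil>)" by (simp add: of_nat_nat)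

lemma continuous_prime_sum: "continuous_on A prime_sum"
proof -
  have "isCont prime_sum t" for t
  proof -
    define M where "M = nat \<lceil>exp (t + 1)\<rceil>"
    have "continuous_on {..<t + 1} (\<lambda>t. \<Sum>n<M. prime_weight n * max 0 (t - ln (real n)))" by (intro continuous_intros)
    hence "continuous_on {..<t + 1} prime_sum"
      by (rule continuous_on_cong[THEN iffD1, rotated -1]) (use prime_sum_finite[of _ "t + 1" M] exp_le_ceiling in \<open>auto simp: M_def\<close>)
    thus ?thesis by (simp add: continuous_on_eq_continuous_at)
  qed
  thus ?thesis by (simp add: continuous_at_imp_continuous_on)
qed

text \<open>Trivial counting: at most exp t + 1 indices, each contributing at most t * t. This is
  all the decay condition in \<open>lerch\<close> requires.\<close>

lemma prime_sum_bounds: assumes t: "t \<ge> 0" shows "0 \<le> prime_sum t" "prime_sum t \<le> (exp t + 1) * t^2"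
proof -
  define M where "M = nat \<lceil>exp t\<rceil>"
  have eq: "prime_sum t = (\<Sum>n<M. prime_weight n * max 0 (t - ln (real n)))"
    by (rule prime_sum_finite[of t t]) (auto simp: M_def exp_le_ceiling)
  show "0 \<le> prime_sum t" unfolding eq by (intro sum_nonneg mult_nonneg_nonneg prime_weight_nonneg) auto
  have "prime_sum t \<le> (\<Sum>n<M. t^2)" unfolding eq
  proof (rule sum_mono)
    fix n assume "n \<in> {..<M}"
    show "prime_weight n * max 0 (t - ln (real n)) \<le> t^2"
    proof (cases "n > 0 \<and> ln (real n) < t")
      case True
      hence "prime_weight n \<le> t" "max 0 (t - ln (real n)) \<le> t" using prime_weight_le[of n] by auto
      hence "prime_weight n * max 0 (t - ln (real n)) \<le> t * t" using t by (intro mult_mono) auto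
      thus ?thesis by (simp add: power2_eq_square)
    qed (auto simp: prime_weight_0 not_less)
  qed
  also have "\<dots> = real M * t^2" by simp
  also have "real M \<le> exp t + 1" unfolding M_def by (simp add: of_nat_nat)
  finally show "prime_sum t \<le> (exp t + 1) * t^2" by (simp add: mult_right_mono)
qed

lemma integral_ramp_exp:
  fixes z b :: real assumes z: "z > 0" and b: "b \<ge> 0"
  shows "has_bochner_integral lborel (\<lambda>t. indicator {0..} t * (max 0 (t - b) * exp (- z * t))) (exp (- z * b) / z^2)"
proof -
  let ?g = "\<lambda>t. indicator {0..} t * (t * exp (- z * t))"
  have hg: "integrable lborel ?g" "integral\<^sup>L lborel ?g = 1 / z^2" using integral_exp_decay(3,4)[OF z] by auto
  have eq: "indicator {0..} t * (max 0 (t - b) * exp (- z * t)) = exp (- z * b) * ?g (- b + 1 * t)" for t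
  proof -
    have "exp (- z * t) = exp (- z * b) * exp (- z * (t - b))" by (simp flip: exp_add add: algebra_simps)
    thus ?thesis using b by (auto simp: indicator_def max_def)
  qed
  have "integrable lborel (\<lambda>t. ?g (- b + 1 * t))" by (intro lborel_integrable_real_affine hg) auto
  moreover have "(LINT t|lborel. ?g (- b + 1 * t)) = 1 / z^2" using lborel_integral_real_affine[of 1 ?g "- b"] hg by simp
  ultimately have "has_bochner_integral lborel (\<lambda>t. ?g (- b + 1 * t)) (1 / z^2)" by (simp add: has_bochner_integral_iff)
  from has_bochner_integral_mult_right[OF this, of "exp (- z * b)"] show ?thesis unfolding eq by simp
qed

text \<open>Each ramp transforms into exp (- z * ln n) / z^2, and the factor n powr (-1/2) in the
  weight shifts the exponent to z + 1/2; z > 1/2 is thus the half-plane of absolute convergence. All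
  terms are nonnegative, so the absolute integrals are the integrals themselves.\<close>

lemma laplace_prime_sum:
  fixes z :: real assumes z: "z > 1/2"
  shows "has_bochner_integral lborel (\<lambda>t. indicator {0..} t *\<^sub>R (of_real (prime_sum t) * of_real (exp (- z * t)))) (mangoldt_L (of_real z + 1/2) / of_real (z^2))"
proof -
  have z0: "z > 0" using z by simp
  let ?f = "\<lambda>n t. prime_weight n * (indicator {0..} t * (max 0 (t - ln (real n)) * exp (- z * t)))"
  let ?v = "\<lambda>n. prime_weight n * (exp (- z * ln (real n)) / z^2)"
  have hb: "has_bochner_integral lborel (?f n) (?v n)" for n
  proof (cases "n = 0")
    case False
    thus ?thesis by (intro has_bochner_integral_mult_right integral_ramp_exp z0) auto
  qed (simp add: prime_weight_0 has_bochner_integral_zero)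
  have int: "integrable lborel (?f n)" for n using hb by (simp add: has_bochner_integral_iff)
  have f0: "?f n t \<ge> 0" for n t by (intro mult_nonneg_nonneg prime_weight_nonneg) auto
  have v: "complex_of_real (?v n) = mangoldt n * npow (of_real (z + 1/2)) n / of_real (z^2)" for n
  proof (cases "n = 0")
    case False
    hence "real n powr (- 1/2) * exp (- z * ln (real n)) = exp (- (z + 1/2) * ln (real n))"
      by (simp add: powr_def exp_add[symmetric] algebra_simps)
    hence "?v n = mangoldt n * exp (- (z + 1/2) * ln (real n)) / z^2" by (simp add: prime_weight_def)
    also have "complex_of_real \<dots> = of_real (mangoldt n) * of_real (exp (- (z + 1/2) * ln (real n))) / of_real (z^2)"
      by (simp only: of_real_mult of_real_divide)
    finally show ?thesis using False by (simp only: npow_of_real of_real_mangoldt neq0_conv)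
  qed (simp add: prime_weight_0)
  have sv: "(\<lambda>n. complex_of_real (?v n)) sums (mangoldt_L (of_real (z + 1/2)) / of_real (z^2))"
    unfolding v mangoldt_L_def by (intro sums_divide summable_sums summable_norm_cancel[OF summable_mangoldt_npow]) (use z in auto)
  hence "summable ?v" using summable_of_real_iff sums_summable by blast
  moreover have "(LINT t|lborel. norm (?f n t)) = ?v n" for n
  proof -
    have "(\<lambda>t. norm (?f n t)) = ?f n" using f0[of n] by (intro ext) (simp only: real_norm_def abs_of_nonneg)
    thus ?thesis using hb[of n] by (simp only: has_bochner_integral_iff)
  qed
  ultimately have sn: "summable (\<lambda>n. LINT t|lborel. norm (?f n t))" by (simp only:)
  have sums_f: "(\<lambda>n. ?f n t) sums (indicator {0..} t * (prime_sum t * exp (- z * t)))" for t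
  proof -
    have "(\<lambda>n. prime_weight n * max 0 (t - ln (real n))) sums prime_sum t"
      unfolding prime_sum_def
    proof (rule summable_sums, rule summable_finite[of "{..<nat \<lceil>exp t\<rceil>}"])
      fix n assume "n \<notin> {..<nat \<lceil>exp t\<rceil>}"
      hence "real (nat \<lceil>exp t\<rceil>) \<le> real n" by simp
      hence "exp t \<le> real n" using exp_le_ceiling[of t] by linarith
      hence "t \<le> ln (real n)" by (metis exp_gt_zero exp_le_cancel_iff exp_ln order_less_le_trans)
      thus "prime_weight n * max 0 (t - ln (real n)) = 0" by simp
    qed simp
    from sums_mult[OF this, of "indicator {0..} t * exp (- z * t)"] show ?thesis by (simp add: mult_ac)
  qed
  have ae: "AE t in lborel. summable (\<lambda>n. norm (?f n t))"
  proof (rule AE_I2)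
    fix t
    have "(\<lambda>n. norm (?f n t)) = (\<lambda>n. ?f n t)" using f0[of _ t] by (intro ext) (simp only: real_norm_def abs_of_nonneg)
    thus "summable (\<lambda>n. norm (?f n t))" using sums_summable[OF sums_f[of t]] by (simp only:)
  qed
  have suminf_f: "(\<Sum>n. ?f n t) = indicator {0..} t * (prime_sum t * exp (- z * t))" for t using sums_unique[OF sums_f[of t]] by simp
  have 1: "integrable lborel (\<lambda>t. indicator {0..} t * (prime_sum t * exp (- z * t)))"
    using integrable_suminf[OF int ae sn] unfolding suminf_f .
  have "(\<lambda>n. integral\<^sup>L lborel (?f n)) sums (LINT t|lborel. indicator {0..} t * (prime_sum t * exp (- z * t)))"
    using sums_integral[OF int ae sn] unfolding suminf_f .
  hence "?v sums (LINT t|lborel. indicator {0..} t * (prime_sum t * exp (- z * t)))" using hb by (simp add: has_bochner_integral_iff)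
  hence "(\<lambda>n. complex_of_real (?v n)) sums of_real (LINT t|lborel. indicator {0..} t * (prime_sum t * exp (- z * t)))" by (simp only: sums_of_real_iff)
  hence "complex_of_real (LINT t|lborel. indicator {0..} t * (prime_sum t * exp (- z * t))) = mangoldt_L (of_real (z + 1/2)) / of_real (z^2)"
    using sv sums_unique2 by blast
  hence "has_bochner_integral lborel (\<lambda>t. complex_of_real (indicator {0..} t * (prime_sum t * exp (- z * t)))) (mangoldt_L (of_real (z + 1/2)) / of_real (z^2))"
    using has_bochner_integral_of_real[OF has_bochner_integral_integrable[OF 1], where 'a = complex] by (simp only:)
  thus ?thesis by (simp add: scaleR_conv_of_real mult_ac)
qed

section \<open>The zero side\<close>

definition zeta_coeff :: "complex \<Rightarrow> complex" where "zeta_coeff \<rho> = of_int (zorder riemann_zeta \<rho>) / (\<rho> - 1/2)^2"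

lemma zeta_coeff_summable: "(\<lambda>\<rho>. norm (zeta_coeff \<rho>)) summable_on zeta_support"
proof -
  have "(\<lambda>\<rho>. norm (zeta_coeff \<rho>)) summable_on zeta_zeros"
    using zeros_summable
  proof (rule summable_on_cong[THEN iffD1, rotated])
    fix \<rho> assume "\<rho> \<in> zeta_zeros"
    thus "real (zero_mult \<rho>) / norm (\<rho> - 1/2) ^ 2 = norm (zeta_coeff \<rho>)"
      by (simp add: zeta_coeff_def of_int_zorder norm_divide norm_power)
  qed
  thus ?thesis unfolding zeta_support_eq by (simp add: summable_on_insert_iff)
qed

text \<open>
  The exponents \<open>\<rho> - 1/2\<close> of \<open>K2\<close> are only known to have real part at most \<open>1/2\<close> (the pole \<open>\<rho> = 1\<close>
  attains it); splitting off \<open>exp (t/2)\<close> makes the remaining sum bounded.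
\<close>

interpretation ZS: exponential_sum zeta_support zeta_coeff "\<lambda>\<rho>. \<rho> - 1"
  by unfold_locales (use zeta_coeff_summable support_Re_le_1 in auto)

lemma support_minus_half: "zeta_support - {1/2} = zeta_support" using half_notin_support by auto

lemma K2_eq: "t \<ge> 0 \<Longrightarrow> K2 riemann_zeta (1/2) t = of_real (exp (t / 2)) * ZS.B t"
proof -
  assume t: "t \<ge> 0"
  have "K2 riemann_zeta (1/2) t = (\<Sum>\<^sub>\<infinity>\<rho>\<in>zeta_support. zeta_coeff \<rho> * exp ((\<rho> - 1/2) * of_real t))"
    using t unfolding K2_def zorder_riemann_zeta_half support_minus_half by (simp add: zeta_coeff_def)
  also have "(\<lambda>\<rho>. zeta_coeff \<rho> * exp ((\<rho> - 1/2) * of_real t)) = (\<lambda>\<rho>. of_real (exp (t / 2)) * (zeta_coeff \<rho> * exp ((\<rho> - 1) * of_real t)))"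
  proof
    fix \<rho> :: complex
    have "exp ((\<rho> - 1/2) * of_real t) = exp (of_real (t / 2)) * exp ((\<rho> - 1) * of_real t)"
      unfolding exp_add[symmetric] by (rule arg_cong[of _ _ exp]) (simp add: field_simps)
    thus "zeta_coeff \<rho> * exp ((\<rho> - 1/2) * of_real t) = of_real (exp (t / 2)) * (zeta_coeff \<rho> * exp ((\<rho> - 1) * of_real t))"
      by (simp only: exp_of_real mult_ac)
  qed
  also have "infsum \<dots> zeta_support = of_real (exp (t / 2)) * ZS.B t" unfolding ZS.B_def by (rule infsum_cmult_right')
  finally show ?thesis .
qed

lemma K2_0: "K2 riemann_zeta (1/2) 0 = ZS.B 0" using K2_eq[of 0] by simp

lemma support_integral_exp:
  fixes n :: nat assumes \<rho>: "\<rho> \<in> zeta_support" and n: "n > 1"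
  shows "(LINT t|lborel. indicator {0..} t *\<^sub>R (exp ((\<rho> - 1) * of_real t) * exp (- (of_nat n - 1/2) * of_real t))) = 1 / (of_nat n - (\<rho> - 1/2))"
proof -
  have "exp ((\<rho> - 1) * of_real t) * exp (- (of_nat n - 1/2) * of_real t) = exp (- (of_nat n - (\<rho> - 1/2)) * of_real t)" for t
    unfolding exp_add[symmetric] by (rule arg_cong[of _ _ exp]) (simp add: field_simps)
  moreover have "Re (of_nat n - (\<rho> - 1/2)) > 0" using support_Re_le_1[OF \<rho>] n by simp
  ultimately show ?thesis using has_bochner_integral_exp_decay[of "of_nat n - (\<rho> - 1/2)"] by (simp add: has_bochner_integral_iff)
qed

text \<open>Integer points are all that \<open>lerch\<close> asks for. The condition n > 1 puts n +
  1/2 into the half-plane of absolute convergence and lets exp (- n * t) outweigh the factor exp (t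
  / 2).\<close>

lemma laplace_K2:
  fixes n :: nat assumes n: "n > 1"
  shows "has_bochner_integral lborel (\<lambda>t. indicator {0..} t *\<^sub>R ((of_real (exp (t / 2)) * ZS.B t - ZS.B 0) * of_real (exp (- real n * t))))
     ((c0_value - mangoldt_L (of_nat n + 1/2)) / of_nat n ^ 2)"
proof -
  let ?\<psi> = "\<lambda>t. exp (- (of_nat n - 1/2) * of_real t) :: complex"
  have \<psi>: "integrable lborel (\<lambda>t. indicator {0..} t *\<^sub>R ?\<psi> t)"
    using has_bochner_integral_exp_decay[of "of_nat n - 1/2"] n by (simp add: has_bochner_integral_iff)
  define J where "J = (LINT t|lborel. indicator {0..} t *\<^sub>R (ZS.B t * ?\<psi> t))"
  have iB: "has_bochner_integral lborel (\<lambda>t. indicator {0..} t *\<^sub>R (ZS.B t * ?\<psi> t)) J"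
    unfolding J_def by (rule has_bochner_integral_integrable[OF ZS.B_integrable[OF \<psi>]])
  have i0: "has_bochner_integral lborel (\<lambda>t. ZS.B 0 * (indicator {0..} t *\<^sub>R exp (- of_nat n * of_real t))) (ZS.B 0 * (1 / of_nat n))"
    by (rule has_bochner_integral_mult_right, rule has_bochner_integral_exp_decay) (use n in simp)
  have hs1: "((\<lambda>\<rho>. zeta_coeff \<rho> * (1 / (of_nat n - (\<rho> - 1/2)))) has_sum J) zeta_support"
    using ZS.integral_has_sum[OF \<psi>] unfolding J_def
    by (rule has_sum_cong[THEN iffD1, rotated]) (use support_integral_exp[OF _ n] in simp)
  have "ZS.B 0 = infsum zeta_coeff zeta_support" by (simp add: ZS.B_def)
  hence hs0: "((\<lambda>\<rho>. zeta_coeff \<rho> * (1 / of_nat n)) has_sum ZS.B 0 * (1 / of_nat n)) zeta_support"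
    using has_sum_infsum[OF abs_summable_summable[OF zeta_coeff_summable]] by (intro has_sum_cmult_left) simp
  hence hs0': "((\<lambda>\<rho>. - (zeta_coeff \<rho> * (1 / of_nat n))) has_sum - (ZS.B 0 * (1 / of_nat n))) zeta_support"
    by (simp only: has_sum_uminus minus_minus)
  define s where "s = complex_of_nat n + 1/2"
  have s: "Re s > 1" using n by (simp add: s_def)
  have "((\<lambda>\<rho>. 1 / of_nat n ^ 2 * (of_int (zorder riemann_zeta \<rho>) * (1 / (s - \<rho>) + 1 / (\<rho> - 1/2)))) has_sum 1 / of_nat n ^ 2 * (c0_value - mangoldt_L s)) zeta_support" (is "(?h has_sum ?x) _")
    by (intro has_sum_cmult_right support_log_derivative s)
  moreover have "((\<lambda>\<rho>. 1 / of_nat n ^ 2 * (of_int (zorder riemann_zeta \<rho>) * (1 / (s - \<rho>) + 1 / (\<rho> - 1/2)))) has_sum J + - (ZS.B 0 * (1 / of_nat n))) zeta_support"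
    using has_sum_add[OF hs1 hs0']
  proof (rule has_sum_cong[THEN iffD1, rotated])
    fix \<rho> assume \<rho>: "\<rho> \<in> zeta_support"
    define a where "a = \<rho> - 1/2"
    have "\<rho> \<noteq> 1/2" using half_notin_support \<rho> by blast
    hence "a \<noteq> 0" by (simp add: a_def)
    moreover have "Re (of_nat n - a) > 0" using support_Re_le_1[OF \<rho>] n by (simp add: a_def)
    hence "of_nat n - a \<noteq> 0" by auto
    moreover have "s - \<rho> = of_nat n - a" by (simp add: s_def a_def)
    moreover have "complex_of_nat n \<noteq> 0" using n by simp
    \<comment> \<open>With x = \<rho> - 1/2 and y = n this matches the transform of one term of
      \<open>K2\<close>, less its value at 0, with one term of the logarithmic derivative divided by
      n^2.\<close>
    moreover have "N / x^2 * (1 / (y - x)) - N / x^2 * (1 / y) = 1 / y^2 * (N * (1 / (y - x) + 1 / x))"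
      if "x \<noteq> 0" "y - x \<noteq> 0" "y \<noteq> 0" for x y N :: complex
      using that by (simp add: divide_simps power2_eq_square) (simp add: algebra_simps)
    ultimately show "zeta_coeff \<rho> * (1 / (of_nat n - (\<rho> - 1/2))) + - (zeta_coeff \<rho> * (1 / of_nat n)) = 1 / of_nat n ^ 2 * (of_int (zorder riemann_zeta \<rho>) * (1 / (s - \<rho>) + 1 / (\<rho> - 1/2)))"
      unfolding zeta_coeff_def a_def[symmetric] add_uminus_conv_diff by (simp only: not_False_eq_True)
  qed
  ultimately have val: "J - ZS.B 0 * (1 / of_nat n) = (c0_value - mangoldt_L s) / of_nat n ^ 2"
    using has_sum_unique[of ?h zeta_support ?x "J + - (ZS.B 0 * (1 / of_nat n))"] by simp
  have "(\<lambda>t. indicator {0..} t *\<^sub>R ((of_real (exp (t / 2)) * ZS.B t - ZS.B 0) * of_real (exp (- real n * t)))) =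
     (\<lambda>t. indicator {0..} t *\<^sub>R (ZS.B t * ?\<psi> t) - ZS.B 0 * (indicator {0..} t *\<^sub>R exp (- of_nat n * of_real t)))"
  proof
    fix t
    have e1: "of_real (exp (t / 2)) * of_real (exp (- real n * t)) = ?\<psi> t"
      unfolding exp_of_real[symmetric] exp_add[symmetric] by (rule arg_cong[of _ _ exp]) (simp add: field_simps)
    have e2: "exp (- of_nat n * of_real t) = complex_of_real (exp (- real n * t))" by (simp add: exp_of_real[symmetric])
    show "indicator {0..} t *\<^sub>R ((of_real (exp (t / 2)) * ZS.B t - ZS.B 0) * of_real (exp (- real n * t))) =
       indicator {0..} t *\<^sub>R (ZS.B t * ?\<psi> t) - ZS.B 0 * (indicator {0..} t *\<^sub>R exp (- of_nat n * of_real t))"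
      unfolding e1[symmetric] e2 by (simp add: scaleR_conv_of_real algebra_simps)
  qed
  with has_bochner_integral_diff[OF iB i0] val show ?thesis by (simp add: s_def)
qed

theorem K2_formula:
  assumes t: "t \<ge> 0"
  shows "K2 riemann_zeta (1/2) t - K2 riemann_zeta (1/2) 0 = c0_value * of_real t - of_real (prime_sum t)"
proof -
  define g where "g t = (of_real (exp (t / 2)) * ZS.B t - ZS.B 0) - c0_value * of_real t + of_real (prime_sum t)" for t
  have "g t = 0"
  \<comment> \<open>The factor exp (- 3 * t) outweighs every part of \<open>g\<close>, the largest
    bound being (exp t + 1) * t^2 for the prime sum.\<close>
  proof (rule lerch[of g 3])
    show "continuous_on {0..} g" unfolding g_def by (intro continuous_intros ZS.continuous_B continuous_prime_sum) auto
    show "((\<lambda>t. g t * of_real (exp (- real 3 * t))) \<longlongrightarrow> 0) at_top"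
    proof (rule Lim_null_comparison)
      let ?b = "\<lambda>t. ZS.S * (exp (t / 2) * exp (- 3 * t)) + norm (ZS.B 0) * exp (- 3 * t) + norm c0_value * (t * exp (- 3 * t)) + (exp t + 1) * t^2 * exp (- 3 * t)"
      show "eventually (\<lambda>t. norm (g t * of_real (exp (- real 3 * t))) \<le> ?b t) at_top"
        using eventually_ge_at_top[of 0]
      proof eventually_elim
        case (elim t)
        have "norm (g t) \<le> norm (of_real (exp (t / 2)) * ZS.B t) + norm (ZS.B 0) + norm (c0_value * of_real t) + norm (complex_of_real (prime_sum t))"
          unfolding g_def by (intro order_trans[OF norm_triangle_ineq] add_right_mono order_trans[OF norm_triangle_ineq4] order_refl)
        also have "\<dots> \<le> ZS.S * exp (t / 2) + norm (ZS.B 0) + norm c0_value * t + (exp t + 1) * t^2"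
          using ZS.norm_B_le[OF elim] prime_sum_bounds[OF elim] elim by (intro add_mono) (auto simp: norm_mult)
        finally have "norm (g t) * exp (- 3 * t) \<le> (ZS.S * exp (t / 2) + norm (ZS.B 0) + norm c0_value * t + (exp t + 1) * t^2) * exp (- 3 * t)"
          by (intro mult_right_mono) auto
        thus ?case by (simp add: norm_mult algebra_simps)
      qed
      have "((\<lambda>t :: real. exp (t / 2) * exp (- 3 * t)) \<longlongrightarrow> 0) at_top" "((\<lambda>t :: real. exp (- 3 * t)) \<longlongrightarrow> 0) at_top"
        "((\<lambda>t :: real. t * exp (- 3 * t)) \<longlongrightarrow> 0) at_top" "((\<lambda>t :: real. (exp t + 1) * t^2 * exp (- 3 * t)) \<longlongrightarrow> 0) at_top"
        by real_asymp+
      hence "(?b \<longlongrightarrow> ZS.S * 0 + norm (ZS.B 0) * 0 + norm c0_value * 0 + 0) at_top"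
        by (intro tendsto_add tendsto_mult tendsto_const)
      thus "(?b \<longlongrightarrow> 0) at_top" by simp
    qed
    fix n :: nat assume "n > 3"
    hence n: "n > 1" "real n > 1/2" by auto
    have l1: "has_bochner_integral lborel (\<lambda>t. c0_value * of_real (indicator {0..} t * (max 0 (t - 0) * exp (- real n * t)))) (c0_value * of_real (exp (- real n * 0) / real n ^ 2))"
      by (intro has_bochner_integral_mult_right has_bochner_integral_of_real integral_ramp_exp) (use n in auto)
    note l2 = laplace_prime_sum[OF n(2)]
    have "has_bochner_integral lborel (\<lambda>t. indicator {0..} t *\<^sub>R ((of_real (exp (t / 2)) * ZS.B t - ZS.B 0) * of_real (exp (- real n * t)))
       - c0_value * of_real (indicator {0..} t * (max 0 (t - 0) * exp (- real n * t))) + indicator {0..} t *\<^sub>R (of_real (prime_sum t) * of_real (exp (- real n * t))))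
       ((c0_value - mangoldt_L (of_nat n + 1/2)) / of_nat n ^ 2 - c0_value * of_real (exp (- real n * 0) / real n ^ 2) + mangoldt_L (of_real (real n) + 1/2) / of_real (real n ^ 2))" (is "has_bochner_integral _ ?F ?V")
      by (intro has_bochner_integral_add has_bochner_integral_diff laplace_K2 l1 l2 n)
    moreover have "?V = 0" by (simp add: diff_divide_distrib)
    moreover have "?F = (\<lambda>t. indicator {0..} t *\<^sub>R (g t * of_real (exp (- real n * t))))"
      by (auto simp: fun_eq_iff g_def indicator_def algebra_simps)
    ultimately show "has_bochner_integral lborel (\<lambda>t. indicator {0..} t *\<^sub>R (g t * of_real (exp (- real n * t)))) 0" by simp
  qed (rule t)
  thus ?thesis using K2_eq[OF t] K2_0 by (simp add: g_def algebra_simps)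
qed

section \<open>Test functions\<close>

lemma iter_deriv_0 [simp]: "iter_deriv 0 \<phi> = \<phi>" by (simp add: iter_deriv_def)

lemma iter_deriv_Suc: "iter_deriv (Suc n) \<phi> = (\<lambda>t. vector_derivative (iter_deriv n \<phi>) (at t))"
  by (simp add: iter_deriv_def)

lemma iter_deriv_2: "iter_deriv 2 \<phi> = (\<lambda>t. vector_derivative (\<lambda>t. vector_derivative \<phi> (at t)) (at t))"
  by (simp add: numeral_2_eq_2 iter_deriv_Suc)

lemma iter_deriv_has_vector_derivative:
  "test_function \<phi> \<Longrightarrow> (iter_deriv n \<phi> has_vector_derivative iter_deriv (Suc n) \<phi> t) (at t)"
  unfolding iter_deriv_Suc test_function_def using vector_derivative_works by blast

lemma continuous_iter_deriv: "test_function \<phi> \<Longrightarrow> continuous_on A (iter_deriv n \<phi>)"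
  using iter_deriv_has_vector_derivative has_vector_derivative_continuous continuous_at_imp_continuous_on by metis

lemma iter_deriv_outside_supp: "t \<notin> supp \<phi> \<Longrightarrow> iter_deriv n \<phi> t = 0"
proof (induction n arbitrary: t)
  case 0
  thus ?case using closure_subset[of "{t. \<phi> t \<noteq> 0}"] by (auto simp: supp_def)
next
  case (Suc n)
  have op: "open (- supp \<phi>)" by (simp add: supp_def open_Compl)
  have d: "((\<lambda>_ :: real. 0 :: complex) has_vector_derivative 0) (at t)" by simp
  have "(iter_deriv n \<phi> has_vector_derivative 0) (at t)"
    by (rule has_vector_derivative_transform_within_open[OF d op]) (use Suc in auto)
  thus ?case unfolding iter_deriv_Suc by (rule vector_derivative_at)
qed

lemma test_function_bounded_support:
  assumes "test_function \<phi>" obtains R where "R > 0" "supp \<phi> \<subseteq> {-R..R}"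
proof -
  have "bounded (supp \<phi>)" using assms by (simp add: test_function_def compact_imp_bounded)
  then obtain R where "R > 0" "\<forall>x\<in>supp \<phi>. norm x \<le> R" using bounded_pos by blast
  thus ?thesis by (intro that[of R]) (auto simp: abs_le_iff)
qed

text \<open>The real supremum is meaningful only for a bounded range, which compact support
  provides.\<close>

lemma norm_test_function_le_SUP: assumes "test_function \<phi>" shows "norm (\<phi> t) \<le> (SUP t. norm (\<phi> t))"
proof (rule cSUP_upper[OF UNIV_I])
  have "compact (\<phi> ` supp \<phi>)"
    using continuous_iter_deriv[OF assms, of "supp \<phi>" 0] assms by (intro compact_continuous_image) (auto simp: test_function_def)
  then obtain B where B: "\<And>t. t \<in> supp \<phi> \<Longrightarrow> norm (\<phi> t) \<le> B" using compact_imp_bounded by (force simp: bounded_iff)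
  have "norm (\<phi> t) \<le> max 0 B" for t
    using B[of t] iter_deriv_outside_supp[of t \<phi> 0] by (cases "t \<in> supp \<phi>") auto
  thus "bdd_above (range (\<lambda>t. norm (\<phi> t)))" by (intro bdd_aboveI) auto
qed

text \<open>Exhibiting a candidate family of derivatives settles smoothness and the values of
  \<open>iter_deriv\<close> together, so closure properties reduce to differentiation rules.\<close>

lemma test_function_if_derivs:
  assumes "\<And>n t. (f n has_vector_derivative f (Suc n) t) (at t)" "f 0 = \<phi>" "supp \<phi> \<subseteq> K" "compact K"
  shows "test_function \<phi>" "iter_deriv n \<phi> = f n"
proof -
  have eq: "iter_deriv n \<phi> = f n" for n
    by (induction n) (use assms(1,2) in \<open>auto simp: iter_deriv_Suc intro!: vector_derivative_at\<close>)
  show "iter_deriv n \<phi> = f n" by (rule eq)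
  have "compact (supp \<phi>)" using closed_Int_compact[of "supp \<phi>" K] assms(3,4) by (simp add: supp_def Int_absorb2)
  thus "test_function \<phi>" unfolding test_function_def eq
    using assms(1) has_vector_derivative_def differentiable_def by blast
qed

lemma test_function_add:
  assumes "test_function \<phi>" "test_function \<psi>"
  shows "test_function (\<lambda>t. \<phi> t + \<psi> t)" "supp (\<lambda>t. \<phi> t + \<psi> t) \<subseteq> supp \<phi> \<union> supp \<psi>"
proof -
  show s: "supp (\<lambda>t. \<phi> t + \<psi> t) \<subseteq> supp \<phi> \<union> supp \<psi>"
    unfolding supp_def closure_Un[symmetric] by (intro closure_mono) auto
  show "test_function (\<lambda>t. \<phi> t + \<psi> t)"
    by (rule test_function_if_derivs(1)[of "\<lambda>n t. iter_deriv n \<phi> t + iter_deriv n \<psi> t", OF _ _ s])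
       (use assms in \<open>auto intro!: has_vector_derivative_add iter_deriv_has_vector_derivative simp: test_function_def\<close>)
qed

lemma test_function_cmult:
  assumes "test_function \<phi>"
  shows "test_function (\<lambda>t. a * \<phi> t)" "supp (\<lambda>t. a * \<phi> t) \<subseteq> supp \<phi>"
proof -
  show s: "supp (\<lambda>t. a * \<phi> t) \<subseteq> supp \<phi>" unfolding supp_def by (intro closure_mono) auto
  show "test_function (\<lambda>t. a * \<phi> t)"
    by (rule test_function_if_derivs(1)[of "\<lambda>n t. a * iter_deriv n \<phi> t", OF _ _ s])
       (use assms in \<open>auto intro!: has_vector_derivative_mult_right iter_deriv_has_vector_derivative simp: test_function_def\<close>)
qed

lemma test_function_reflect:
  assumes "test_function \<phi>"
  shows "test_function (\<lambda>t. \<phi> (- t))" "iter_deriv n (\<lambda>t. \<phi> (- t)) t = (- 1) ^ n * iter_deriv n \<phi> (- t)"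
    "supp (\<lambda>t. \<phi> (- t)) \<subseteq> uminus ` supp \<phi>"
proof -
  have c: "compact (uminus ` supp \<phi>)"
    using assms by (intro compact_continuous_image continuous_intros) (auto simp: test_function_def)
  show s: "supp (\<lambda>t. \<phi> (- t)) \<subseteq> uminus ` supp \<phi>" unfolding supp_def[of "\<lambda>t. \<phi> (- t)"]
  proof (rule closure_minimal[OF _ compact_imp_closed[OF c]])
    show "{t. \<phi> (- t) \<noteq> 0} \<subseteq> uminus ` supp \<phi>"
      using iter_deriv_outside_supp[of _ \<phi> 0] by (force simp: image_iff intro: bexI[of _ "- _"])
  qed
  have d: "((\<lambda>t. (- 1) ^ n * iter_deriv n \<phi> (- t)) has_vector_derivative (- 1) ^ Suc n * iter_deriv (Suc n) \<phi> (- t)) (at t)" for n t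
  proof -
    have "((iter_deriv n \<phi> \<circ> uminus) has_vector_derivative (- 1) *\<^sub>R iter_deriv (Suc n) \<phi> (- t)) (at t)"
      by (intro vector_diff_chain_at iter_deriv_has_vector_derivative assms) (auto intro!: derivative_eq_intros)
    from has_vector_derivative_mult_right[OF this, of "(- 1) ^ n"] show ?thesis by (simp add: o_def)
  qed
  note * = test_function_if_derivs[of "\<lambda>n t. (- 1) ^ n * iter_deriv n \<phi> (- t)" "\<lambda>t. \<phi> (- t)", OF d _ s c]
  show "test_function (\<lambda>t. \<phi> (- t))" by (rule *(1)) simp
  show "iter_deriv n (\<lambda>t. \<phi> (- t)) t = (- 1) ^ n * iter_deriv n \<phi> (- t)" using *(2)[of n] by simp
qed

lemma has_bochner_integral_FTC_half_line:
  fixes F f :: "real \<Rightarrow> complex"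
  assumes F: "\<And>t. (F has_vector_derivative f t) (at t)" and f: "continuous_on UNIV f"
    and zero: "\<And>t. t > R \<Longrightarrow> F t = 0" "\<And>t. t > R \<Longrightarrow> f t = 0"
  shows "has_bochner_integral lborel (\<lambda>t. indicator {a..} t *\<^sub>R f t) (- F a)"
proof -
  define T where "T = max a R + 1"
  have "has_bochner_integral lborel (\<lambda>t. indicator {a..T} t *\<^sub>R f t) (F T - F a)"
    by (rule has_bochner_integral_FTC_Icc)
       (use F f in \<open>auto simp: T_def intro: has_vector_derivative_at_within continuous_on_subset\<close>)
  moreover have "indicator {a..T} t *\<^sub>R f t = indicator {a..} t *\<^sub>R f t" for t
    using zero(2)[of t] by (cases "t > R") (auto simp: indicator_def T_def)
  moreover have "F T = 0" by (rule zero) (simp add: T_def)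
  ultimately show ?thesis by simp
qed

section \<open>The explicit formula\<close>

definition cramer_kernel :: "real \<Rightarrow> complex" where
  "cramer_kernel t = (K2 riemann_zeta (1/2) t - K2 riemann_zeta (1/2) 0) * indicator {0..} t"

definition symmetric_cramer :: functional where
  "symmetric_cramer = (\<lambda>\<phi>. distr_mult (\<lambda>t. of_real (exp (- t / 2))) (W riemann_zeta (1/2)) \<phi> +
     distr_mult (\<lambda>t. of_real (exp (t / 2))) (distr_reflect (W riemann_zeta (1/2))) \<phi>)"

text \<open>The weight exp (- t / 2) cancels the factor exp (t / 2) built into \<open>W\<close>; in
  the second summand the weight exp (t / 2) becomes exp (- t / 2) on reflection and cancels
  likewise. The two signs from the distributional derivatives cancel as well.\<close>

lemma symmetric_cramer_eq:
  shows "symmetric_cramer \<phi> = (LINT t|lborel. cramer_kernel t * iter_deriv 2 \<phi> t) +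
    (LINT t|lborel. cramer_kernel t * iter_deriv 2 (\<lambda>t. \<phi> (- t)) t)"
proof -
  have cancel: "exp (1 / 2 * of_real t) * (complex_of_real (exp (- t / 2)) * z) = z" for t z
  proof -
    have "exp (1 / 2 * of_real t) * complex_of_real (exp (- t / 2)) = 1"
      unfolding exp_of_real[symmetric] exp_add[symmetric] by simp
    thus ?thesis by (simp only: mult.assoc[symmetric] mult_1_left)
  qed
  show ?thesis
    unfolding symmetric_cramer_def W_def distr_mult_def distr_reflect_def distr_deriv_def function_distr_def iter_deriv_2 cramer_kernel_def
    by (simp only: cancel minus_minus)
qed

text \<open>The second derivative of a ramp starting at a is the Dirac mass at a. The primitive (t -
  a) * \<phi>' - \<phi> performs both integrations by parts at once.\<close>

lemma ramp_second_derivative: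
  assumes \<phi>: "test_function \<phi>" and a: "a \<ge> 0"
  shows "has_bochner_integral lborel (\<lambda>t. of_real (indicator {0..} t * max 0 (t - a)) * iter_deriv 2 \<phi> t) (\<phi> a)"
proof -
  obtain R where R: "R > 0" "supp \<phi> \<subseteq> {-R..R}" using test_function_bounded_support[OF \<phi>] .
  have zero: "iter_deriv n \<phi> t = 0" if "t > R" for n t using iter_deriv_outside_supp[of t \<phi> n] R that by force
  let ?F = "\<lambda>t. of_real (t - a) * iter_deriv 1 \<phi> t - iter_deriv 0 \<phi> t"
  have "has_bochner_integral lborel (\<lambda>t. indicator {a..} t *\<^sub>R (of_real (t - a) * iter_deriv 2 \<phi> t)) (- ?F a)"
  proof (rule has_bochner_integral_FTC_half_line[where R = R and F = ?F])
    show "(?F has_vector_derivative of_real (t - a) * iter_deriv 2 \<phi> t) (at t)" for t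
    proof -
      have "((\<lambda>t. complex_of_real (t - a)) has_vector_derivative of_real 1) (at t)"
        by (intro has_vector_derivative_of_real) (auto intro!: derivative_eq_intros)
      from has_vector_derivative_diff[OF has_vector_derivative_mult[OF this iter_deriv_has_vector_derivative[OF \<phi>, of 1]] iter_deriv_has_vector_derivative[OF \<phi>, of 0]]
      show ?thesis by (simp add: numeral_2_eq_2)
    qed
    show "continuous_on UNIV (\<lambda>t. of_real (t - a) * iter_deriv 2 \<phi> t)" by (intro continuous_intros continuous_iter_deriv \<phi>)
  qed (simp_all add: zero del: iter_deriv_0)
  moreover have "indicator {a..} t *\<^sub>R (of_real (t - a) * iter_deriv 2 \<phi> t) = of_real (indicator {0..} t * max 0 (t - a)) * iter_deriv 2 \<phi> t" for t
    using a by (auto simp: indicator_def max_def)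
  ultimately show ?thesis by simp
qed

text \<open>By \<open>K2_formula\<close> the kernel is a finite combination of ramps on {0..T}. For
  t < 0 every term vanishes, and beyond T the second derivative of \<phi> does.\<close>

lemma cramer_kernel_integral:
  assumes \<phi>: "test_function \<phi>" and T: "supp \<phi> \<subseteq> {-T..T}" and M: "exp T < real M"
  shows "has_bochner_integral lborel (\<lambda>t. cramer_kernel t * iter_deriv 2 \<phi> t)
    (c0_value * \<phi> 0 - (\<Sum>n<M. of_real (prime_weight n) * \<phi> (ln (real n))))"
proof -
  let ?r = "\<lambda>a t. of_real (indicator {0..} t * max 0 (t - a)) * iter_deriv 2 \<phi> t"
  have r: "has_bochner_integral lborel (\<lambda>t. of_real (prime_weight n) * ?r (ln (real n)) t) (of_real (prime_weight n) * \<phi> (ln (real n)))" for n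
  proof (cases "n = 0")
    case False
    thus ?thesis by (intro has_bochner_integral_mult_right ramp_second_derivative \<phi>) auto
  qed (simp add: prime_weight_0 has_bochner_integral_zero)
  have "has_bochner_integral lborel (\<lambda>t. c0_value * ?r 0 t - (\<Sum>n<M. of_real (prime_weight n) * ?r (ln (real n)) t))
    (c0_value * \<phi> 0 - (\<Sum>n<M. of_real (prime_weight n) * \<phi> (ln (real n))))"
    by (intro has_bochner_integral_diff has_bochner_integral_sum has_bochner_integral_mult_right[OF ramp_second_derivative[OF \<phi>]] r) auto
  moreover have "c0_value * ?r 0 t - (\<Sum>n<M. of_real (prime_weight n) * ?r (ln (real n)) t) = cramer_kernel t * iter_deriv 2 \<phi> t" for t
  proof (cases "t \<in> {0..T}")
    case True
    have "(\<Sum>n<M. of_real (prime_weight n) * ?r (ln (real n)) t) = of_real (prime_sum t) * iter_deriv 2 \<phi> t"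
      using True prime_sum_finite[of t T M] M by (simp add: sum_distrib_right mult.assoc)
    moreover have "cramer_kernel t = c0_value * of_real t - of_real (prime_sum t)" using True K2_formula[of t] by (simp add: cramer_kernel_def)
    ultimately show ?thesis using True by (simp only: left_diff_distrib) simp
  next
    case False
    hence "t < 0 \<or> t \<notin> supp \<phi>" using T by auto
    hence "t < 0 \<or> iter_deriv 2 \<phi> t = 0" using iter_deriv_outside_supp[of t \<phi> 2] by blast
    thus ?thesis by (auto simp: cramer_kernel_def)
  qed
  ultimately show ?thesis by simp
qed

text \<open>The finite form to which both sides of the formula reduce on test functions supported in
  {-T..T} once exp T < M.\<close>

definition explicit_sum :: "nat \<Rightarrow> functional" where
  "explicit_sum M \<phi> = 2 * c0_value * \<phi> 0 - (\<Sum>n<M. of_real (prime_weight n) * (\<phi> (ln (real n)) + \<phi> (- ln (real n))))"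

lemma symmetric_cramer_explicit:
  assumes \<phi>: "test_function \<phi>" and T: "supp \<phi> \<subseteq> {-T..T}" and M: "exp T < real M"
  shows "symmetric_cramer \<phi> = explicit_sum M \<phi>"
proof -
  have "supp (\<lambda>t. \<phi> (- t)) \<subseteq> uminus ` {-T..T}" using test_function_reflect(3)[OF \<phi>] T by blast
  hence "supp (\<lambda>t. \<phi> (- t)) \<subseteq> {-T..T}" by simp
  from cramer_kernel_integral[OF \<phi> T M] cramer_kernel_integral[OF test_function_reflect(1)[OF \<phi>] this M]
  show ?thesis unfolding symmetric_cramer_eq explicit_sum_def
    by (simp add: has_bochner_integral_iff sum.distrib distrib_left algebra_simps)
qed

text \<open>Distinct pairs (p, k) give distinct powers, so the double sum is a sum over prime powers
  n. It may be extended to all n < M because the von Mangoldt function vanishes elsewhere, and for n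
  \<ge> M the points ln n and - ln n lie outside the support of \<phi>.\<close>

lemma prime_power_sum_explicit:
  assumes \<phi>: "test_function \<phi>" and T: "supp \<phi> \<subseteq> {-T..T}" and M: "exp T < real M"
  shows "2 * c0_value * dirac 0 \<phi> - (\<Sum>\<^sub>\<infinity>(p, k)\<in>{p :: nat. prime p} \<times> {k :: nat. k \<ge> 1}.
     of_real (ln (real p) * real p powr (- real k / 2)) *
       (dirac (real k * ln (real p)) \<phi> + dirac (- (real k * ln (real p))) \<phi>)) = explicit_sum M \<phi>"
proof -
  let ?P = "{p :: nat. prime p} \<times> {k :: nat. k \<ge> 1}"
  let ?g = "\<lambda>n. of_real (prime_weight n) * (\<phi> (ln (real n)) + \<phi> (- ln (real n)))"
  have inj: "inj_on (\<lambda>(p, k). p ^ k) ?P"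
  proof (rule inj_onI)
    fix x y assume "x \<in> ?P" "y \<in> ?P" and eq: "(\<lambda>(p, k). p ^ k) x = (\<lambda>(p, k). p ^ k) y"
    then obtain p k q l :: nat where "x = (p, k)" "y = (q, l)" "prime p" "prime q" "k > 0" "l > 0"
      by (cases x, cases y) auto
    thus "x = y" using eq prime_power_inj''[of p q k l] by simp
  qed
  have "(\<Sum>\<^sub>\<infinity>(p, k)\<in>?P. of_real (ln (real p) * real p powr (- real k / 2)) *
       (dirac (real k * ln (real p)) \<phi> + dirac (- (real k * ln (real p))) \<phi>)) = infsum (?g \<circ> (\<lambda>(p, k). p ^ k)) ?P"
  proof (rule infsum_cong)
    fix x assume "x \<in> ?P"
    then obtain p k :: nat where x: "x = (p, k)" and p: "prime p" and k: "k \<ge> 1" by auto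
    have p0: "real p > 0" using p prime_gt_0_nat by simp
    have "real p powr (- real k / 2) = real (p ^ k) powr (- 1 / 2)"
      using p0 by (simp add: powr_powr flip: powr_realpow)
    moreover have "mangoldt (p ^ k) = ln (real p)" using p k by simp
    moreover have "ln (real (p ^ k)) = real k * ln (real p)" using p0 by (simp add: ln_realpow)
    ultimately show "(case x of (p, k) \<Rightarrow> of_real (ln (real p) * real p powr (- real k / 2)) *
       (dirac (real k * ln (real p)) \<phi> + dirac (- (real k * ln (real p))) \<phi>)) = (?g \<circ> (\<lambda>(p, k). p ^ k)) x"
      unfolding x prime_weight_def dirac_def o_def prod.case by simp
  qed
  also have "\<dots> = infsum ?g ((\<lambda>(p, k). p ^ k) ` ?P)" by (rule infsum_reindex[OF inj, symmetric])
  also have "\<dots> = infsum ?g {..<M}"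
  proof (rule infsum_cong_neutral)
    fix n assume "n \<in> {..<M} - (\<lambda>(p, k). p ^ k) ` ?P"
    hence "\<not> primepow n" unfolding primepow_def by (auto simp: image_iff Suc_le_eq)
    thus "?g n = 0" by (simp add: prime_weight_def mangoldt_def)
  next
    fix n assume "n \<in> (\<lambda>(p, k). p ^ k) ` ?P - {..<M}"
    hence n: "M \<le> n" by auto
    show "?g n = 0"
    proof -
      have "exp T < real n" using M n by (meson less_le_trans of_nat_le_iff)
      hence "T < ln (real n)" by (metis exp_gt_zero exp_less_cancel_iff exp_ln order_less_trans)
      hence "ln (real n) \<notin> supp \<phi>" "- ln (real n) \<notin> supp \<phi>" using T by auto
      hence "\<phi> (ln (real n)) = 0" "\<phi> (- ln (real n)) = 0"
        using iter_deriv_outside_supp[of _ \<phi> 0] by simp_all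
      thus ?thesis by simp
    qed
  qed simp
  also have "\<dots> = (\<Sum>n<M. ?g n)" by simp
  finally show ?thesis by (simp only: explicit_sum_def dirac_def)
qed

text \<open>One argument serves both sides of the formula. On a fixed compact set the functional is
  a finite combination of point evaluations, hence linear and bounded by the supremum norm alone, a
  distribution of order 0.\<close>

lemma is_distribution_if_explicit_sum:
  assumes S: "\<And>T M \<phi>. test_function \<phi> \<Longrightarrow> supp \<phi> \<subseteq> {-T..T} \<Longrightarrow> exp T < real M \<Longrightarrow> S \<phi> = explicit_sum M \<phi>"
  shows "is_distribution S"
  unfolding is_distribution_def
proof (intro conjI allI impI)
  fix \<phi> \<psi> assume \<phi>: "test_function \<phi>" and \<psi>: "test_function \<psi>"
  obtain R R' where "supp \<phi> \<subseteq> {-R..R}" "supp \<psi> \<subseteq> {-R'..R'}"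
    using test_function_bounded_support[OF \<phi>] test_function_bounded_support[OF \<psi>] by metis
  \<comment> \<open>A common support bound makes the same \<open>M\<close> valid for \<phi>, \<psi>
    and their sum.\<close>
  moreover define T where "T = max R R'"
  ultimately have T: "supp \<phi> \<subseteq> {-T..T}" "supp \<psi> \<subseteq> {-T..T}" by fastforce+
  obtain M :: nat where M: "exp T < real M" using reals_Archimedean2 by blast
  have "S (\<lambda>t. \<phi> t + \<psi> t) = explicit_sum M (\<lambda>t. \<phi> t + \<psi> t)"
    by (rule S[OF _ _ M]) (use test_function_add[OF \<phi> \<psi>] T in auto)
  also have "\<dots> = explicit_sum M \<phi> + explicit_sum M \<psi>"
    by (simp add: explicit_sum_def algebra_simps sum.distrib)
  finally show "S (\<lambda>t. \<phi> t + \<psi> t) = S \<phi> + S \<psi>" using S[OF \<phi> T(1) M] S[OF \<psi> T(2) M] by simp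
next
  fix a :: complex and \<phi> assume \<phi>: "test_function \<phi>"
  obtain T where T: "supp \<phi> \<subseteq> {-T..T}" using test_function_bounded_support[OF \<phi>] by metis
  obtain M :: nat where M: "exp T < real M" using reals_Archimedean2 by blast
  have "S (\<lambda>t. a * \<phi> t) = explicit_sum M (\<lambda>t. a * \<phi> t)"
    by (rule S[OF _ _ M]) (use test_function_cmult[OF \<phi>] T in auto)
  also have "\<dots> = a * explicit_sum M \<phi>"
    by (simp add: explicit_sum_def algebra_simps sum_distrib_left)
  finally show "S (\<lambda>t. a * \<phi> t) = a * S \<phi>" using S[OF \<phi> T M] by simp
next
  fix K :: "real set" assume "compact K"
  then obtain T where "\<forall>x\<in>K. norm x \<le> T" using compact_imp_bounded bounded_iff by blast
  hence T: "K \<subseteq> {-T..T}" by (auto simp: abs_le_iff)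
  obtain M :: nat where M: "exp T < real M" using reals_Archimedean2 by blast
  define C where "C = 2 * norm c0_value + (\<Sum>n<M. prime_weight n * 2)"
  show "\<exists>C N. \<forall>\<phi>. test_function \<phi> \<longrightarrow> supp \<phi> \<subseteq> K \<longrightarrow> norm (S \<phi>) \<le> C * (\<Sum>j\<le>N. SUP t. norm (iter_deriv j \<phi> t))"
  proof (intro exI[of _ C] exI[of _ 0] allI impI)
    fix \<phi> assume \<phi>: "test_function \<phi>" and K: "supp \<phi> \<subseteq> K"
    define B where "B = (SUP t. norm (\<phi> t))"
    have B: "norm (\<phi> t) \<le> B" for t unfolding B_def by (rule norm_test_function_le_SUP[OF \<phi>])
    have "norm (S \<phi>) = norm (explicit_sum M \<phi>)" using S[OF \<phi> _ M] K T by simp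
    also have "\<dots> \<le> norm (2 * c0_value * \<phi> 0) + (\<Sum>n<M. norm (of_real (prime_weight n) * (\<phi> (ln (real n)) + \<phi> (- ln (real n)))))"
      unfolding explicit_sum_def by (intro order_trans[OF norm_triangle_ineq4] add_left_mono norm_sum)
    also have "\<dots> \<le> 2 * norm c0_value * B + (\<Sum>n<M. prime_weight n * (B + B))"
    proof (intro add_mono sum_mono)
      show "norm (2 * c0_value * \<phi> 0) \<le> 2 * norm c0_value * B" unfolding norm_mult by (intro mult_mono B) auto
      fix n
      show "norm (of_real (prime_weight n) * (\<phi> (ln (real n)) + \<phi> (- ln (real n)))) \<le> prime_weight n * (B + B)"
        unfolding norm_mult using prime_weight_nonneg[of n] by (intro mult_mono norm_triangle_le add_mono B) auto
    qed
    also have "\<dots> = C * B" by (simp add: C_def sum_distrib_left sum_distrib_right algebra_simps flip: mult_2)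
    finally show "norm (S \<phi>) \<le> C * (\<Sum>j\<le>0. SUP t. norm (iter_deriv j \<phi> t))" by (simp add: B_def)
  qed
qed

section \<open>The formal sum over zeros and pole away from 0\<close>

lemma integral_exp_second_derivative:
  fixes a :: complex
  assumes \<phi>: "test_function \<phi>" and zero: "\<phi> 0 = 0" "iter_deriv 1 \<phi> 0 = 0" and a: "a \<noteq> 0"
  shows "integrable lborel (\<lambda>t. indicator {0..} t *\<^sub>R (exp (a * of_real t) * iter_deriv 2 \<phi> t))"
    and "has_bochner_integral lborel (\<lambda>t. indicator {0..} t *\<^sub>R (exp (a * of_real t) * \<phi> t))
     ((LINT t|lborel. indicator {0..} t *\<^sub>R (exp (a * of_real t) * iter_deriv 2 \<phi> t)) / a^2)"
proof -
  obtain R where R: "R > 0" "supp \<phi> \<subseteq> {-R..R}" using test_function_bounded_support[OF \<phi>] .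
  have z: "iter_deriv n \<phi> t = 0" if "t > R" for n t
  proof -
    have "t \<notin> supp \<phi>" using R that by auto
    thus ?thesis by (rule iter_deriv_outside_supp)
  qed
  have e: "((\<lambda>t. exp (a * of_real t)) has_vector_derivative a * exp (a * of_real t)) (at t)" for t
    by (rule has_vector_derivative_real_field[where f = "\<lambda>z. exp (a * z)" and f' = "a * exp (a * of_real t)"])
       (auto intro!: derivative_eq_intros)
  have i: "has_bochner_integral lborel (\<lambda>t. indicator {0..} t *\<^sub>R (exp (a * of_real t) * iter_deriv (Suc n) \<phi> t + a * exp (a * of_real t) * iter_deriv n \<phi> t)) (- (exp (a * of_real 0) * iter_deriv n \<phi> 0))" for n
  proof (rule has_bochner_integral_FTC_half_line[where R = R and F = "\<lambda>t. exp (a * of_real t) * iter_deriv n \<phi> t"])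
    show "((\<lambda>t. exp (a * of_real t) * iter_deriv n \<phi> t) has_vector_derivative exp (a * of_real t) * iter_deriv (Suc n) \<phi> t + a * exp (a * of_real t) * iter_deriv n \<phi> t) (at t)" for t
      by (rule has_vector_derivative_mult[OF e iter_deriv_has_vector_derivative[OF \<phi>]])
    show "continuous_on UNIV (\<lambda>t. exp (a * of_real t) * iter_deriv (Suc n) \<phi> t + a * exp (a * of_real t) * iter_deriv n \<phi> t)"
      by (intro continuous_intros continuous_iter_deriv \<phi>)
  qed (use z in auto)
  have int: "integrable lborel (\<lambda>t. indicator {0..} t *\<^sub>R (exp (a * of_real t) * iter_deriv n \<phi> t))" for n
  proof -
    have "integrable lborel (\<lambda>t. indicator {0..R} t *\<^sub>R (exp (a * of_real t) * iter_deriv n \<phi> t))"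
      by (intro borel_integrable_compact continuous_intros continuous_iter_deriv \<phi>) auto
    moreover have "indicator {0..R} t *\<^sub>R (exp (a * of_real t) * iter_deriv n \<phi> t) = indicator {0..} t *\<^sub>R (exp (a * of_real t) * iter_deriv n \<phi> t)" for t
      using z[of t n] by (cases "t > R") (auto simp: indicator_def)
    ultimately show ?thesis by simp
  qed
  show "integrable lborel (\<lambda>t. indicator {0..} t *\<^sub>R (exp (a * of_real t) * iter_deriv 2 \<phi> t))" by (rule int)
  define I where "I n = (LINT t|lborel. indicator {0..} t *\<^sub>R (exp (a * of_real t) * iter_deriv n \<phi> t))" for n
  have rec: "I (Suc n) + a * I n = - iter_deriv n \<phi> 0" for n
  proof -
    have "I (Suc n) + a * I n = (LINT t|lborel. indicator {0..} t *\<^sub>R (exp (a * of_real t) * iter_deriv (Suc n) \<phi> t) + a * (indicator {0..} t *\<^sub>R (exp (a * of_real t) * iter_deriv n \<phi> t)))"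
      unfolding I_def integral_mult_right_zero[symmetric]
      by (rule Bochner_Integration.integral_add[symmetric]) (intro int Bochner_Integration.integrable_mult_right)+
    also have "\<dots> = - iter_deriv n \<phi> 0"
      using i[of n] by (simp add: has_bochner_integral_iff scaleR_add_right mult.assoc)
    finally show ?thesis .
  qed
  \<comment> \<open>The boundary terms at 0 vanish with \<phi> and its derivative; two integrations
    by parts then produce the denominator a^2 found in \<open>zeta_coeff\<close>.\<close>
  have "I 1 = - a * I 0" "I 2 = - a * I 1"
    using rec[of 0] rec[of 1] zero by (simp_all add: numeral_2_eq_2 add_eq_0_iff2)
  hence "I 0 = I 2 / a^2" using a by (simp add: power2_eq_square)
  thus "has_bochner_integral lborel (\<lambda>t. indicator {0..} t *\<^sub>R (exp (a * of_real t) * \<phi> t))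
     ((LINT t|lborel. indicator {0..} t *\<^sub>R (exp (a * of_real t) * iter_deriv 2 \<phi> t)) / a^2)"
    using int[of 0] by (simp add: has_bochner_integral_iff I_def)
qed

text \<open>This gives the formal expression for the left side a meaning. Tested away from 0, where
  exp (a * |t|) has its kink, each term gains a factor 1 / (\<rho> - 1/2)^2 by integrating by parts
  twice, and the series becomes the unconditionally convergent one that defines
  \<open>K2\<close>.\<close>

lemma has_sum_zeros:
  assumes \<phi>: "test_function \<phi>" and 0: "0 \<notin> supp \<phi>"
  shows "((\<lambda>\<rho>. of_int (zorder riemann_zeta \<rho>) * function_distr (\<lambda>t. exp ((\<rho> - 1/2) * of_real \<bar>t\<bar>)) \<phi>)
     has_sum symmetric_cramer \<phi>) zeta_support"
proof -
  define \<phi>' where "\<phi>' = (\<lambda>t. \<phi> (- t))"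
  have \<phi>': "test_function \<phi>'" unfolding \<phi>'_def by (rule test_function_reflect(1)[OF \<phi>])
  have z: "iter_deriv n \<phi> 0 = 0" for n by (rule iter_deriv_outside_supp[OF 0])
  have z': "iter_deriv n \<phi>' 0 = 0" for n unfolding \<phi>'_def test_function_reflect(2)[OF \<phi>] by (simp add: z)
  have z0: "\<phi> 0 = 0" "\<phi>' 0 = 0" using z[of 0] z'[of 0] by simp_all
  \<comment> \<open>Both half-lines are folded onto t \<ge> 0; the factor exp (t / 2) moves the
    exponent from \<rho> - 1, as in \<open>ZS.B\<close>, back to \<rho> - 1/2.\<close>
  define \<psi> where "\<psi> t = of_real (exp (t / 2)) * (iter_deriv 2 \<phi> t + iter_deriv 2 \<phi>' t)" for t
  define E where "E a f = (\<lambda>t. indicator {0..} t *\<^sub>R (exp (a * of_real t) * f t))" for a :: complex and f :: "real \<Rightarrow> complex"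
  note I = integral_exp_second_derivative[OF \<phi> z0(1) z, folded E_def] integral_exp_second_derivative[OF \<phi>' z0(2) z', folded E_def]
  have pair: "function_distr (\<lambda>t. exp (a * of_real \<bar>t\<bar>)) \<phi> = (integral\<^sup>L lborel (E a (iter_deriv 2 \<phi>)) + integral\<^sup>L lborel (E a (iter_deriv 2 \<phi>'))) / a^2"
    if a: "a \<noteq> 0" for a
  proof -
    have "has_bochner_integral lborel (\<lambda>t. E a \<phi>' (0 + (- 1) * t)) (integral\<^sup>L lborel (E a (iter_deriv 2 \<phi>')) / a^2)"
      using lborel_integrable_real_affine[of "E a \<phi>'" "- 1" 0] lborel_integral_real_affine[of "- 1" "E a \<phi>'" 0] I(4)[OF a]
      by (simp add: has_bochner_integral_iff)
    from has_bochner_integral_add[OF I(2)[OF a] this]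
    have "(LINT t|lborel. E a \<phi> t + E a \<phi>' (0 + (- 1) * t)) = integral\<^sup>L lborel (E a (iter_deriv 2 \<phi>)) / a^2 + integral\<^sup>L lborel (E a (iter_deriv 2 \<phi>')) / a^2"
      by (simp only: has_bochner_integral_iff)
    \<comment> \<open>The two half-lines overlap at 0, where both functions vanish.\<close>
    moreover have "E a \<phi> t + E a \<phi>' (0 + (- 1) * t) = exp (a * of_real \<bar>t\<bar>) * \<phi> t" for t
      using z0 by (cases t "0 :: real" rule: linorder_cases) (auto simp: E_def \<phi>'_def)
    ultimately show ?thesis by (simp add: function_distr_def add_divide_distrib)
  qed
  have E_\<psi>: "indicator {0..} t *\<^sub>R (exp ((\<rho> - 1) * of_real t) * \<psi> t) = E (\<rho> - 1/2) (iter_deriv 2 \<phi>) t + E (\<rho> - 1/2) (iter_deriv 2 \<phi>') t" for \<rho> t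
  proof -
    have "exp ((\<rho> - 1) * of_real t) * of_real (exp (t / 2)) = exp ((\<rho> - 1/2) * of_real t)"
      unfolding exp_of_real[symmetric] exp_add[symmetric] by (rule arg_cong[of _ _ exp]) (simp add: field_simps)
    thus ?thesis unfolding \<psi>_def E_def mult.assoc[symmetric] by (simp only: distrib_left scaleR_add_right)
  qed
  have int_E: "integrable lborel (E (\<rho> - 1/2) (iter_deriv 2 \<phi>))" "integrable lborel (E (\<rho> - 1/2) (iter_deriv 2 \<phi>'))" if "\<rho> \<noteq> 1/2" for \<rho>
    using I(1,3)[of "\<rho> - 1/2"] that by simp_all
  have \<psi>: "integrable lborel (\<lambda>t. indicator {0..} t *\<^sub>R \<psi> t)"
    using Bochner_Integration.integrable_add[OF int_E[of 1]] E_\<psi>[of _ 1, symmetric] by simp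
  have "((\<lambda>\<rho>. of_int (zorder riemann_zeta \<rho>) * function_distr (\<lambda>t. exp ((\<rho> - 1/2) * of_real \<bar>t\<bar>)) \<phi>)
     has_sum (LINT t|lborel. indicator {0..} t *\<^sub>R (ZS.B t * \<psi> t))) zeta_support"
    using ZS.integral_has_sum[OF \<psi>]
  proof (rule has_sum_cong[THEN iffD1, rotated])
    fix \<rho> assume "\<rho> \<in> zeta_support"
    hence \<rho>: "\<rho> \<noteq> 1/2" using half_notin_support by blast
    show "zeta_coeff \<rho> * (LINT t|lborel. indicator {0..} t *\<^sub>R (exp ((\<rho> - 1) * of_real t) * \<psi> t)) =
       of_int (zorder riemann_zeta \<rho>) * function_distr (\<lambda>t. exp ((\<rho> - 1/2) * of_real \<bar>t\<bar>)) \<phi>"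
      unfolding E_\<psi> Bochner_Integration.integral_add[OF int_E[OF \<rho>]] using pair[of "\<rho> - 1/2"] \<rho>
      by (simp add: zeta_coeff_def)
  qed
  moreover have "(LINT t|lborel. indicator {0..} t *\<^sub>R (ZS.B t * \<psi> t)) = symmetric_cramer \<phi>"
  proof -
    obtain R where R: "R > 0" "supp \<phi> \<subseteq> {-R..R}" using test_function_bounded_support[OF \<phi>] .
    obtain R' where R': "R' > 0" "supp \<phi>' \<subseteq> {-R'..R'}" using test_function_bounded_support[OF \<phi>'] .
    obtain M M' :: nat where M: "exp R < real M" "exp R' < real M'" using reals_Archimedean2 by metis
    have c: "integrable lborel (\<lambda>t. cramer_kernel t * iter_deriv 2 \<phi> t)" "integrable lborel (\<lambda>t. cramer_kernel t * iter_deriv 2 \<phi>' t)"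
      using cramer_kernel_integral[OF \<phi> R(2) M(1)] cramer_kernel_integral[OF \<phi>' R'(2) M(2)] by (simp_all add: has_bochner_integral_iff)
    \<comment> \<open>The constant subtracted in the kernel does not contribute: the integral of the
      second derivative over the half-line is minus the first derivative at 0.\<close>
    have D: "has_bochner_integral lborel (\<lambda>t. indicator {0..} t *\<^sub>R iter_deriv 2 f t) 0"
      if f: "test_function f" "iter_deriv 1 f 0 = 0" for f
    proof -
      obtain r where r: "r > 0" "supp f \<subseteq> {-r..r}" using test_function_bounded_support[OF f(1)] .
      have "iter_deriv n f t = 0" if "t > r" for n t
      proof -
        have "t \<notin> supp f" using r that by auto
        thus ?thesis by (rule iter_deriv_outside_supp)
      qed
      hence "has_bochner_integral lborel (\<lambda>t. indicator {0..} t *\<^sub>R iter_deriv 2 f t) (- iter_deriv 1 f 0)"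
        using iter_deriv_has_vector_derivative[OF f(1), of 1] continuous_iter_deriv[OF f(1)]
        by (intro has_bochner_integral_FTC_half_line[where R = r and F = "iter_deriv 1 f"]) (auto simp: numeral_2_eq_2)
      thus ?thesis unfolding f(2) by simp
    qed
    have "has_bochner_integral lborel (\<lambda>t. cramer_kernel t * iter_deriv 2 \<phi> t + cramer_kernel t * iter_deriv 2 \<phi>' t +
        ZS.B 0 * (indicator {0..} t *\<^sub>R iter_deriv 2 \<phi> t + indicator {0..} t *\<^sub>R iter_deriv 2 \<phi>' t)) (symmetric_cramer \<phi> + ZS.B 0 * (0 + 0))"
      unfolding symmetric_cramer_eq \<phi>'_def[symmetric]
      by (intro has_bochner_integral_add has_bochner_integral_mult_right D \<phi> \<phi>' z z' has_bochner_integral_integrable c)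
    moreover have "cramer_kernel t * iter_deriv 2 \<phi> t + cramer_kernel t * iter_deriv 2 \<phi>' t +
        ZS.B 0 * (indicator {0..} t *\<^sub>R iter_deriv 2 \<phi> t + indicator {0..} t *\<^sub>R iter_deriv 2 \<phi>' t) = indicator {0..} t *\<^sub>R (ZS.B t * \<psi> t)" for t
      using K2_eq[of t] K2_0 by (auto simp: cramer_kernel_def \<psi>_def indicator_def algebra_simps)
    ultimately show ?thesis by (simp add: has_bochner_integral_iff)
  qed
  ultimately show ?thesis by simp
qed

theorem theorem7p1:
  shows "let L = (\<lambda>\<phi>.
             distr_mult (\<lambda>t. of_real (exp (- t / 2))) (W riemann_zeta (1/2)) \<phi> +
             distr_mult (\<lambda>t. of_real (exp (t / 2))) (distr_reflect (W riemann_zeta (1/2))) \<phi>)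
         in
           distribution_eq L
             (\<lambda>\<phi>. 2 * c0 riemann_zeta (1/2) * dirac 0 \<phi> -
                (\<Sum>\<^sub>\<infinity>(p, k)\<in>{p :: nat. prime p} \<times> {k :: nat. k \<ge> 1}.
                   of_real (ln (real p) * real p powr (- real k / 2)) *
                   (dirac (real k * ln (real p)) \<phi> + dirac (- (real k * ln (real p))) \<phi>))) \<and>
           (\<forall>\<phi>. test_function \<phi> \<longrightarrow> 0 \<notin> supp \<phi> \<longrightarrow>
              ((\<lambda>\<rho>. of_int (zorder riemann_zeta \<rho>) *
                  function_distr (\<lambda>t. exp ((\<rho> - 1/2) * of_real \<bar>t\<bar>)) \<phi>)
               has_sum L \<phi>) (divisor_support riemann_zeta)) \<and>
           c0 riemann_zeta (1/2) =
             of_real (- (ln pi / 2) - pi / 4 - euler_mascheroni / 2 - 3 / 2 * ln 2)"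
  unfolding Let_def symmetric_cramer_def[symmetric] c0_riemann_zeta distribution_eq_def
proof (intro conjI allI impI)
  show "is_distribution symmetric_cramer"
    by (rule is_distribution_if_explicit_sum) (rule symmetric_cramer_explicit)
  show "is_distribution (\<lambda>\<phi>. 2 * c0_value * dirac 0 \<phi> -
      (\<Sum>\<^sub>\<infinity>(p, k)\<in>{p :: nat. prime p} \<times> {k :: nat. k \<ge> 1}.
         of_real (ln (real p) * real p powr (- real k / 2)) *
         (dirac (real k * ln (real p)) \<phi> + dirac (- (real k * ln (real p))) \<phi>)))"
    by (rule is_distribution_if_explicit_sum) (rule prime_power_sum_explicit)
  fix \<phi> assume \<phi>: "test_function \<phi>"
  obtain R where R: "R > 0" "supp \<phi> \<subseteq> {-R..R}" using test_function_bounded_support[OF \<phi>] .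
  obtain M :: nat where M: "exp R < real M" using reals_Archimedean2 by blast
  show "symmetric_cramer \<phi> = 2 * c0_value * dirac 0 \<phi> -
      (\<Sum>\<^sub>\<infinity>(p, k)\<in>{p :: nat. prime p} \<times> {k :: nat. k \<ge> 1}.
         of_real (ln (real p) * real p powr (- real k / 2)) *
         (dirac (real k * ln (real p)) \<phi> + dirac (- (real k * ln (real p))) \<phi>))"
    unfolding prime_power_sum_explicit[OF \<phi> R(2) M] by (rule symmetric_cramer_explicit[OF \<phi> R(2) M])
next
  fix \<phi> assume "test_function \<phi>" "0 \<notin> supp \<phi>"
  thus "((\<lambda>\<rho>. of_int (zorder riemann_zeta \<rho>) * function_distr (\<lambda>t. exp ((\<rho> - 1/2) * of_real \<bar>t\<bar>)) \<phi>) has_sum symmetric_cramer \<phi>) zeta_support"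
    by (rule has_sum_zeros)
next
  show "c0_value = of_real (- (ln pi / 2) - pi / 4 - euler_mascheroni / 2 - 3 / 2 * ln 2)" by (simp only: c0_value_def)
qed

end
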